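(* Let $n=2p$, $J_n=\begin{pmatrix} 0 & -I_p \\ I_p & 0 \end{pmatrix}$, and let $Q\in L^1_{\mathrm{loc}}(\mathbb{R}_+,\mathbb{C}^{n\times n})$ have bounded imaginary part $Q_2=\mathrm{Im}\,Q$. Then: (i) For each $\Phi=\Phi^*\in\mathbb{C}^{p\times p}$ the boundary condition $$\mathrm{dom}\,\widetilde A_\Phi=\{y\in\mathrm{dom}\,D^+_{\max}(Q):\cos\Phi\cdot y_1(0)+\sin\Phi\cdot y_2(0)=0\},\qquad\widetilde A_\Phi=D^+_{\max}(Q)\upharpoonright\mathrm{dom}\,\widetilde A_\Phi$$ defines a quasi-selfadjoint extension $\widetilde A_\Phi\in\mathrm{Ext}\{D^+_{\min}(Q),D^+_{\min}(Q^* )\}$ satisfying $$\alpha_Q\|f\|^2\le\mathrm{Im}(\widetilde A_\Phi f,f)\le\beta_Q\|f\|^2,\ f\in\mathrm{dom}\,\widetilde A_\Phi,\qquad\text{and}\qquad\mathbb{C}_{\alpha_Q,-}\cup\mathbb{C}_{\beta_Q,+}\subset\rho(\widetilde A_\Phi).$$ (ii) For each $\lambda\in\rho(\widetilde A_\Phi)$ there exists a unique operator solution $v_\Phi(t,\lambda)=(v_{1,\Phi}(t,\lambda),v_{2,\Phi}(t,\lambda))^\top:\mathbb{C}^p\to\mathbb{C}^p\oplus\mathbb{C}^p$, $t\in\mathbb{R}_+$, of the equation $J_ny'+Q(x)y=\lambda y$ such that $v_\Phi(\cdot,\lambda)h\in L^2(\mathbb{R}_+,\mathbb{C}^n)$ for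 all $h\in\mathbb{C}^p$ and $$\cos\Phi\cdot v_{1,\Phi}(0,\lambda)+\sin\Phi\cdot v_{2,\Phi}(0,\lambda)=I_p,\qquad\lambda\in\rho(\widetilde A_\Phi).$$
   Context: $\mathbb{R}_+=[0,\infty)$ and $D(Q)y=J_ny'+Q(x)y$. The maximal operator $D^+_{\max}(Q)$ in $L^2(\mathbb{R}_+,\mathbb{C}^n)$ has domain $\{y\in L^2: y\in AC_{\mathrm{loc}}(\mathbb{R}_+,\mathbb{C}^n),\ D(Q)y\in L^2\}$ and acts as $y\mapsto D(Q)y$; the minimal operator $D^+_{\min}(Q)$ is the closure of its restriction to those $y\in\mathrm{dom}\,D^+_{\max}(Q)$ with compact support and $y(0)=0$; $(D^+_{\min}(Q))^*=D^+_{\max}(Q^* )$. Functions are written $y=\{y_1,y_2\}$ with $y_1,y_2$ being $\mathbb{C}^p$-valued. A dual pair $\{A,B\}$ consists of operators with $(Af,g)=(f,Bg)$ for $f\in\mathrm{dom}\,A$, $g\in\mathrm{dom}\,B$; $\{D^+_{\min}(Q),D^+_{\min}(Q^* )\}$ is a dual pair of closed densely defined operators. $\mathrm{Ext}\{A,B\}$ is the set of operators $\widetilde A$ with $A\subset\widetilde A\subset B^*$; such an $\widetilde A$ is quasi-selfadjoint if $\dim(\mathrm{dom}\,\widetilde A/\mathrm{dom}\,A)=\dim(\mathrm{dom}\,\widetilde A^*/\mathrm{dom}\,B)$. $Q_2(x)=\mathrm{Im}\,Q(x)=\frac1{2i}(Q(x)-Q(x)^* )$ is bounded means $\|Q_2(x)\|\le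 C$ on $\mathbb{R}_+$ for some $C$; $\alpha_Q$ and $\beta_Q$ are the essential infimum over $x\in\mathbb{R}_+$ of the smallest eigenvalue of $Q_2(x)$ and the essential supremum of the largest eigenvalue of $Q_2(x)$; $\mathbb{C}_{\alpha,+}=\{z:\mathrm{Im}\,z>\alpha\}$, $\mathbb{C}_{\alpha,-}=\{z:\mathrm{Im}\,z<\alpha\}$. $\rho$ is the resolvent set; inner products are linear in the first argument. *)

theory Defs
  imports
    "HOL-Analysis.Analysis"
    "HOL-Library.Equipollence"
    "HOL-Probability.Essential_Supremum"
begin

section \<open>The Hilbert space of square-integrable functions on the half-line\<close>

abbreviation halfline :: "real measure" where
  "halfline \<equiv> lebesgue_on {0..}"

definition square_integrable :: "(real \<Rightarrow> complex ^ 'n) \<Rightarrow> bool" where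
  "square_integrable f \<longleftrightarrow>
     f \<in> borel_measurable halfline \<and> integrable halfline (\<lambda>x. (norm (f x))\<^sup>2)"

definition cdot :: "complex ^ 'n \<Rightarrow> complex ^ 'n \<Rightarrow> complex" where
  "cdot u v = (\<Sum>i\<in>UNIV. u $ i * cnj (v $ i))"

lemma Re_cdot: "Re (cdot u v) = u \<bullet> v"
  by (simp add: cdot_def inner_vec_def inner_complex_def)

lemma cdot_self: "cdot u u = of_real ((norm u)\<^sup>2)"
proof (rule complex_eqI)
  show "Im (cdot u u) = Im (of_real ((norm u)\<^sup>2))"
    by (simp add: cdot_def)
qed (simp add: Re_cdot power2_norm_eq_inner)

lemma cdot_commute: "cdot u v = cnj (cdot v u)"
  by (simp add: cdot_def mult.commute)

lemma cdot_add_left: "cdot (u + v) w = cdot u w + cdot v w"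
  by (simp add: cdot_def sum.distrib algebra_simps)

lemma cdot_scale_left: "cdot (c *s u) w = c * cdot u w"
  by (simp add: cdot_def sum_distrib_left algebra_simps)

lemma norm_vector_scalar_mult: "norm (c *s u) = cmod c * norm (u :: complex ^ 'n)"
  by (simp add: norm_vec_def norm_mult L2_set_right_distrib)

lemma norm_cdot_le: "cmod (cdot u v) \<le> norm u * norm v"
proof -
  have "cmod (cdot u v) \<le> (\<Sum>i\<in>UNIV. \<bar>cmod (u $ i)\<bar> * \<bar>cmod (v $ i)\<bar>)"
    unfolding cdot_def by (rule order_trans[OF norm_sum]) (simp add: norm_mult)
  also have "\<dots> \<le> norm u * norm v"
    unfolding norm_vec_def by (rule L2_set_mult_ineq)
  finally show ?thesis .
qed

lemma bounded_linear_vector_scalar_mult: "bounded_linear (\<lambda>u :: complex ^ 'n. c *s u)"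
proof (rule bounded_linear_intro)
  show "c *s (x + y) = c *s x + c *s y" for x y :: "complex ^ 'n"
    by (simp add: vec_eq_iff algebra_simps)
  show "c *s (r *\<^sub>R x) = r *\<^sub>R (c *s x)" for r and x :: "complex ^ 'n"
    by (simp add: vec_eq_iff algebra_simps)
  show "norm (c *s x) \<le> norm x * cmod c" for x :: "complex ^ 'n"
    by (simp add: norm_vector_scalar_mult)
qed

lemma continuous_on_cdot: "continuous_on UNIV (\<lambda>p :: (complex ^ 'n) \<times> (complex ^ 'n). cdot (fst p) (snd p))"
  unfolding cdot_def by (intro continuous_intros)

lemma borel_measurable_cdot:
  fixes f g :: "'a \<Rightarrow> complex ^ 'n"
  assumes "f \<in> borel_measurable M" "g \<in> borel_measurable M"
  shows "(\<lambda>x. cdot (f x) (g x)) \<in> borel_measurable M"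
  using borel_measurable_continuous_Pair[OF assms continuous_on_cdot] .

lemma square_integrable_scale:
  assumes "square_integrable f" shows "square_integrable (\<lambda>x. c *s f x)"
proof -
  have "(\<lambda>x. c *s f x) \<in> borel_measurable halfline"
    using assms by (intro borel_measurable_continuous_on[where f = "\<lambda>u. c *s u"]
        linear_continuous_on bounded_linear_vector_scalar_mult) (auto simp: square_integrable_def)
  then show ?thesis
    using assms by (simp add: square_integrable_def norm_vector_scalar_mult power_mult_distrib)
qed

lemma square_integrable_add:
  assumes "square_integrable f" "square_integrable g"
  shows "square_integrable (\<lambda>x. f x + g x)"
proof -
  have m: "f \<in> borel_measurable halfline" "g \<in> borel_measurable halfline"
    using assms by (auto simp: square_integrable_def)
  have "integrable halfline (\<lambda>x. 2 * (norm (f x))\<^sup>2 + 2 * (norm (g x))\<^sup>2)"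
    using assms by (auto simp: square_integrable_def)
  then have "integrable halfline (\<lambda>x. (norm (f x + g x))\<^sup>2)"
  proof (rule Bochner_Integration.integrable_bound)
    show "(\<lambda>x. (norm (f x + g x))\<^sup>2) \<in> borel_measurable halfline"
      using m by measurable
    have "(norm (f x + g x))\<^sup>2 \<le> 2 * (norm (f x))\<^sup>2 + 2 * (norm (g x))\<^sup>2" for x
    proof -
      have "(norm (f x + g x))\<^sup>2 \<le> (norm (f x) + norm (g x))\<^sup>2"
        by (simp add: norm_triangle_ineq power_mono)
      also have "\<dots> \<le> 2 * (norm (f x))\<^sup>2 + 2 * (norm (g x))\<^sup>2"
        using sum_squares_bound[of "norm (f x)" "norm (g x)"] by (simp add: power2_sum)
      finally show ?thesis .
    qed
    then show "AE x in halfline. norm ((norm (f x + g x))\<^sup>2)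
        \<le> norm (2 * (norm (f x))\<^sup>2 + 2 * (norm (g x))\<^sup>2)"
      by (intro AE_I2) simp
  qed
  then show ?thesis
    using m by (simp add: square_integrable_def)
qed

lemma integrable_cdot:
  assumes "square_integrable f" "square_integrable g"
  shows "integrable halfline (\<lambda>x. cdot (f x) (g x))"
proof -
  have "integrable halfline (\<lambda>x. (norm (f x))\<^sup>2 + (norm (g x))\<^sup>2)"
    using assms by (auto simp: square_integrable_def)
  then show ?thesis
  proof (rule Bochner_Integration.integrable_bound)
    show "(\<lambda>x. cdot (f x) (g x)) \<in> borel_measurable halfline"
      using assms by (intro borel_measurable_cdot) (auto simp: square_integrable_def)
    have "cmod (cdot (f x) (g x)) \<le> (norm (f x))\<^sup>2 + (norm (g x))\<^sup>2" for x
    proof -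
      have "0 \<le> norm (f x) * norm (g x)" by simp
      moreover have "2 * (norm (f x) * norm (g x)) \<le> (norm (f x))\<^sup>2 + (norm (g x))\<^sup>2"
        using sum_squares_bound[of "norm (f x)" "norm (g x)"] by (simp add: mult.assoc)
      ultimately show ?thesis
        using norm_cdot_le[of "f x" "g x"] by linarith
    qed
    then show "AE x in halfline. norm (cdot (f x) (g x))
        \<le> norm ((norm (f x))\<^sup>2 + (norm (g x))\<^sup>2)"
      by (intro AE_I2) simp
  qed
qed

definition L2_eq :: "(real \<Rightarrow> complex ^ 'n) \<Rightarrow> (real \<Rightarrow> complex ^ 'n) \<Rightarrow> bool" where
  "L2_eq f g \<longleftrightarrow> square_integrable f \<and> square_integrable g \<and> (AE x in halfline. f x = g x)"

lemma square_integrable_zero: "square_integrable (\<lambda>x. 0)"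
  by (simp add: square_integrable_def)

quotient_type 'n L2 = "real \<Rightarrow> complex ^ ('n :: finite)" / partial: L2_eq
  morphisms rep_L2 L2_class
proof (rule part_equivpI)
  show "\<exists>f :: real \<Rightarrow> complex ^ 'n. L2_eq f f"
    by (rule exI[of _ "\<lambda>x. 0"]) (simp add: L2_eq_def square_integrable_zero)
  show "symp (L2_eq :: (real \<Rightarrow> complex ^ 'n) \<Rightarrow> _)"
    by (rule sympI) (auto simp: L2_eq_def elim: eventually_mono)
  show "transp (L2_eq :: (real \<Rightarrow> complex ^ 'n) \<Rightarrow> _)"
  proof (rule transpI)
    fix f g h :: "real \<Rightarrow> complex ^ 'n"
    assume "L2_eq f g" "L2_eq g h"
    moreover from this have "AE x in halfline. f x = h x"
      by (auto simp: L2_eq_def elim: eventually_elim2)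
    ultimately show "L2_eq f h" by (simp add: L2_eq_def)
  qed
qed

lift_definition scaleC_L2 :: "complex \<Rightarrow> ('n :: finite) L2 \<Rightarrow> 'n L2"
  is "\<lambda>c f x. c *s f x"
  by (auto simp: L2_eq_def square_integrable_scale elim: eventually_mono)

lift_definition cinner_L2 :: "('n :: finite) L2 \<Rightarrow> 'n L2 \<Rightarrow> complex"
  is "\<lambda>f g. integral\<^sup>L halfline (\<lambda>x. cdot (f x) (g x))"
proof -
  fix f f' g g' :: "real \<Rightarrow> complex ^ 'n"
  assume a: "L2_eq f f'" "L2_eq g g'"
  show "integral\<^sup>L halfline (\<lambda>x. cdot (f x) (g x)) = integral\<^sup>L halfline (\<lambda>x. cdot (f' x) (g' x))"
  proof (rule integral_cong_AE)
    show "AE x in halfline. cdot (f x) (g x) = cdot (f' x) (g' x)"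
      using a by (auto simp: L2_eq_def elim: eventually_elim2)
  qed (use a in \<open>auto simp: L2_eq_def square_integrable_def intro: borel_measurable_cdot\<close>)
qed

instantiation L2 :: (finite) real_inner
begin

lift_definition zero_L2 :: "'a L2" is "\<lambda>x. 0"
  by (simp add: L2_eq_def square_integrable_zero)

lift_definition plus_L2 :: "'a L2 \<Rightarrow> 'a L2 \<Rightarrow> 'a L2" is "\<lambda>f g x. f x + g x"
  by (auto simp: L2_eq_def square_integrable_add elim: eventually_elim2)

definition scaleR_L2 :: "real \<Rightarrow> 'a L2 \<Rightarrow> 'a L2" where
  "r *\<^sub>R f = scaleC_L2 (complex_of_real r) f"

definition uminus_L2 :: "'a L2 \<Rightarrow> 'a L2" where
  "- f = scaleC_L2 (- 1) f"

definition minus_L2 :: "'a L2 \<Rightarrow> 'a L2 \<Rightarrow> 'a L2" where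
  "f - g = f + (- g :: 'a L2)"

definition inner_L2 :: "'a L2 \<Rightarrow> 'a L2 \<Rightarrow> real" where
  "f \<bullet> g = Re (cinner_L2 f g)"

definition norm_L2 :: "'a L2 \<Rightarrow> real" where
  "norm f = sqrt (f \<bullet> (f :: 'a L2))"

definition sgn_L2 :: "'a L2 \<Rightarrow> 'a L2" where
  "sgn f = inverse (norm f) *\<^sub>R (f :: 'a L2)"

definition dist_L2 :: "'a L2 \<Rightarrow> 'a L2 \<Rightarrow> real" where
  "dist f g = norm (f - g :: 'a L2)"

definition uniformity_L2 :: "('a L2 \<times> 'a L2) filter" where
  "uniformity_L2 = (INF e\<in>{0<..}. principal {(x, y). dist x (y :: 'a L2) < e})"

definition open_L2 :: "'a L2 set \<Rightarrow> bool" where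
  "open_L2 S \<longleftrightarrow> (\<forall>x\<in>S. \<forall>\<^sub>F (x', y) in uniformity. x' = x \<longrightarrow> y \<in> (S :: 'a L2 set))"

lemma scaleC_L2_add_right: "scaleC_L2 c (f + g) = scaleC_L2 c f + scaleC_L2 c (g :: 'a L2)"
  by transfer (auto simp: L2_eq_def
      intro!: square_integrable_scale square_integrable_add AE_I2
      simp: vec_eq_iff algebra_simps)

lemma scaleC_L2_add_left: "scaleC_L2 (c + d) f = scaleC_L2 c f + scaleC_L2 d (f :: 'a L2)"
  by transfer (auto simp: L2_eq_def
      intro!: square_integrable_scale square_integrable_add AE_I2
      simp: vec_eq_iff algebra_simps)

lemma scaleC_L2_scaleC_L2: "scaleC_L2 c (scaleC_L2 d f) = scaleC_L2 (c * d) (f :: 'a L2)"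
  by transfer (auto simp: L2_eq_def
      intro!: square_integrable_scale AE_I2 simp: vec_eq_iff algebra_simps)

lemma scaleC_L2_one: "scaleC_L2 1 f = (f :: 'a L2)"
  by transfer (auto simp: L2_eq_def)

lemma scaleC_L2_zero: "scaleC_L2 0 f = (0 :: 'a L2)"
  by transfer (auto simp: L2_eq_def square_integrable_zero)

lemma cinner_L2_add_left: "cinner_L2 (f + g) h = cinner_L2 f h + cinner_L2 (g :: 'a L2) h"
  by transfer (auto simp: L2_eq_def cdot_add_left integrable_cdot)

lemma cinner_L2_scale_left: "cinner_L2 (scaleC_L2 c f) h = c * cinner_L2 (f :: 'a L2) h"
  by transfer (auto simp: L2_eq_def cdot_scale_left integrable_cdot)

lemma cinner_L2_commute: "cinner_L2 f g = cnj (cinner_L2 g (f :: 'a L2))"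
proof transfer
  fix f g :: "real \<Rightarrow> complex ^ 'a"
  have "cnj (integral\<^sup>L halfline (\<lambda>x. cdot (g x) (f x)))
      = integral\<^sup>L halfline (\<lambda>x. cnj (cdot (g x) (f x)))"
    by simp
  then show "integral\<^sup>L halfline (\<lambda>x. cdot (f x) (g x))
      = cnj (integral\<^sup>L halfline (\<lambda>x. cdot (g x) (f x)))"
    by (simp flip: cdot_commute)
qed

lemma cinner_L2_self_nonneg: "0 \<le> Re (cinner_L2 f (f :: 'a L2))"
  by transfer (simp add: cdot_self del: of_real_power)

lemma cinner_L2_self_eq_0: "Re (cinner_L2 f f) = 0 \<longleftrightarrow> f = (0 :: 'a L2)"
proof transfer
  fix f :: "real \<Rightarrow> complex ^ 'a"
  assume "L2_eq f f"
  then have sq: "square_integrable f" by (simp add: L2_eq_def)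
  then have int: "integrable halfline (\<lambda>x. (norm (f x))\<^sup>2)" by (simp add: square_integrable_def)
  have "Re (integral\<^sup>L halfline (\<lambda>x. cdot (f x) (f x))) = integral\<^sup>L halfline (\<lambda>x. (norm (f x))\<^sup>2)"
    by (simp add: cdot_self del: of_real_power)
  also have "\<dots> = 0 \<longleftrightarrow> (AE x in halfline. (norm (f x))\<^sup>2 = 0)"
    using int by (rule integral_nonneg_eq_0_iff_AE) simp
  also have "\<dots> \<longleftrightarrow> L2_eq f (\<lambda>x. 0)"
    using sq by (simp add: L2_eq_def square_integrable_zero)
  finally show "Re (integral\<^sup>L halfline (\<lambda>x. cdot (f x) (f x))) = 0 \<longleftrightarrow> L2_eq f (\<lambda>x. 0)" .
qed

instance
proof
  fix f g h :: "'a L2" and r s :: real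
  show "f + g + h = f + (g + h)"
    by transfer (auto simp: L2_eq_def add.assoc intro!: square_integrable_add)
  show "f + g = g + f"
    by transfer (auto simp: L2_eq_def add.commute intro!: square_integrable_add)
  show "0 + f = f"
    by transfer (auto simp: L2_eq_def)
  show "- f + f = 0"
    using scaleC_L2_add_left[of "- 1" 1 f]
    by (simp add: uminus_L2_def scaleC_L2_one scaleC_L2_zero)
  show "f - g = f + - g"
    by (fact minus_L2_def)
  show "r *\<^sub>R (f + g) = r *\<^sub>R f + r *\<^sub>R g"
    by (simp add: scaleR_L2_def scaleC_L2_add_right)
  show "(r + s) *\<^sub>R f = r *\<^sub>R f + s *\<^sub>R f"
    by (simp add: scaleR_L2_def scaleC_L2_add_left)
  show "r *\<^sub>R s *\<^sub>R f = (r * s) *\<^sub>R f"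
    by (simp add: scaleR_L2_def scaleC_L2_scaleC_L2)
  show "1 *\<^sub>R f = f"
    by (simp add: scaleR_L2_def scaleC_L2_one)
  show "dist f g = norm (f - g)"
    by (fact dist_L2_def)
  show "sgn f = inverse (norm f) *\<^sub>R f"
    by (simp add: sgn_L2_def)
  show "(uniformity :: ('a L2 \<times> 'a L2) filter)
      = (INF e\<in>{0<..}. principal {(x, y). dist x y < e})"
    by (fact uniformity_L2_def)
  show "open U \<longleftrightarrow> (\<forall>x\<in>U. \<forall>\<^sub>F (x', y) in uniformity. x' = x \<longrightarrow> y \<in> U)" for U :: "'a L2 set"
    by (fact open_L2_def)
  show "f \<bullet> g = g \<bullet> f"
    by (simp add: inner_L2_def cinner_L2_commute[of f g])
  show "(f + g) \<bullet> h = f \<bullet> h + g \<bullet> h"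
    by (simp add: inner_L2_def cinner_L2_add_left)
  show "(r *\<^sub>R f) \<bullet> g = r * (f \<bullet> g)"
    by (simp add: inner_L2_def scaleR_L2_def cinner_L2_scale_left)
  show "0 \<le> f \<bullet> f"
    by (simp add: inner_L2_def cinner_L2_self_nonneg)
  show "f \<bullet> f = 0 \<longleftrightarrow> f = 0"
    by (simp add: inner_L2_def cinner_L2_self_eq_0)
  show "norm f = sqrt (f \<bullet> f)"
    by (fact norm_L2_def)
qed

end

global_interpretation L2: vector_space "scaleC_L2 :: complex \<Rightarrow> ('n :: finite) L2 \<Rightarrow> 'n L2"
  by unfold_locales
    (simp_all add: scaleC_L2_add_right scaleC_L2_add_left scaleC_L2_scaleC_L2 scaleC_L2_one)


section \<open>Unbounded operators as graphs\<close>

definition linear_operator :: "('n :: finite L2 \<times> 'n L2) set \<Rightarrow> bool" where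
  "linear_operator T \<longleftrightarrow> single_valued T \<and> (0, 0) \<in> T
     \<and> (\<forall>f g f' g'. (f, g) \<in> T \<longrightarrow> (f', g') \<in> T \<longrightarrow> (f + f', g + g') \<in> T)
     \<and> (\<forall>c f g. (f, g) \<in> T \<longrightarrow> (scaleC_L2 c f, scaleC_L2 c g) \<in> T)"

text \<open>This is the graph of the usual adjoint when \<open>Domain T\<close> is dense; in general it
  is a linear relation.\<close>

definition adjoint_op :: "('n :: finite L2 \<times> 'n L2) set \<Rightarrow> ('n L2 \<times> 'n L2) set" where
  "adjoint_op T = {(h, k). \<forall>(f, g)\<in>T. cinner_L2 g h = cinner_L2 f k}"

definition Ext :: "('n :: finite L2 \<times> 'n L2) set \<Rightarrow> ('n L2 \<times> 'n L2) set \<Rightarrow> ('n L2 \<times> 'n L2) set set"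
  where "Ext A B = {T. linear_operator T \<and> A \<subseteq> T \<and> T \<subseteq> adjoint_op B}"

text \<open>The cosets of the elements of \<open>B\<close> are pairwise distinct and form a complex basis
  of the quotient space \<open>U/V\<close>.\<close>

definition quotient_basis :: "'n :: finite L2 set \<Rightarrow> 'n L2 set \<Rightarrow> 'n L2 set \<Rightarrow> bool" where
  "quotient_basis U V B \<longleftrightarrow> B \<subseteq> U \<and> L2.independent B \<and> L2.span B \<inter> V = {0}
     \<and> U = {u + v |u v. u \<in> L2.span B \<and> v \<in> V}"

text \<open>\<open>dim (U/V) = dim (U'/V')\<close> as cardinals, so infinite dimensions are
  covered as well.\<close>

definition quotient_dim_eq ::
    "'n :: finite L2 set \<Rightarrow> 'n L2 set \<Rightarrow> 'n L2 set \<Rightarrow> 'n L2 set \<Rightarrow> bool" where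
  "quotient_dim_eq U V U' V' \<longleftrightarrow>
     (\<exists>B B'. quotient_basis U V B \<and> quotient_basis U' V' B' \<and> B \<approx> B')"

definition quasi_selfadjoint ::
    "('n :: finite L2 \<times> 'n L2) set \<Rightarrow> ('n L2 \<times> 'n L2) set \<Rightarrow> ('n L2 \<times> 'n L2) set \<Rightarrow> bool" where
  "quasi_selfadjoint A B T \<longleftrightarrow> T \<in> Ext A B
     \<and> quotient_dim_eq (Domain T) (Domain A) (Domain (adjoint_op T)) (Domain B)"

text \<open>\<open>z\<close> is in the resolvent set iff \<open>(T - z)\<inverse>\<close> is the graph of an
  everywhere defined bounded operator \<open>R\<close>.\<close>

definition resolvent_set :: "('n :: finite L2 \<times> 'n L2) set \<Rightarrow> complex set" where
  "resolvent_set T = {z. \<exists>R. bounded_linear R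
     \<and> {(g - scaleC_L2 z f, f) |f g. (f, g) \<in> T} = {(h, R h) |h. True}}"


section \<open>Matrices\<close>

definition ctranspose :: "complex ^ 'n ^ 'm \<Rightarrow> complex ^ 'm ^ 'n" where
  "ctranspose A = (\<chi> i j. cnj (A $ j $ i))"

definition Im_matrix :: "complex ^ 'n ^ 'n \<Rightarrow> complex ^ 'n ^ 'n" where
  "Im_matrix A = mat (1 / (2 * \<i>)) ** (A - ctranspose A)"

text \<open>The class operations \<open>*\<close> and \<open>^\<close> on the type of square
  matrices act entrywise, so the library's \<open>cos\<close> and \<open>sin\<close> on Banach
  algebras do not apply.\<close>

definition matrix_power :: "complex ^ 'n ^ 'n \<Rightarrow> nat \<Rightarrow> complex ^ 'n ^ 'n" where
  "matrix_power A k = ((**) A ^^ k) (mat 1)"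

definition cos_matrix :: "complex ^ 'n ^ 'n \<Rightarrow> complex ^ 'n ^ 'n" where
  "cos_matrix A = (\<Sum>k. cos_coeff k *\<^sub>R matrix_power A k)"

definition sin_matrix :: "complex ^ 'n ^ 'n \<Rightarrow> complex ^ 'n ^ 'n" where
  "sin_matrix A = (\<Sum>k. sin_coeff k *\<^sub>R matrix_power A k)"

definition eigenvalues :: "complex ^ 'n ^ 'n \<Rightarrow> complex set" where
  "eigenvalues A = {l. \<exists>v. v \<noteq> 0 \<and> A *v v = l *s v}"

text \<open>The next two are only used for Hermitian matrices, whose eigenvalues are real.\<close>

definition smallest_eigenvalue :: "complex ^ 'n ^ 'n \<Rightarrow> real" where
  "smallest_eigenvalue A = Min (Re ` eigenvalues A)"

definition largest_eigenvalue :: "complex ^ 'n ^ 'n \<Rightarrow> real" where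
  "largest_eigenvalue A = Max (Re ` eigenvalues A)"

text \<open>Vectors in \<open>\<complex>\<^sup>2\<^sup>p\<close> are indexed by \<open>'p + 'p\<close>.  The
  following also extract the upper and lower row blocks of a matrix.\<close>

definition upper :: "'a ^ ('p::finite + 'p) \<Rightarrow> 'a ^ 'p" where
  "upper y = (\<chi> i. y $ Inl i)"

definition lower :: "'a ^ ('p::finite + 'p) \<Rightarrow> 'a ^ 'p" where
  "lower y = (\<chi> i. y $ Inr i)"

definition J :: "complex ^ ('p::finite + 'p) ^ ('p::finite + 'p)" where
  "J = (\<chi> r s. case (r, s) of
      (Inl i, Inr j) \<Rightarrow> if i = j then - 1 else 0
    | (Inr i, Inl j) \<Rightarrow> if i = j then 1 else 0
    | _ \<Rightarrow> 0)"


section \<open>The Dirac-type operators\<close>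

definition L1_loc :: "(real \<Rightarrow> 'a :: euclidean_space) \<Rightarrow> bool" where
  "L1_loc f \<longleftrightarrow> (\<forall>b\<ge>0. f absolutely_integrable_on {0..b})"

text \<open>A set \<open>D\<close> with \<open>D division_of \<Union>D\<close> is a finite set of compact
  intervals with pairwise disjoint interiors.\<close>

definition absolutely_continuous_on_interval :: "real \<Rightarrow> real \<Rightarrow> (real \<Rightarrow> 'a :: real_normed_vector) \<Rightarrow> bool"
  where "absolutely_continuous_on_interval a b f \<longleftrightarrow>
     (\<forall>e>0. \<exists>d>0. \<forall>D. D division_of \<Union>D \<and> \<Union>D \<subseteq> {a..b} \<and> (\<Sum>K\<in>D. Sup K - Inf K) < d
        \<longrightarrow> (\<Sum>K\<in>D. norm (f (Sup K) - f (Inf K))) < e)"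

definition AC_loc :: "(real \<Rightarrow> 'a :: real_normed_vector) \<Rightarrow> bool" where
  "AC_loc f \<longleftrightarrow> (\<forall>b\<ge>0. absolutely_continuous_on_interval 0 b f)"

text \<open>For \<open>y\<close> in \<open>AC_loc\<close> the derivative exists almost everywhere on the half-line.\<close>

definition dirac_expr ::
    "(real \<Rightarrow> complex ^ ('p::finite + 'p) ^ ('p::finite + 'p)) \<Rightarrow> (real \<Rightarrow> complex ^ ('p::finite + 'p)) \<Rightarrow> real \<Rightarrow> complex ^ ('p::finite + 'p)"
  where "dirac_expr Q y = (\<lambda>x. J *v vector_derivative y (at x) + Q x *v y x)"

definition max_domain ::
    "(real \<Rightarrow> complex ^ ('p::finite + 'p) ^ ('p::finite + 'p)) \<Rightarrow> (real \<Rightarrow> complex ^ ('p::finite + 'p)) set" where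
  "max_domain Q = {y. AC_loc y \<and> square_integrable y \<and> square_integrable (dirac_expr Q y)}"

definition D_max ::
    "(real \<Rightarrow> complex ^ ('p::finite + 'p) ^ ('p::finite + 'p)) \<Rightarrow> (('p::finite + 'p) L2 \<times> ('p::finite + 'p) L2) set" where
  "D_max Q = {(L2_class y, L2_class (dirac_expr Q y)) |y. y \<in> max_domain Q}"

definition D_min ::
    "(real \<Rightarrow> complex ^ ('p::finite + 'p) ^ ('p::finite + 'p)) \<Rightarrow> (('p::finite + 'p) L2 \<times> ('p::finite + 'p) L2) set" where
  "D_min Q = closure {(L2_class y, L2_class (dirac_expr Q y)) |y.
     y \<in> max_domain Q \<and> (\<exists>b\<ge>0. \<forall>x>b. y x = 0) \<and> y 0 = 0}"

definition D_bc ::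
    "(real \<Rightarrow> complex ^ ('p::finite + 'p) ^ ('p::finite + 'p)) \<Rightarrow> complex ^ 'p ^ 'p
      \<Rightarrow> (('p::finite + 'p) L2 \<times> ('p::finite + 'p) L2) set" where
  "D_bc Q \<Phi> = {(L2_class y, L2_class (dirac_expr Q y)) |y. y \<in> max_domain Q
     \<and> cos_matrix \<Phi> *v upper (y 0) + sin_matrix \<Phi> *v lower (y 0) = 0}"

text \<open>Essential extrema over the half-line; they are finite when \<open>Q\<close> is measurable with
  essentially bounded imaginary part, so \<open>real_of_ereal\<close> loses nothing.\<close>

definition alpha :: "(real \<Rightarrow> complex ^ 'n ^ 'n) \<Rightarrow> real" where
  "alpha Q = real_of_ereal
     (- esssup halfline (\<lambda>x. - ereal (smallest_eigenvalue (Im_matrix (Q x)))))"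

definition beta :: "(real \<Rightarrow> complex ^ 'n ^ 'n) \<Rightarrow> real" where
  "beta Q = real_of_ereal (esssup halfline (\<lambda>x. ereal (largest_eigenvalue (Im_matrix (Q x)))))"

definition matrix_solution ::
    "(real \<Rightarrow> complex ^ ('p::finite + 'p) ^ ('p::finite + 'p)) \<Rightarrow> complex \<Rightarrow> (real \<Rightarrow> complex ^ 'p ^ ('p::finite + 'p)) \<Rightarrow> bool"
  where "matrix_solution Q l v \<longleftrightarrow> AC_loc v
     \<and> (AE x in halfline. \<exists>v'. (v has_vector_derivative v') (at x)
          \<and> J ** v' + Q x ** v x = mat l ** v x)"

end

theory Submission
  imports Defs
begin

text \<open>
The operators are represented by graphs of pairs \<open>(y, g)\<close> with \<open>J y' + Q y = g\<close>, so that the whole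
argument takes place at the level of the differential equation.

Integration by parts. The derivative of \<open>cdot (J *v y) z\<close> is \<open>cdot g z - cdot y k\<close> when \<open>y\<close> solves
the equation for \<open>Q\<close> with right-hand side \<open>g\<close>, and \<open>z\<close> solves that for the adjoint of \<open>Q\<close> with
right-hand side \<open>k\<close>. As \<open>J\<close> is constant, the form \<open>cdot (J *v y) z\<close> is integrable for
square-integrable \<open>y\<close>, \<open>z\<close>; it has a limit at infinity, which must be 0. Hence infinity contributes
no boundary term (\<open>primitive_integrable_integral_derivative\<close>, \<open>green_formula\<close>). At 0 the boundary
condition makes the form vanish: \<open>cos \<Phi>\<close> and \<open>sin \<Phi>\<close> are commuting Hermitian matrices with
\<open>cos\<^sup>2 \<Phi> + sin\<^sup>2 \<Phi> = 1\<close> (\<open>lagrangian_cos_sin\<close>), so the condition cuts out a Lagrangian subspace.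
Therefore \<open>Im (A f, f)\<close> is the integral of the imaginary part of the form of \<open>Q\<close>, which yields the
numerical bounds (\<open>numerical_range_boundary_op\<close>).

Solvability. If the imaginary part of \<open>l - Q\<close> is definite, \<open>J y' + Q y - l y = f\<close> has a
square-integrable solution that satisfies the boundary condition (\<open>halfline_boundary_problem\<close>). On
an interval \<open>[0, b]\<close> with the condition \<open>y\<^sub>1(b) = 0\<close> added, this is a linear system of equal
numbers of equations and unknowns, and the energy identity makes it injective
(\<open>regular_boundary_problem\<close>). The same identity bounds the solutions independently of \<open>b\<close>; this
bounds their initial values (\<open>initial_value_bound\<close>), and a limit for \<open>b \<rightarrow> \<infinity>\<close> exists by compactness.
Together with the numerical bounds this puts the two half-planes into the resolvent set.

Adjoints and dimensions. Solvability for \<open>Q\<close> and for its adjoint shows that the adjoint of the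
operator with a Lagrangian boundary condition is given by the adjoint coefficient and the same
condition (\<open>adjoint_boundary_op\<close>); in particular all these operators are closed. The conditions
\<open>y\<^sub>1(0) = 0\<close> and \<open>y\<^sub>2(0) = 0\<close> are Lagrangian, and their intersection shows that the minimal operator
is given by \<open>y(0) = 0\<close> (\<open>D_min_eq_boundary_op\<close>). So \<open>y \<mapsto> y(0)\<close> identifies the quotient of the
domains with a Lagrangian subspace, which has dimension \<open>p\<close> for \<open>Q\<close> as well as for its adjoint
(\<open>quotient_basis_boundary_op\<close>): the extension is quasi-selfadjoint.

Solutions at a point of the resolvent set. A compactly supported function with the prescribed
boundary value is corrected by the resolvent of its defect; uniqueness is injectivity of the
operator minus \<open>l\<close> (\<open>resolvent_matrix_solution\<close>).

The first sections provide the real analysis of locally absolutely continuous functions on which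
this rests: integrals are differentiable almost everywhere, absolutely continuous functions are
differentiable almost everywhere and are the integrals of their derivatives, and linear systems
with locally integrable coefficients have unique solutions.\<close>

(* Below, "content" is the length of an interval, not the content of a polynomial. *)
hide_const (open) Polynomial.content

section \<open>Differentiation of integrals and of absolutely continuous functions\<close>

lemma real_segment_eq_cball:
  fixes x y :: real
  shows "cball ((x + y) / 2) (\<bar>y - x\<bar> / 2) = {min x y..max x y}"
  unfolding cball_eq_atLeastAtMost by (cases "x \<le> y") (auto simp: min_def max_def field_simps)

text \<open>By Vitali's covering lemma some disjoint subfamily of the segments covers \<open>S\<close> after a five-fold
enlargement, so an estimate of total length over finite disjoint families already controls the
outer measure of \<open>S\<close>. The segments have to start at the points of \<open>S\<close> but need not be centred
there. The lemma serves both for the differentiation of integrals and for the differentiability of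
absolutely continuous functions.\<close>

lemma vitali_segment_cover:
  fixes S :: "real set" and y :: "real \<Rightarrow> real"
  assumes seg: "\<And>x. x \<in> S \<Longrightarrow> y x \<noteq> x \<and> \<bar>y x - x\<bar> \<le> B"
    and bound: "\<And>C. finite C \<Longrightarrow> C \<subseteq> S \<Longrightarrow>
       pairwise (\<lambda>u v. disjnt {min u (y u)..max u (y u)} {min v (y v)..max v (y v)}) C \<Longrightarrow>
       (\<Sum>x\<in>C. \<bar>y x - x\<bar>) \<le> e"
  obtains T where "S \<subseteq> T" "T \<in> lmeasurable" "measure lebesgue T \<le> 5 * e"
proof -
  let ?a = "\<lambda>x. (x + y x) / 2" and ?r = "\<lambda>x. \<bar>y x - x\<bar> / 2"
  have "S \<subseteq> (\<Union>x\<in>S. cball (?a x) (?r x))"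
    by (auto simp: real_segment_eq_cball)
  moreover have "\<And>x. x \<in> S \<Longrightarrow> 0 < ?r x \<and> ?r x \<le> B / 2"
    using seg by auto
  ultimately obtain C where C: "countable C" "C \<subseteq> S"
      "pairwise (\<lambda>i j. disjnt (cball (?a i) (?r i)) (cball (?a j) (?r j))) C"
      "S \<subseteq> (\<Union>i\<in>C. cball (?a i) (5 * ?r i))"
    by (rule Vitali_covering_lemma_cballs)
  let ?T = "\<Union>i\<in>C. cball (?a i) (5 * ?r i)"
  have fin: "measure lebesgue (\<Union>i\<in>I. cball (?a i) (5 * ?r i)) \<le> 5 * e" if "I \<subseteq> C" "finite I" for I
  proof -
    have "measure lebesgue (\<Union>i\<in>I. cball (?a i) (5 * ?r i)) \<le> (\<Sum>i\<in>I. measure lebesgue (cball (?a i) (5 * ?r i)))"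
      using that by (intro measure_UNION_le) auto
    also have "\<dots> = (\<Sum>i\<in>I. 5 * \<bar>y i - i\<bar>)"
      by (intro sum.cong refl) (simp add: cball_eq_atLeastAtMost)
    also have "\<dots> = 5 * (\<Sum>i\<in>I. \<bar>y i - i\<bar>)"
      by (simp add: sum_distrib_left)
    also have "\<dots> \<le> 5 * e"
      using bound[of I] that C(2) pairwise_subset[OF C(3), of I]
      by (simp add: real_segment_eq_cball)
    finally show ?thesis .
  qed
  have "?T \<in> lmeasurable"
    by (rule fmeasurable_UN_bound[OF C(1) _ fin]) auto
  moreover have "measure lebesgue ?T \<le> 5 * e"
    by (rule measure_UN_bound[OF C(1) _ fin]) auto
  ultimately show ?thesis using that C(4) by blast
qed

text \<open>At a point where differentiability with derivative \<open>f x\<close> fails, arbitrarily short segments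
violate the linear approximation by a fixed proportion of their length. Over disjoint segments
that are fine for a suitable gauge, Henstock's lemma makes the total violation small. Hence the
total length of such segments is small, and the covering lemma bounds the bad set.\<close>

lemma negligible_not_derivative_of_integral:
  fixes f :: "real \<Rightarrow> 'a::euclidean_space"
  assumes f: "f integrable_on {a..b}"
  shows "negligible {x\<in>{a..b}. \<not> ((\<lambda>x. integral {a..x} f) has_vector_derivative f x) (at x within {a..b})}"
proof -
  define F where "F x = integral {a..x} f" for x
  define E where "E n = {x\<in>{a..b}. \<forall>d>0. \<exists>y\<in>{a..b}. \<bar>y - x\<bar> < d \<and>
    norm (F y - F x - (y - x) *\<^sub>R f x) > \<bar>y - x\<bar> / Suc n}" for n :: nat
  have diff: "integral {u..v} f = F v - F u" if "a \<le> u" "u \<le> v" "v \<le> b" for u v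
  proof -
    have "integral {a..u} f + integral {u..v} f = integral {a..v} f"
      by (rule Henstock_Kurzweil_Integration.integral_combine)
         (use that in \<open>auto intro: integrable_on_subinterval[OF f]\<close>)
    then show ?thesis by (simp add: F_def algebra_simps)
  qed
  have neg: "negligible (E n)" for n
    unfolding negligible_outer_le
  proof (intro allI impI)
    fix e :: real assume "e > 0"
    \<comment> \<open>The violation is at least the length divided by \<open>Suc n\<close>, and the covering lemma costs a factor 5.\<close>
    define e' where "e' = e / (5 * Suc n)"
    have scale: "s \<le> e / 5" if "s / q < e / (5 * q)" "q > 0" for s q :: real
      using that divide_less_cancel[of s q "e / 5"] by (simp add: mult.commute)
    have "e' > 0" using \<open>e > 0\<close> by (simp add: e'_def)
    then obtain \<gamma> where \<gamma>: "gauge \<gamma>"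
      and hen: "\<And>p. \<lbrakk>p tagged_partial_division_of (cbox a b); \<gamma> fine p\<rbrakk> \<Longrightarrow>
             (\<Sum>(x,k)\<in>p. norm (content k *\<^sub>R f x - integral k f)) < e'"
      using Henstock_lemma[of f a b e'] f by auto
    have ex: "\<exists>y. y \<in> {a..b} \<and> {min x y..max x y} \<subseteq> \<gamma> x \<and>
        norm (F y - F x - (y - x) *\<^sub>R f x) > \<bar>y - x\<bar> / Suc n" if x: "x \<in> E n" for x
    proof -
      obtain d where d: "d > 0" "ball x d \<subseteq> \<gamma> x"
        using \<gamma> by (meson gauge_def openE)
      obtain y where y: "y \<in> {a..b}" "\<bar>y - x\<bar> < d" "norm (F y - F x - (y - x) *\<^sub>R f x) > \<bar>y - x\<bar> / Suc n"
        using x d(1) unfolding E_def by blast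
      have "{min x y..max x y} \<subseteq> ball x d"
        using y(2) by (auto simp: dist_real_def min_def max_def split: if_splits)
      then show ?thesis using y d by blast
    qed
    obtain y where y: "\<And>x. x \<in> E n \<Longrightarrow> y x \<in> {a..b} \<and> {min x (y x)..max x (y x)} \<subseteq> \<gamma> x \<and>
        norm (F (y x) - F x - (y x - x) *\<^sub>R f x) > \<bar>y x - x\<bar> / Suc n"
      using ex by metis
    let ?s = "\<lambda>x. {min x (y x)..max x (y x)}"
    obtain T where "E n \<subseteq> T" "T \<in> lmeasurable" "measure lebesgue T \<le> 5 * (e / 5)"
    proof (rule vitali_segment_cover[of "E n" y "b - a" "e/5"])
      show "y x \<noteq> x \<and> \<bar>y x - x\<bar> \<le> b - a" if "x \<in> E n" for x
        using y[OF that] that by (force simp: E_def)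
      fix C assume C: "finite C" "C \<subseteq> E n" "pairwise (\<lambda>u v. disjnt (?s u) (?s v)) C"
      define p where "p = (\<lambda>x. (x, ?s x)) ` C"
      have inj: "inj_on (\<lambda>x. (x, ?s x)) C" by (auto simp: inj_on_def)
      have p: "p tagged_partial_division_of (cbox a b)"
        unfolding tagged_partial_division_of_def
      proof (intro conjI allI impI)
        show "finite p" using C by (simp add: p_def)
        fix x K assume "(x, K) \<in> p"
        then have x: "x \<in> C" "K = ?s x" by (auto simp: p_def)
        then have "x \<in> {a..b}" "y x \<in> {a..b}" using y C(2) by (auto simp: E_def)
        then show "x \<in> K" "K \<subseteq> cbox a b" using x by auto
        show "\<exists>a b. K = cbox a b" using x by (metis box_real(2))
      next
        fix x1 K1 x2 K2 assume "(x1, K1) \<in> p \<and> (x2, K2) \<in> p \<and> (x1, K1) \<noteq> (x2, K2)"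
        then have "disjnt K1 K2" using C(3) by (auto simp: p_def pairwise_def)
        then show "interior K1 \<inter> interior K2 = {}"
          using interior_subset by (fastforce simp: disjnt_def)
      qed
      have "\<gamma> fine p" using y C(2) unfolding p_def fine_def by blast
      then have "(\<Sum>(x,k)\<in>p. norm (content k *\<^sub>R f x - integral k f)) < e'" using hen p by blast
      then have less: "(\<Sum>x\<in>C. norm (content (?s x) *\<^sub>R f x - integral (?s x) f)) < e'"
        unfolding p_def by (simp add: sum.reindex[OF inj])
      have "(\<Sum>x\<in>C. \<bar>y x - x\<bar> / Suc n) \<le> (\<Sum>x\<in>C. norm (content (?s x) *\<^sub>R f x - integral (?s x) f))"
      proof (rule sum_mono)
        fix x assume "x \<in> C"
        then have x: "x \<in> {a..b}" "y x \<in> {a..b}" "norm (F (y x) - F x - (y x - x) *\<^sub>R f x) > \<bar>y x - x\<bar> / Suc n"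
          using y C(2) by (auto simp: E_def)
        have "norm (content (?s x) *\<^sub>R f x - integral (?s x) f) = norm (F (y x) - F x - (y x - x) *\<^sub>R f x)"
        proof (cases "x \<le> y x")
          case True
          then show ?thesis using x diff[of x "y x"] by (simp add: norm_minus_commute)
        next
          case False
          then show ?thesis using x diff[of "y x" x]
            by (simp add: min_def max_def) (simp add: algebra_simps)
        qed
        then show "\<bar>y x - x\<bar> / Suc n \<le> norm (content (?s x) *\<^sub>R f x - integral (?s x) f)"
          using x by simp
      qed
      then have "(\<Sum>x\<in>C. \<bar>y x - x\<bar>) / Suc n < e'"
        using less by (simp add: sum_divide_distrib)
      then show "(\<Sum>x\<in>C. \<bar>y x - x\<bar>) \<le> e / 5"
        unfolding e'_def using scale[of "\<Sum>x\<in>C. \<bar>y x - x\<bar>" "real (Suc n)"] by simp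
    qed
    then show "\<exists>T. E n \<subseteq> T \<and> T \<in> lmeasurable \<and> measure lebesgue T \<le> e" by auto
  qed
  have "{x\<in>{a..b}. \<not> (F has_vector_derivative f x) (at x within {a..b})} \<subseteq> (\<Union>n. E n)"
  proof clarify
    fix x assume x: "x \<in> {a..b}" and nd: "\<not> (F has_vector_derivative f x) (at x within {a..b})"
    have bl: "bounded_linear (\<lambda>t. t *\<^sub>R f x)" by (rule bounded_linear_scaleR_left)
    obtain e where e: "e > 0" "\<And>d. d > 0 \<Longrightarrow> \<exists>y\<in>{a..b}. \<bar>y - x\<bar> < d \<and>
        \<not> norm (F y - F x - (y - x) *\<^sub>R f x) \<le> e * \<bar>y - x\<bar>"
      using nd bl unfolding has_vector_derivative_def has_derivative_within_alt by auto
    obtain n where n: "inverse (real (Suc n)) < e" using reals_Archimedean[OF e(1)] by auto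
    have "x \<in> E n" unfolding E_def
    proof (intro CollectI conjI allI impI)
      fix d :: real assume "d > 0"
      then obtain y where y: "y \<in> {a..b}" "\<bar>y - x\<bar> < d" "norm (F y - F x - (y - x) *\<^sub>R f x) > e * \<bar>y - x\<bar>"
        using e(2)[of d] by (auto simp: not_le)
      have "\<bar>y - x\<bar> / Suc n \<le> e * \<bar>y - x\<bar>"
        using mult_right_mono[OF less_imp_le[OF n], of "\<bar>y - x\<bar>"] by (simp add: divide_inverse mult.commute)
      with y show "\<exists>y\<in>{a..b}. \<bar>y - x\<bar> < d \<and> norm (F y - F x - (y - x) *\<^sub>R f x) > \<bar>y - x\<bar> / Suc n"
        by (intro bexI[of _ y]) auto
    qed (use x in auto)
    then show "x \<in> (\<Union>n. E n)" by blast
  qed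
  moreover have "negligible (\<Union>n. E n)" using neg by (intro negligible_Union_nat) auto
  ultimately show ?thesis unfolding F_def using negligible_subset by blast
qed

lemma negligible_imp_open_cover:
  fixes N :: "real set"
  assumes "negligible N" "e > 0"
  obtains U where "open U" "N \<subseteq> U" "U \<in> lmeasurable" "measure lebesgue U < e"
proof -
  have N: "N \<in> null_sets lebesgue" using assms by (simp add: negligible_iff_null_sets)
  obtain U where U: "open U" "N \<subseteq> U" "U - N \<in> lmeasurable" "emeasure lebesgue (U - N) < ennreal e"
    using sets_lebesgue_outer_open[of N e] N assms by auto
  have UN: "U = (U - N) \<union> N" using U by auto
  have lm: "U \<in> lmeasurable"
    using U(3) assms(1) UN by (metis fmeasurable.Un negligible_imp_measurable)
  have "emeasure lebesgue U = emeasure lebesgue (U - N)"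
    using N U(1) by (simp add: emeasure_Diff_null_set)
  then have "measure lebesgue U < e"
    using U(4) lm assms(2) by (simp add: emeasure_eq_measure2) (metis ennreal_less_iff measure_nonneg)
  with U lm show ?thesis using that by blast
qed

lemma absolutely_continuous_onE:
  assumes "absolutely_continuous_on_interval a b F" "e > 0"
  obtains d where "d > 0" "\<And>D. D division_of \<Union>D \<Longrightarrow> \<Union>D \<subseteq> {a..b} \<Longrightarrow>
      (\<Sum>K\<in>D. Sup K - Inf K) < d \<Longrightarrow> (\<Sum>K\<in>D. norm (F (Sup K) - F (Inf K))) < e"
proof -
  obtain d where "d > 0" "\<forall>D. D division_of \<Union>D \<and> \<Union>D \<subseteq> {a..b} \<and> (\<Sum>K\<in>D. Sup K - Inf K) < d
        \<longrightarrow> (\<Sum>K\<in>D. norm (F (Sup K) - F (Inf K))) < e"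
    using assms(1)[unfolded absolutely_continuous_on_interval_def, THEN spec, THEN mp, OF assms(2)] by (elim exE conjE)
  then show ?thesis by (intro that[of d]) simp_all
qed

text \<open>The gauge treats the two kinds of tags differently. Off \<open>N\<close> differentiability makes the error a
small multiple of the length. Tags in \<open>N\<close> are confined to an open set of small measure, and
there absolute continuity makes the total increment of \<open>F\<close> small.\<close>

lemma integral_derivative_absolutely_continuous:
  fixes F :: "real \<Rightarrow> 'a::euclidean_space"
  assumes "a \<le> b" and ac: "absolutely_continuous_on_interval a b F" and N: "negligible N"
    and deriv: "\<And>x. x \<in> {a..b} - N \<Longrightarrow> (F has_vector_derivative f x) (at x within {a..b})"
  shows "(f has_integral F b - F a) {a..b}"
proof -
  define f' where "f' x = (if x \<in> N then 0 else f x)" for x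
  have "(f' has_integral F b - F a) {a..b}"
    unfolding has_integral_real
  proof (intro allI impI)
    fix e :: real assume "e > 0"
    then have "e / 2 > 0" by simp
    obtain d where d: "d > 0" and dac: "\<And>D. D division_of \<Union>D \<Longrightarrow> \<Union>D \<subseteq> {a..b} \<Longrightarrow>
        (\<Sum>K\<in>D. Sup K - Inf K) < d \<Longrightarrow> (\<Sum>K\<in>D. norm (F (Sup K) - F (Inf K))) < e / 2"
      by (rule absolutely_continuous_onE[OF ac \<open>e / 2 > 0\<close>]) (rule that, assumption, simp)
    obtain U where U: "open U" "N \<subseteq> U" "U \<in> lmeasurable" "measure lebesgue U < d"
      using negligible_imp_open_cover[OF N d] by blast
    define c where "c = e / (2 * (b - a + 1))"
    have c: "c > 0" "c * (b - a) \<le> e / 2" using \<open>e > 0\<close> \<open>a \<le> b\<close> by (auto simp: c_def field_simps)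
    have "\<exists>\<delta>>0. x \<in> {a..b} - N \<longrightarrow> (\<forall>y\<in>{a..b}. \<bar>y - x\<bar> < \<delta> \<longrightarrow> norm (F y - F x - (y - x) *\<^sub>R f x) \<le> c * \<bar>y - x\<bar>)" for x
    proof (cases "x \<in> {a..b} - N")
      case True
      show ?thesis
        using deriv[OF True] c(1) unfolding has_vector_derivative_def has_derivative_within_alt by auto
    qed (auto intro: exI[of _ 1])
    then obtain \<delta> where \<delta>: "\<And>x. \<delta> x > 0"
      "\<And>x y. x \<in> {a..b} - N \<Longrightarrow> y \<in> {a..b} \<Longrightarrow> \<bar>y - x\<bar> < \<delta> x \<Longrightarrow> norm (F y - F x - (y - x) *\<^sub>R f x) \<le> c * \<bar>y - x\<bar>"
      by metis
    define \<gamma> where "\<gamma> x = (if x \<in> N then U else ball x (\<delta> x))" for x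
    have g: "gauge \<gamma>" using U \<delta> by (auto simp: gauge_def \<gamma>_def)
    have est: "norm ((\<Sum>(x, k)\<in>D. content k *\<^sub>R f' x) - (F b - F a)) < e"
      if D: "D tagged_division_of {a..b}" and fine: "\<gamma> fine D" for D
    proof -
      have Dp: "D tagged_partial_division_of {a..b}" "finite D"
        using D by (auto simp: tagged_division_of_def tagged_partial_division_of_def)
      let ?g = "\<lambda>(x, K). content K *\<^sub>R f' x - (F (Sup K) - F (Inf K))"
      have K: "\<exists>u v. K = {u..v} \<and> u \<le> x \<and> x \<le> v \<and> a \<le> u \<and> v \<le> b" if xK: "(x, K) \<in> D" for x K
      proof -
        obtain u v where "K = cbox u v" "x \<in> K" "K \<subseteq> {a..b}"
          using tagged_division_ofD(2-4)[OF D xK] by blast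
        then show ?thesis by (intro exI[of _ u] exI[of _ v]) auto
      qed
      have Kne: "K \<noteq> {}" if "(x, K) \<in> D" for x K using K[OF that] by auto
      have eq: "(\<Sum>(x, k)\<in>D. content k *\<^sub>R f' x) - (F b - F a) = sum ?g D"
        by (simp add: additive_tagged_division_1[OF \<open>a \<le> b\<close> D, symmetric] sum_subtractf[symmetric] case_prod_beta)
      define D1 where "D1 = {(x, K) \<in> D. x \<in> N}"
      have D1: "D1 \<subseteq> D" by (auto simp: D1_def)
      have D1p: "D1 tagged_partial_division_of {a..b}"
        by (rule tagged_partial_division_subset[OF Dp(1) D1])
      let ?d = "\<lambda>K. if K = {} then 0 else norm (F (Sup K) - F (Inf K))"
      have "(\<Sum>p\<in>D1. norm (?g p)) = (\<Sum>(x, K)\<in>D1. ?d K)"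
        using Kne D1 by (intro sum.cong) (auto simp: D1_def f'_def norm_minus_commute)
      also have "\<dots> = sum ?d (snd ` D1)"
      proof (rule sum.over_tagged_division_lemma[OF tagged_partial_division_of_Union_self[OF D1p]])
        show "?d (cbox u v) = 0" if "box u v = {}" for u v :: real
          using that by (cases "u = v") auto
      qed
      also have "\<dots> \<le> (\<Sum>K\<in>snd ` D1. norm (F (Sup K) - F (Inf K)))"
        by (rule sum_mono) auto
      also have "\<dots> < e / 2"
      proof (rule dac)
        show div: "snd ` D1 division_of \<Union> (snd ` D1)"
          by (rule partial_division_of_tagged_division[OF D1p])
        show "\<Union> (snd ` D1) \<subseteq> {a..b}" using K D1 by fastforce
        have "(\<Sum>K\<in>snd ` D1. Sup K - Inf K) = (\<Sum>K\<in>snd ` D1. content K)"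
          using K D1 by (intro sum.cong refl) fastforce
        also have "\<dots> = measure lebesgue (\<Union> (snd ` D1))"
        proof -
          have "content K = measure lebesgue K" if "K \<in> snd ` D1" for K
            using that K D1 by fastforce
          then show ?thesis using content_division[OF div] by simp
        qed
        also have "\<dots> \<le> measure lebesgue U"
        proof (rule measure_mono_fmeasurable)
          show "\<Union> (snd ` D1) \<subseteq> U"
            using fine D1 unfolding fine_def D1_def \<gamma>_def by fastforce
          show "\<Union> (snd ` D1) \<in> sets lebesgue"
            using lmeasurable_division[OF div] by auto
        qed (use U in auto)
        also have "\<dots> < d" by (rule U)
        finally show "(\<Sum>K\<in>snd ` D1. Sup K - Inf K) < d" .
      qed
      finally have 1: "(\<Sum>p\<in>D1. norm (?g p)) < e / 2" .
      have "(\<Sum>p\<in>D - D1. norm (?g p)) \<le> (\<Sum>(x, K)\<in>D - D1. c * content K)"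
      proof (intro sum_mono, clarsimp simp: case_prod_beta)
        fix x K assume xK: "(x, K) \<in> D" "(x, K) \<notin> D1"
        then obtain u v where uv: "K = {u..v}" "u \<le> x" "x \<le> v" "a \<le> u" "v \<le> b" using K by blast
        have x: "x \<in> {a..b} - N" using xK uv by (auto simp: D1_def)
        have sub: "{u..v} \<subseteq> ball x (\<delta> x)"
          using fine xK x uv unfolding fine_def \<gamma>_def by fastforce
        have "u \<in> ball x (\<delta> x)" "v \<in> ball x (\<delta> x)" using uv by (auto simp del: mem_ball intro: subsetD[OF sub])
        then have "norm (F v - F x - (v - x) *\<^sub>R f x) \<le> c * (v - x)"
          "norm (F u - F x - (u - x) *\<^sub>R f x) \<le> c * (x - u)"
          using \<delta>(2)[OF x, of v] \<delta>(2)[OF x, of u] uv by (auto simp: dist_real_def)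
        moreover have "(v - u) *\<^sub>R f x - (F v - F u) = (F u - F x - (u - x) *\<^sub>R f x) - (F v - F x - (v - x) *\<^sub>R f x)"
          by (simp add: algebra_simps)
        ultimately have "norm ((v - u) *\<^sub>R f x - (F v - F u)) \<le> c * (x - u) + c * (v - x)"
          by (simp only:) (rule order_trans[OF norm_triangle_ineq4], linarith)
        then show "norm (content K *\<^sub>R f' x - (F (Sup K) - F (Inf K))) \<le> c * content K"
          using uv x by (simp add: f'_def right_diff_distrib)
      qed
      also have "\<dots> \<le> (\<Sum>(x, K)\<in>D. c * content K)"
        using Dp c by (intro sum_mono2) auto
      also have "\<dots> = c * (\<Sum>(x, K)\<in>D. content K)"
        by (simp add: sum_distrib_left case_prod_beta)
      also have "\<dots> = c * (b - a)"
        using additive_content_tagged_division[of D a b] D \<open>a \<le> b\<close> by simp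
      finally have 2: "(\<Sum>p\<in>D - D1. norm (?g p)) \<le> e / 2" using c by simp
      have "norm (sum ?g D) \<le> (\<Sum>p\<in>D. norm (?g p))" by (rule norm_sum)
      also have "\<dots> = (\<Sum>p\<in>D - D1. norm (?g p)) + (\<Sum>p\<in>D1. norm (?g p))"
        by (rule sum.subset_diff[OF D1 Dp(2)])
      finally show ?thesis using 1 2 unfolding eq by simp
    qed
    show "\<exists>\<gamma>. gauge \<gamma> \<and> (\<forall>D. D tagged_division_of {a..b} \<and> \<gamma> fine D \<longrightarrow>
       norm ((\<Sum>(x, k)\<in>D. content k *\<^sub>R f' x) - (F b - F a)) < e)"
      by (intro exI[of _ \<gamma>] conjI allI impI g) (erule conjE, rule est, assumption+)
  qed
  then show ?thesis
    by (rule has_integral_spike[OF N, rotated]) (auto simp: f'_def)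
qed

text \<open>Consider the last point up to which a slightly raised function has not fallen below its initial
value; if it were not \<open>b\<close>, one could step past it. The raise is \<open>e (x - a)\<close>, plus \<open>\<bar>K\<bar>\<close> times the
measure of the part of an open set \<open>U \<supseteq> N\<close> to the left of \<open>x\<close>: inside \<open>U\<close> the last term
outweighs the largest decrease that the Lipschitz condition permits. Only some small step is
required at each point, so an upper derivative along a sequence suffices.\<close>

lemma le_of_upper_derivative_nonneg_AE:
  fixes H :: "real \<Rightarrow> real"
  assumes ab: "a \<le> b"
    and lip: "\<And>x y. x \<in> {a..b} \<Longrightarrow> y \<in> {a..b} \<Longrightarrow> \<bar>H x - H y\<bar> \<le> K * \<bar>x - y\<bar>"
    and N: "negligible N"
    and step: "\<And>x e. x \<in> {a..<b} - N \<Longrightarrow> e > 0 \<Longrightarrow> \<exists>h>0. x + h \<le> b \<and> H (x + h) - H x \<ge> - e * h"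
  shows "H a \<le> H b"
proof (rule field_le_epsilon)
  fix e0 :: real assume "e0 > 0"
  define e where "e = e0 / (b - a + \<bar>K\<bar> + 1)"
  have e: "e > 0" "e * (b - a + \<bar>K\<bar>) \<le> e0"
    using \<open>e0 > 0\<close> ab by (auto simp: e_def field_simps)
  have lip': "\<bar>H x - H y\<bar> \<le> \<bar>K\<bar> * \<bar>x - y\<bar>" if "x \<in> {a..b}" "y \<in> {a..b}" for x y
    using lip[OF that] abs_ge_self[of K] by (meson abs_ge_zero mult_right_mono order_trans)
  obtain U where U: "open U" "N \<subseteq> U" "U \<in> lmeasurable" "measure lebesgue U < e"
    using negligible_imp_open_cover[OF N e(1)] by blast
  define \<phi> where "\<phi> x = measure lebesgue (U \<inter> {a..x})" for x
  have Um: "U \<inter> {u<..v} \<in> lmeasurable" "U \<inter> {u..v} \<in> lmeasurable" for u v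
    using U(3) by (auto intro: fmeasurable_Int_fmeasurable)
  have \<phi>_diff: "\<phi> y - \<phi> x = measure lebesgue (U \<inter> {x<..y})" if "a \<le> x" "x \<le> y" for x y
  proof -
    have "U \<inter> {a..y} = (U \<inter> {a..x}) \<union> (U \<inter> {x<..y})" using that by auto
    moreover have "(U \<inter> {a..x}) \<inter> (U \<inter> {x<..y}) = {}" by auto
    then have "measure lebesgue ((U \<inter> {a..x}) \<union> (U \<inter> {x<..y})) = \<phi> x + measure lebesgue (U \<inter> {x<..y})"
      using measure_Un3[OF Um(2) Um(1), of a x x y] by (simp add: \<phi>_def)
    ultimately show ?thesis by (simp add: \<phi>_def)
  qed
  have \<phi>_lip: "0 \<le> \<phi> y - \<phi> x \<and> \<phi> y - \<phi> x \<le> y - x" if "a \<le> x" "x \<le> y" for x y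
  proof -
    have "measure lebesgue (U \<inter> {x<..y}) \<le> measure lebesgue {x<..y}"
    proof (rule measure_mono_fmeasurable)
      show "{x<..y} \<in> lmeasurable" by (rule fmeasurableI) (use that in auto)
    qed (use Um in auto)
    then show ?thesis using \<phi>_diff[OF that] that by simp
  qed
  have \<phi>_b: "\<phi> b \<le> e"
    using measure_mono_fmeasurable[of "U \<inter> {a..b}" U lebesgue] U(3,4) Um by (auto simp: \<phi>_def)
  have \<phi>_a: "\<phi> a = 0"
  proof -
    have "\<phi> a \<le> measure lebesgue {a}"
      unfolding \<phi>_def by (rule measure_mono_fmeasurable) (use Um(2)[of a a] lmeasurable_cbox[of a a] in auto)
    then show ?thesis by (simp add: \<phi>_def measure_le_0_iff)
  qed
  define G where "G x = H x + e * (x - a) + \<bar>K\<bar> * \<phi> x" for x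
  have "continuous_on {a..b} H"
    by (rule lipschitz_on_continuous_on[of "\<bar>K\<bar>"]) (auto simp: lipschitz_on_def dist_real_def intro!: lip')
  moreover have "continuous_on {a..b} \<phi>"
  proof (rule lipschitz_on_continuous_on[of 1])
    show "1-lipschitz_on {a..b} \<phi>"
      unfolding lipschitz_on_def dist_real_def
    proof (intro conjI ballI)
      fix x y assume "x \<in> {a..b}" "y \<in> {a..b}"
      then show "\<bar>\<phi> x - \<phi> y\<bar> \<le> 1 * \<bar>x - y\<bar>"
        using \<phi>_lip[of x y] \<phi>_lip[of y x] by (cases "x \<le> y") auto
    qed simp
  qed
  ultimately have contG: "continuous_on {a..b} G"
    unfolding G_def by (intro continuous_intros)
  define S where "S = {x \<in> {a..b}. G x \<in> {G a..}}"
  have "compact S"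
  proof -
    have "S = {a..b} \<inter> G -` {G a..}" by (auto simp: S_def)
    then have "closed S" using continuous_closed_preimage[OF contG, of "{G a..}"] by simp
    moreover have "bounded S" by (rule bounded_subset[of "{a..b}"]) (auto simp: S_def)
    ultimately show ?thesis by (simp add: compact_eq_bounded_closed)
  qed
  moreover have "a \<in> S" using ab by (simp add: S_def)
  ultimately obtain s where s: "s \<in> S" "\<And>t. t \<in> S \<Longrightarrow> t \<le> s"
    using compact_attains_sup[of S] by blast
  have "s = b"
  proof (rule ccontr)
    assume "s \<noteq> b"
    then have s': "a \<le> s" "s < b" "G s \<ge> G a" using s by (auto simp: S_def)
    have "\<exists>h>0. s + h \<le> b \<and> G (s + h) \<ge> G s"
    proof (cases "s \<in> U")
      case True
      then obtain r where r: "r > 0" "ball s r \<subseteq> U" using U(1) by (meson openE)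
      define h where "h = min (r / 2) (b - s)"
      have h: "h > 0" "h < r" "s + h \<le> b" using r s' by (auto simp: h_def)
      have "{s<..s + h} \<subseteq> U" using r h by (auto simp: subset_iff dist_real_def)
      then have "U \<inter> {s<..s + h} = {s<..s + h}" by blast
      then have "\<phi> (s + h) - \<phi> s = h" using \<phi>_diff[of s "s + h"] h s' by simp
      moreover have "H (s + h) - H s \<ge> - (\<bar>K\<bar> * h)" using lip'[of "s + h" s] h s' by auto
      ultimately have "G (s + h) - G s \<ge> e * h"
        unfolding G_def by (simp add: algebra_simps)
      moreover have "e * h > 0" using h e by simp
      ultimately have "G s \<le> G (s + h)" by linarith
      then show ?thesis using h by blast
    next
      case False
      then have "s \<in> {a..<b} - N" using U s' by auto
      then obtain h where h: "h > 0" "s + h \<le> b" "H (s + h) - H s \<ge> - e * h"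
        using step e(1) by blast
      have "\<bar>K\<bar> * (\<phi> (s + h) - \<phi> s) \<ge> 0" using \<phi>_lip[of s "s + h"] h s' by simp
      then have "G (s + h) \<ge> G s" using h(3) unfolding G_def by (simp add: algebra_simps)
      then show ?thesis using h by blast
    qed
    then obtain h where "h > 0" "s + h \<le> b" "G (s + h) \<ge> G s" by blast
    then show False using s(2)[of "s + h"] s' by (auto simp: S_def)
  qed
  then have "G a \<le> G b" using s by (auto simp: S_def)
  then have "H a \<le> H b + e * (b - a) + \<bar>K\<bar> * \<phi> b" by (simp add: G_def \<phi>_a)
  also have "\<dots> \<le> H b + e * (b - a) + \<bar>K\<bar> * e" using \<phi>_b by (simp add: mult_left_mono)
  also have "\<dots> \<le> H b + e0" using e(2) by (simp add: algebra_simps)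
  finally show "H a \<le> H b + e0" .
qed

lemma limsup_real_approx:
  fixes q :: "nat \<Rightarrow> real"
  assumes bound: "\<And>n. \<bar>q n\<bar> \<le> K" and e: "e > 0"
  defines "g \<equiv> real_of_ereal (limsup (\<lambda>n. ereal (q n)))"
  shows "\<bar>g\<bar> \<le> K" "eventually (\<lambda>n. q n < g + e) sequentially" "\<exists>n\<ge>m. q n > g - e"
proof -
  have q: "- K \<le> q n" "q n \<le> K" for n using bound[of n] by auto
  have up: "limsup (\<lambda>n. ereal (q n)) \<le> ereal K"
    by (rule Limsup_bounded) (auto simp: q)
  have lo: "ereal (- K) \<le> limsup (\<lambda>n. ereal (q n))"
    by (rule le_Limsup) (auto simp: q simp del: uminus_ereal.simps)
  have g: "ereal g = limsup (\<lambda>n. ereal (q n))"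
    unfolding g_def by (rule ereal_real') (use up lo in auto)
  show "\<bar>g\<bar> \<le> K" using up lo unfolding g[symmetric] by (simp add: abs_le_iff)
  have "limsup (\<lambda>n. ereal (q n)) < ereal (g + e)" unfolding g[symmetric] using e by simp
  from Limsup_lessD[OF this] show "eventually (\<lambda>n. q n < g + e) sequentially" by simp
  show "\<exists>n\<ge>m. q n > g - e"
  proof (rule ccontr)
    assume "\<not> ?thesis"
    then have "eventually (\<lambda>n. ereal (q n) \<le> ereal (g - e)) sequentially"
      unfolding eventually_sequentially by (auto simp: not_less)
    then have "limsup (\<lambda>n. ereal (q n)) \<le> ereal (g - e)" by (rule Limsup_bounded)
    then show False unfolding g[symmetric] using e by simp
  qed
qed

text \<open>The candidate for the derivative is the upper limit \<open>g\<close> of the difference quotients along the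
steps \<open>1/(n+1)\<close>. The integral \<open>G\<close> of \<open>g\<close> has derivative \<open>g\<close> almost everywhere. Along these
steps, the difference quotients of \<open>F - G\<close> have upper limit 0 there, and those of \<open>G - F\<close> are
eventually above any negative number. So both functions are nondecreasing, whence \<open>F\<close> is the
integral of \<open>g\<close> up to a constant.\<close>

lemma lipschitz_differentiable_AE:
  fixes F :: "real \<Rightarrow> real"
  assumes lip: "\<And>x y. \<bar>F x - F y\<bar> \<le> K * \<bar>x - y\<bar>"
  obtains N where "negligible N" "\<And>x. x \<in> {a..b} - N \<Longrightarrow> \<exists>D. (F has_vector_derivative D) (at x within {a..b})"
proof (cases "a \<le> b")
  case False
  then show ?thesis using that[of "{}"] by auto
next
  case ab: True
  define q where "q n x = real (Suc n) * (F (x + 1 / Suc n) - F x)" for n x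
  have qb: "\<bar>q n x\<bar> \<le> K" for n x
  proof -
    have "\<bar>q n x\<bar> = real (Suc n) * \<bar>F (x + 1 / Suc n) - F x\<bar>" by (simp add: q_def abs_mult)
    also have "\<dots> \<le> real (Suc n) * (K * \<bar>x + 1 / Suc n - x\<bar>)"
      by (rule mult_left_mono[OF lip]) simp
    also have "\<dots> = K" by (simp del: of_nat_Suc)
    finally show ?thesis .
  qed
  define g where "g x = real_of_ereal (limsup (\<lambda>n. ereal (q n x)))" for x
  have gK: "\<bar>g x\<bar> \<le> K"
    and g_above: "e > 0 \<Longrightarrow> eventually (\<lambda>n. q n x < g x + e) sequentially"
    and g_below: "e > 0 \<Longrightarrow> \<exists>n\<ge>m. q n x > g x - e" for x e m
    unfolding g_def using limsup_real_approx[of "\<lambda>n. q n x" K] qb zero_less_one by blast+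
  have contF: "continuous_on UNIV F"
    by (rule lipschitz_on_continuous_on[of "\<bar>K\<bar>"])
       (auto simp: lipschitz_on_def dist_real_def intro!: order_trans[OF lip] mult_right_mono)
  have "q n \<in> borel_measurable borel" for n
    unfolding q_def
    by (intro borel_measurable_continuous_onI continuous_intros continuous_on_compose2[OF contF]) auto
  then have "g \<in> borel_measurable borel" unfolding g_def by measurable
  then have "g \<in> borel_measurable lborel" by simp
  then have gm: "g \<in> borel_measurable (lebesgue_on {a..b})"
    by (intro measurable_restrict_space1 measurable_completion)
  have gi: "g integrable_on {a..b}"
    by (rule measurable_bounded_by_integrable_imp_integrable[OF gm, of "\<lambda>x. K"]) (use gK in auto)
  define G where "G x = integral {a..x} g" for x
  have G_lip: "\<bar>G x - G y\<bar> \<le> K * \<bar>x - y\<bar>" if "x \<in> {a..b}" "y \<in> {a..b}" for x y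
  proof -
    have *: "\<bar>G v - G u\<bar> \<le> K * (v - u)" if "a \<le> u" "u \<le> v" "v \<le> b" for u v
    proof -
      have gi': "g integrable_on {c..d}" if "a \<le> c" "d \<le> b" for c d
        by (rule integrable_on_subinterval[OF gi]) (use that in auto)
      have "integral {a..u} g + integral {u..v} g = integral {a..v} g"
        by (rule Henstock_Kurzweil_Integration.integral_combine) (use that gi' in auto)
      then have "G v - G u = integral {u..v} g" by (simp add: G_def)
      moreover have "norm (integral {u..v} g) \<le> K * content {u..v}"
      proof (rule has_integral_bound[of K g _ u v, unfolded box_real])
        show "0 \<le> K" using qb[of 0 0] by linarith
        show "(g has_integral integral {u..v} g) {u..v}" using gi'[of u v] that by (simp add: integrable_integral)
      qed (use gK in auto)
      ultimately show ?thesis using that by simp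
    qed
    show ?thesis using *[of x y] *[of y x] that by (cases "x \<le> y") auto
  qed
  define N where "N = {x\<in>{a..b}. \<not> (G has_vector_derivative g x) (at x within {a..b})}"
  have N: "negligible N"
    unfolding N_def G_def by (rule negligible_not_derivative_of_integral[OF gi])
  have small: "\<exists>m. \<forall>n\<ge>m. 1 / real (Suc n) < d" if d: "d > 0" for d :: real
  proof -
    obtain m where m: "inverse (real (Suc m)) < d" using reals_Archimedean[OF d] by blast
    have "1 / real (Suc n) < d" if "n \<ge> m" for n
    proof -
      have "inverse (real (Suc n)) \<le> inverse (real (Suc m))" using that by (intro le_imp_inverse_le) auto
      then have "inverse (real (Suc n)) < d" using m by linarith
      then show ?thesis by (simp add: divide_inverse del: of_nat_Suc)
    qed
    then show ?thesis by blast
  qed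
  have G_step: "\<exists>m. \<forall>n\<ge>m. x + 1 / real (Suc n) \<le> c \<and>
      \<bar>G (x + 1 / real (Suc n)) - G x - 1 / real (Suc n) * g x\<bar> \<le> e * (1 / real (Suc n))"
    if x: "x \<in> {a..<c} - N" and c: "c \<le> b" and e: "e > 0" for x c e
  proof -
    have "(G has_vector_derivative g x) (at x within {a..b})" using x c by (auto simp: N_def)
    then obtain d where d: "d > 0" "\<And>y. y \<in> {a..b} \<Longrightarrow> \<bar>y - x\<bar> < d \<Longrightarrow> \<bar>G y - G x - (y - x) * g x\<bar> \<le> e * \<bar>y - x\<bar>"
      using e unfolding has_vector_derivative_def has_derivative_within_alt by (auto simp: real_norm_def)
    obtain m where m: "\<And>n. n \<ge> m \<Longrightarrow> 1 / real (Suc n) < min d (c - x)"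
      using small[of "min d (c - x)"] d x by auto
    have "x + 1 / real (Suc n) \<le> c \<and>
      \<bar>G (x + 1 / real (Suc n)) - G x - 1 / real (Suc n) * g x\<bar> \<le> e * (1 / real (Suc n))" if "n \<ge> m" for n
    proof -
      define h where "h = 1 / real (Suc n)"
      have h: "h > 0" "h < d" "h < c - x" using m[OF that] by (auto simp: h_def)
      show ?thesis using d(2)[of "x + h"] h x c unfolding h_def[symmetric] by auto
    qed
    then show ?thesis by blast
  qed
  have q_eq: "F (x + 1 / real (Suc n)) - F x = 1 / real (Suc n) * q n x" for x n
    by (simp add: q_def del: of_nat_Suc)
  have eq: "F c = F a + G c" if c: "c \<in> {a..b}" for c
  proof -
    have "s * (F a - G a) \<le> s * (F c - G c)" if s: "s = 1 \<or> s = - 1" for s :: real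
    proof (rule le_of_upper_derivative_nonneg_AE[where H = "\<lambda>x. s * (F x - G x)" and K = "2 * K" and N = N])
      show "\<bar>s * (F x - G x) - s * (F y - G y)\<bar> \<le> 2 * K * \<bar>x - y\<bar>" if "x \<in> {a..c}" "y \<in> {a..c}" for x y
        using lip[of x y] G_lip[of x y] that c s by auto
      show "\<exists>h>0. x + h \<le> c \<and> s * (F (x + h) - G (x + h)) - s * (F x - G x) \<ge> - e * h"
        if x: "x \<in> {a..<c} - N" and e: "e > 0" for x e
      proof -
        have e2: "e / 2 > 0" using e by simp
        have cb: "c \<le> b" using c by simp
        obtain m where m: "\<And>n. n \<ge> m \<Longrightarrow> x + 1 / real (Suc n) \<le> c \<and>
           \<bar>G (x + 1 / real (Suc n)) - G x - 1 / real (Suc n) * g x\<bar> \<le> e / 2 * (1 / real (Suc n))"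
          using G_step[OF x cb e2] by blast
        obtain m' where m': "\<And>n. n \<ge> m' \<Longrightarrow> q n x < g x + e / 2"
          using g_above[OF e2, of x] unfolding eventually_sequentially by blast
        obtain n' where n': "n' \<ge> m" "q n' x > g x - e / 2" using g_below[OF e2] by blast
        have "\<exists>n\<ge>m. s * (q n x - g x) \<ge> - (e / 2)"
        proof (cases "s = 1")
          case True
          then show ?thesis using n' by (intro exI[of _ n']) auto
        next
          case False
          then show ?thesis using s m'[of "max m m'"] by (intro exI[of _ "max m m'"]) auto
        qed
        then obtain n where n: "n \<ge> m" "s * (q n x - g x) \<ge> - (e / 2)" by blast
        define h where "h = 1 / real (Suc n)"
        have h: "h > 0" by (simp add: h_def)
        have "h * (s * (q n x - g x)) \<ge> h * - (e / 2)" using n h by (intro mult_left_mono) auto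
        moreover have "\<bar>G (x + h) - G x - h * g x\<bar> \<le> e / 2 * h" "x + h \<le> c"
          using m[of n] n unfolding h_def by auto
        moreover have "F (x + h) - F x = h * q n x" using q_eq[of x n] by (simp add: h_def)
        ultimately show ?thesis using h s unfolding abs_le_iff
          by (intro exI[of _ h]) (auto simp: algebra_simps)
      qed
    qed (use c N in auto)
    from this[of 1] this[of "- 1"] show ?thesis by (simp add: G_def)
  qed
  show ?thesis
  proof (rule that[OF N])
    fix x assume x: "x \<in> {a..b} - N"
    then have "(G has_vector_derivative g x) (at x within {a..b})" by (auto simp: N_def)
    then have "((\<lambda>x. F a + G x) has_vector_derivative g x) (at x within {a..b})"
      using has_vector_derivative_add[OF has_vector_derivative_const[of "F a"], of G "g x"] by simp
    then have "(F has_vector_derivative g x) (at x within {a..b})"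
      by (rule has_vector_derivative_transform[rotated 2]) (use x in blast, rule eq)
    then show "\<exists>D. (F has_vector_derivative D) (at x within {a..b})" by blast
  qed
qed

lemma absolutely_continuous_on_continuous:
  fixes F :: "real \<Rightarrow> 'a::real_normed_vector"
  assumes "absolutely_continuous_on_interval a b F"
  shows "continuous_on {a..b} F"
proof (rule uniformly_continuous_imp_continuous, unfold uniformly_continuous_on_def, intro allI impI)
  fix e :: real assume "e > 0"
  obtain d where d: "d > 0" "\<And>D. D division_of \<Union>D \<Longrightarrow> \<Union>D \<subseteq> {a..b} \<Longrightarrow>
      (\<Sum>K\<in>D. Sup K - Inf K) < d \<Longrightarrow> (\<Sum>K\<in>D. norm (F (Sup K) - F (Inf K))) < e"
    by (rule absolutely_continuous_onE[OF assms \<open>e > 0\<close>]) (rule that, assumption, simp)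
  have *: "dist (F v) (F u) < e" if "u \<in> {a..b}" "v \<in> {a..b}" "u \<le> v" "v - u < d" for u v
    using d(2)[of "{{u..v}}"] that division_of_self[of u v] by (auto simp: dist_norm)
  show "\<exists>d>0. \<forall>x\<in>{a..b}. \<forall>x'\<in>{a..b}. dist x' x < d \<longrightarrow> dist (F x') (F x) < e"
  proof (intro exI[of _ d] conjI ballI impI)
    fix x x' assume "x \<in> {a..b}" "x' \<in> {a..b}" "dist x' x < d"
    then show "dist (F x') (F x) < e"
      using *[of x x'] *[of x' x] by (cases "x \<le> x'") (auto simp: dist_commute dist_real_def)
  qed (use d in auto)
qed

text \<open>McShane's extension: the largest \<open>c\<close>-Lipschitz function that is at most \<open>f\<close> on \<open>A\<close>.\<close>

lemma lipschitz_envelope: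
  fixes f :: "real \<Rightarrow> real"
  assumes "k0 \<in> A" and below: "\<forall>k\<in>A. m \<le> f k" and "c \<ge> 0"
  defines "u \<equiv> \<lambda>x. INF k\<in>A. f k + c * \<bar>x - k\<bar>"
  shows "\<bar>u x - u y\<bar> \<le> c * \<bar>x - y\<bar>"
    and "k \<in> A \<Longrightarrow> u x \<le> f k + c * \<bar>x - k\<bar>"
    and "(\<And>k. k \<in> A \<Longrightarrow> r \<le> f k + c * \<bar>x - k\<bar>) \<Longrightarrow> r \<le> u x"
proof -
  have bdd: "bdd_below ((\<lambda>k. f k + c * \<bar>x - k\<bar>) ` A)" for x
    by (rule bdd_belowI2[of _ m]) (use below \<open>c \<ge> 0\<close> in \<open>simp add: add_increasing2\<close>)
  show up: "u x \<le> f k + c * \<bar>x - k\<bar>" if "k \<in> A" for k x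
    unfolding u_def by (rule cINF_lower[OF bdd that])
  show lo: "r \<le> u x" if "\<And>k. k \<in> A \<Longrightarrow> r \<le> f k + c * \<bar>x - k\<bar>" for r x
    unfolding u_def by (rule cINF_greatest) (use that \<open>k0 \<in> A\<close> in auto)
  have "u x - c * \<bar>x - y\<bar> \<le> u y" for x y
  proof (rule lo)
    fix k assume k: "k \<in> A"
    have "c * \<bar>x - k\<bar> \<le> c * (\<bar>x - y\<bar> + \<bar>y - k\<bar>)" using \<open>c \<ge> 0\<close> by (intro mult_left_mono) auto
    then show "u x - c * \<bar>x - y\<bar> \<le> f k + c * \<bar>y - k\<bar>" using up[OF k, of x] by (simp add: distrib_left)
  qed
  from this[of x y] this[of y x] show "\<bar>u x - u y\<bar> \<le> c * \<bar>x - y\<bar>" by (simp add: abs_le_iff abs_minus_commute)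
qed

text \<open>Let \<open>A n\<close> consist of the points from which all slopes are at most \<open>n\<close>. Outside \<open>A n\<close> every point
starts a segment of slope more than \<open>n\<close>; by absolute continuity disjoint segments of this kind
have total length at most \<open>1/n\<close>, so the complement of the union of the \<open>A n\<close> is null. On \<open>A n\<close> the
function touches two \<open>n\<close>-Lipschitz functions that enclose it. Where both are differentiable, their
derivatives agree because the gap between them has a minimum, and \<open>F\<close> is squeezed in between.\<close>

lemma absolutely_continuous_real_differentiable_AE:
  fixes F :: "real \<Rightarrow> real"
  assumes ac: "absolutely_continuous_on_interval a b F"
  obtains N where "negligible N" "\<And>x. x \<in> {a<..<b} - N \<Longrightarrow> \<exists>D. (F has_vector_derivative D) (at x)"
proof -
  define A where "A n = {x\<in>{a..b}. \<forall>y\<in>{a..b}. \<bar>F y - F x\<bar> \<le> real n * \<bar>y - x\<bar>}" for n :: nat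
  have "bounded (F ` {a..b})"
    by (intro compact_imp_bounded compact_continuous_image absolutely_continuous_on_continuous[OF ac]) simp
  then obtain M where M: "M > 0" "\<And>x. x \<in> {a..b} \<Longrightarrow> \<bar>F x\<bar> \<le> M"
    unfolding bounded_pos by auto
  obtain d where d: "d > 0" and dac: "\<And>D. D division_of \<Union>D \<Longrightarrow> \<Union>D \<subseteq> {a..b} \<Longrightarrow>
      (\<Sum>K\<in>D. Sup K - Inf K) < d \<Longrightarrow> (\<Sum>K\<in>D. norm (F (Sup K) - F (Inf K))) < 1"
    by (rule absolutely_continuous_onE[OF ac zero_less_one]) (rule that, assumption, simp)
  have negE: "negligible ({a..b} - (\<Union>n. A n))"
    unfolding negligible_outer_le
  proof (intro allI impI)
    fix e :: real assume e: "e > 0"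
    \<comment> \<open>A segment of slope above \<open>n\<close> is shorter than \<open>2M/n\<close>; \<open>n > c\<close> makes this less than \<open>d/2\<close>,
      makes \<open>1/n\<close> at most \<open>d/2\<close>, and makes the bound \<open>5/n\<close> of the covering lemma at most \<open>e\<close>.\<close>
    define c where "c = max (max (4 * M / d) (2 / d)) (5 / e)"
    obtain n :: nat where n: "real n > c" using reals_Archimedean2 by blast
    have "0 < 5 / e" "5 / e \<le> c" using e by (simp_all add: c_def)
    then have "c > 0" by linarith
    then have "real n > 0" using n by linarith
    then have n': "real n > 0" "2 * M / n < d / 2" "1 / n \<le> d / 2" "5 * (1 / n) \<le> e"
      using n d e M by (auto simp: c_def field_simps)
    have "\<exists>y. y \<in> {a..b} \<and> \<bar>F y - F x\<bar> > real n * \<bar>y - x\<bar>" if "x \<in> {a..b} - A n" for x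
      using that by (auto simp: A_def not_le)
    then obtain y where y: "\<And>x. x \<in> {a..b} - A n \<Longrightarrow> y x \<in> {a..b} \<and> \<bar>F (y x) - F x\<bar> > real n * \<bar>y x - x\<bar>"
      by metis
    let ?s = "\<lambda>x. {min x (y x)..max x (y x)}"
    have small: "\<bar>y x - x\<bar> < d / 2" if "x \<in> {a..b} - A n" for x
    proof -
      have "real n * \<bar>y x - x\<bar> < 2 * M" using y[OF that] M(2)[of x] M(2)[of "y x"] that by auto
      then have "\<bar>y x - x\<bar> < 2 * M / n" using n' by (simp add: field_simps)
      then show ?thesis using n' by simp
    qed
    obtain T where T: "{a..b} - A n \<subseteq> T" "T \<in> lmeasurable" "measure lebesgue T \<le> 5 * (1 / n)"
    proof (rule vitali_segment_cover[of "{a..b} - A n" y "d / 2" "1 / n"])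
      show "y x \<noteq> x \<and> \<bar>y x - x\<bar> \<le> d / 2" if "x \<in> {a..b} - A n" for x
        using y[OF that] small[OF that] by auto
      fix C assume "finite C" "C \<subseteq> {a..b} - A n" "pairwise (\<lambda>u v. disjnt (?s u) (?s v)) C"
      \<comment> \<open>Absolute continuity applies only to families of total length below \<open>d\<close>. Adding the segments
        one at a time keeps this true: each is shorter than \<open>d/2\<close> and the earlier ones have total
        length at most \<open>1/n \<le> d/2\<close>.\<close>
      then show "(\<Sum>x\<in>C. \<bar>y x - x\<bar>) \<le> 1 / n"
      proof (induction C rule: finite_induct)
        case empty
        then show ?case by simp
      next
        case (insert z C)
        have dis: "pairwise (\<lambda>u v. disjnt (?s u) (?s v)) C"
          using insert.prems(2) by (rule pairwise_subset) auto
        have "(\<Sum>x\<in>C. \<bar>y x - x\<bar>) \<le> 1 / n" using insert dis by blast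
        then have less: "(\<Sum>x\<in>insert z C. \<bar>y x - x\<bar>) < d"
          using insert small[of z] n' by simp
        let ?C = "insert z C"
        have inj: "inj_on ?s ?C"
        proof (rule inj_onI, rule ccontr)
          fix u v assume uv: "u \<in> ?C" "v \<in> ?C" "?s u = ?s v" "u \<noteq> v"
          then have "disjnt (?s u) (?s u)" using insert.prems(2) unfolding pairwise_def by metis
          moreover have "u \<in> ?s u" by auto
          ultimately show False unfolding disjnt_def by blast
        qed
        have "(\<Sum>K\<in>?s ` ?C. norm (F (Sup K) - F (Inf K))) < 1"
        proof (rule dac)
          show "?s ` ?C division_of \<Union> (?s ` ?C)"
          proof (rule division_ofI)
            show "finite (?s ` ?C)" using insert by simp
            fix K assume "K \<in> ?s ` ?C"
            then obtain u where u: "u \<in> ?C" "K = ?s u" by auto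
            show "K \<subseteq> \<Union> (?s ` ?C)" using u by blast
            show "K \<noteq> {}" using u by auto
            show "\<exists>a b. K = cbox a b" using u by (metis box_real(2))
          next
            fix K1 K2 assume "K1 \<in> ?s ` ?C" "K2 \<in> ?s ` ?C" "K1 \<noteq> K2"
            then obtain u v where uv: "u \<in> ?C" "v \<in> ?C" "K1 = ?s u" "K2 = ?s v" "u \<noteq> v" by auto
            have "disjnt K1 K2"
              using pairwiseD[OF insert.prems(2) uv(1,2,5)] unfolding uv(3,4) .
            then show "interior K1 \<inter> interior K2 = {}"
              using interior_subset[of K1] interior_subset[of K2] unfolding disjnt_def by blast
          qed simp
          have "?s u \<subseteq> {a..b}" if "u \<in> ?C" for u
            using y[of u] insert.prems(1) that by auto
          then show "\<Union> (?s ` ?C) \<subseteq> {a..b}" by blast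
          have "(\<Sum>K\<in>?s ` ?C. Sup K - Inf K) = (\<Sum>x\<in>?C. \<bar>y x - x\<bar>)"
            unfolding sum.reindex[OF inj] by (intro sum.cong refl) auto
          then show "(\<Sum>K\<in>?s ` ?C. Sup K - Inf K) < d" using less by simp
        qed
        also have "(\<Sum>K\<in>?s ` ?C. norm (F (Sup K) - F (Inf K))) = (\<Sum>x\<in>?C. \<bar>F (y x) - F x\<bar>)"
          unfolding sum.reindex[OF inj] by (intro sum.cong refl) (auto simp: min_def max_def abs_minus_commute)
        finally have "(\<Sum>x\<in>?C. \<bar>F (y x) - F x\<bar>) < 1" .
        moreover have "(\<Sum>x\<in>?C. real n * \<bar>y x - x\<bar>) \<le> (\<Sum>x\<in>?C. \<bar>F (y x) - F x\<bar>)"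
          using y insert.prems(1) by (intro sum_mono less_imp_le) blast
        ultimately have "real n * (\<Sum>x\<in>?C. \<bar>y x - x\<bar>) < 1"
          by (simp only: sum_distrib_left)
        then show ?case using n' by (subst pos_le_divide_eq) (simp_all add: mult.commute)
      qed
    qed
    then show "\<exists>T. {a..b} - (\<Union>n. A n) \<subseteq> T \<and> T \<in> lmeasurable \<and> measure lebesgue T \<le> e"
      using n' by (intro exI[of _ T]) auto
  qed
  have "\<exists>N. negligible N \<and> (\<forall>x\<in>A n \<inter> {a<..<b} - N. \<exists>D. (F has_vector_derivative D) (at x))" for n
  proof (cases "A n = {}")
    case True
    then show ?thesis by (intro exI[of _ "{}"]) auto
  next
    case False
    then obtain k0 where k0: "k0 \<in> A n" by blast
    define U where "U x = (INF k\<in>A n. F k + real n * \<bar>x - k\<bar>)" for x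
    define V where "V x = (INF k\<in>A n. - F k + real n * \<bar>x - k\<bar>)" for x
    have lb: "\<forall>k\<in>A n. - M \<le> F k" "\<forall>k\<in>A n. - M \<le> - F k"
      using M(2) by (fastforce simp: A_def)+
    note U = lipschitz_envelope[of k0 "A n" "- M" F "real n", OF k0 lb(1) of_nat_0_le_iff, folded U_def]
    note V = lipschitz_envelope[of k0 "A n" "- M" "\<lambda>x. - F x" "real n", OF k0 lb(2) of_nat_0_le_iff, folded V_def]
    have FU: "F y \<le> U y" "- F y \<le> V y" if "y \<in> {a..b}" for y
    proof -
      show "F y \<le> U y"
      proof (rule U(3))
        fix k assume "k \<in> A n"
        then have "\<bar>F y - F k\<bar> \<le> real n * \<bar>y - k\<bar>" using that by (auto simp: A_def)
        then show "F y \<le> F k + real n * \<bar>y - k\<bar>" by simp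
      qed
      show "- F y \<le> V y"
      proof (rule V(3))
        fix k assume "k \<in> A n"
        then have "\<bar>F y - F k\<bar> \<le> real n * \<bar>y - k\<bar>" using that by (auto simp: A_def)
        then show "- F y \<le> - F k + real n * \<bar>y - k\<bar>" by simp
      qed
    qed
    have eq: "U x = F x" "V x = - F x" if "x \<in> A n" for x
    proof -
      have "x \<in> {a..b}" using that by (auto simp: A_def)
      then show "U x = F x" "V x = - F x" using FU[of x] U(2)[OF that, of x] V(2)[OF that, of x] by auto
    qed
    obtain N1 where N1: "negligible N1" "\<And>x. x \<in> {a..b} - N1 \<Longrightarrow> \<exists>D. (U has_vector_derivative D) (at x within {a..b})"
      by (rule lipschitz_differentiable_AE[of U "real n", OF U(1)]) (rule that, assumption, simp)
    obtain N2 where N2: "negligible N2" "\<And>x. x \<in> {a..b} - N2 \<Longrightarrow> \<exists>D. (V has_vector_derivative D) (at x within {a..b})"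
      by (rule lipschitz_differentiable_AE[of V "real n", OF V(1)]) (rule that, assumption, simp)
    have "\<exists>D. (F has_vector_derivative D) (at x)" if x: "x \<in> A n \<inter> {a<..<b} - (N1 \<union> N2)" for x
    proof -
      have at: "at x within {a..b} = at x" using x by (intro at_within_interior) auto
      have xab: "x \<in> {a..b} - N1" "x \<in> {a..b} - N2" using x by auto
      obtain D1 where D1: "(U has_vector_derivative D1) (at x)" using N1(2)[OF xab(1)] unfolding at by blast
      obtain D2 where D2: "(V has_vector_derivative D2) (at x)" using N2(2)[OF xab(2)] unfolding at by blast
      obtain r where r: "r > 0" "ball x r \<subseteq> {a<..<b}"
        using x open_greaterThanLessThan[of a b] by (metis DiffD1 IntD2 openE)
      have "((\<lambda>t. U t + V t) has_real_derivative D1 + D2) (at x)"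
        unfolding has_real_derivative_iff_has_vector_derivative by (intro derivative_intros D1 D2)
      then have "D1 + D2 = 0"
      proof (rule DERIV_local_min[OF _ r(1)])
        show "\<forall>y. \<bar>x - y\<bar> < r \<longrightarrow> U x + V x \<le> U y + V y"
        proof (intro allI impI)
          fix y assume "\<bar>x - y\<bar> < r"
          then have "y \<in> ball x r" by (simp add: dist_real_def)
          then have "y \<in> {a..b}" using r(2) by auto
          then show "U x + V x \<le> U y + V y" using FU[of y] eq[of x] x by auto
        qed
      qed
      then have D2': "D2 = - D1" by simp
      have "(F has_vector_derivative D1) (at x)"
        unfolding has_vector_derivative_def has_derivative_at_alt
      proof (intro conjI allI impI bounded_linear_scaleR_left)
        fix e :: real assume e: "e > 0"
        obtain d1 where d1: "d1 > 0" "\<And>y. norm (y - x) < d1 \<Longrightarrow> norm (U y - U x - (y - x) *\<^sub>R D1) \<le> e * norm (y - x)"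
          using D1 e unfolding has_vector_derivative_def has_derivative_at_alt by blast
        obtain d2 where d2: "d2 > 0" "\<And>y. norm (y - x) < d2 \<Longrightarrow> norm (V y - V x - (y - x) *\<^sub>R D2) \<le> e * norm (y - x)"
          using D2 e unfolding has_vector_derivative_def has_derivative_at_alt by blast
        have "norm (F y - F x - (y - x) *\<^sub>R D1) \<le> e * norm (y - x)" if "norm (y - x) < min r (min d1 d2)" for y
        proof -
          have "y \<in> ball x r" using that by (auto simp: dist_real_def)
          then have "y \<in> {a..b}" using r(2) by auto
          then show ?thesis using d1(2)[of y] d2(2)[of y] FU[of y] eq[of x] x that D2' by (auto simp: abs_le_iff)
        qed
        then show "\<exists>d>0. \<forall>y. norm (y - x) < d \<longrightarrow> norm (F y - F x - (y - x) *\<^sub>R D1) \<le> e * norm (y - x)"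
          using r d1 d2 by (intro exI[of _ "min r (min d1 d2)"]) auto
      qed
      then show ?thesis by blast
    qed
    then show ?thesis using N1(1) N2(1) by (intro exI[of _ "N1 \<union> N2"]) (auto intro: negligible_Un)
  qed
  then obtain N where N: "\<And>n. negligible (N n)"
      "\<And>n x. x \<in> A n \<inter> {a<..<b} - N n \<Longrightarrow> \<exists>D. (F has_vector_derivative D) (at x)"
    by metis
  show ?thesis
  proof (rule that)
    show "negligible (({a..b} - (\<Union>n. A n)) \<union> (\<Union>n. N n))"
      using negE N(1) by (intro negligible_Un negligible_Union_nat) auto
    fix x assume x: "x \<in> {a<..<b} - (({a..b} - (\<Union>n. A n)) \<union> (\<Union>n. N n))"
    then have "x \<in> {a..b}" by auto
    with x obtain n where "x \<in> A n" by blast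
    with x N(2)[of x n] show "\<exists>D. (F has_vector_derivative D) (at x)" by blast
  qed
qed

lemma absolutely_continuous_differentiable_AE:
  fixes F :: "real \<Rightarrow> 'a::euclidean_space"
  assumes ac: "absolutely_continuous_on_interval a b F"
  obtains N where "negligible N" "\<And>x. x \<in> {a<..<b} - N \<Longrightarrow> \<exists>D. (F has_vector_derivative D) (at x)"
proof -
  have "\<exists>N. negligible N \<and> (\<forall>x\<in>{a<..<b} - N. \<exists>D. ((\<lambda>x. F x \<bullet> i) has_vector_derivative D) (at x))" if i: "i \<in> Basis" for i
  proof -
    have "absolutely_continuous_on_interval a b (\<lambda>x. F x \<bullet> i)"
      unfolding absolutely_continuous_on_interval_def
    proof (intro allI impI)
      fix e :: real assume e: "e > 0"
      obtain d where d: "d > 0" and dac: "\<And>D. D division_of \<Union>D \<Longrightarrow> \<Union>D \<subseteq> {a..b} \<Longrightarrow>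
          (\<Sum>K\<in>D. Sup K - Inf K) < d \<Longrightarrow> (\<Sum>K\<in>D. norm (F (Sup K) - F (Inf K))) < e"
        by (rule absolutely_continuous_onE[OF ac e]) (rule that, assumption, simp)
      have "(\<Sum>K\<in>D. norm (F (Sup K) \<bullet> i - F (Inf K) \<bullet> i)) \<le> (\<Sum>K\<in>D. norm (F (Sup K) - F (Inf K)))" for D
        by (intro sum_mono) (metis Basis_le_norm i inner_diff_left real_norm_def)
      then show "\<exists>d>0. \<forall>D. D division_of \<Union>D \<and> \<Union>D \<subseteq> {a..b} \<and> (\<Sum>K\<in>D. Sup K - Inf K) < d
         \<longrightarrow> (\<Sum>K\<in>D. norm (F (Sup K) \<bullet> i - F (Inf K) \<bullet> i)) < e"
        using d dac by (intro exI[of _ d]) (auto intro: le_less_trans)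
    qed
    then obtain N where "negligible N" "\<And>x. x \<in> {a<..<b} - N \<Longrightarrow> \<exists>D. ((\<lambda>x. F x \<bullet> i) has_vector_derivative D) (at x)"
      by (rule absolutely_continuous_real_differentiable_AE) (rule that, assumption, simp)
    then show ?thesis by blast
  qed
  then obtain N where N: "\<And>i. i \<in> Basis \<Longrightarrow> negligible (N i)"
      "\<And>i x. i \<in> Basis \<Longrightarrow> x \<in> {a<..<b} - N i \<Longrightarrow> \<exists>D. ((\<lambda>x. F x \<bullet> i) has_vector_derivative D) (at x)"
    by metis
  show ?thesis
  proof (rule that)
    show "negligible (\<Union>i\<in>Basis. N i)" using N(1) by (intro negligible_Union) auto
    fix x assume x: "x \<in> {a<..<b} - (\<Union>i\<in>Basis. N i)"
    then have "\<exists>D. ((\<lambda>x. F x \<bullet> i) has_vector_derivative D) (at x)" if "i \<in> Basis" for i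
      using N(2)[OF that] that by blast
    then obtain D where D: "\<And>i. i \<in> Basis \<Longrightarrow> ((\<lambda>x. F x \<bullet> i) has_vector_derivative D i) (at x)"
      by metis
    have "(F has_vector_derivative (\<Sum>i\<in>Basis. D i *\<^sub>R i)) (at x)"
      unfolding has_vector_derivative_def
    proof (subst has_derivative_componentwise_within, rule ballI)
      fix i :: 'a assume i: "i \<in> Basis"
      have "(\<lambda>t. (t *\<^sub>R (\<Sum>i\<in>Basis. D i *\<^sub>R i)) \<bullet> i) = (\<lambda>t. t *\<^sub>R D i)"
        using i by (simp only: inner_scaleR_left inner_sum_left_Basis) simp
      then show "((\<lambda>x. F x \<bullet> i) has_derivative (\<lambda>t. (t *\<^sub>R (\<Sum>i\<in>Basis. D i *\<^sub>R i)) \<bullet> i)) (at x)"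
        using D[OF i] by (simp only: has_vector_derivative_def)
    qed
    then show "\<exists>D. (F has_vector_derivative D) (at x)" by blast
  qed
qed

section \<open>Almost everywhere on the half-line\<close>

lemma AE_halfline_iff: "(AE x in halfline. P x) \<longleftrightarrow> negligible {x. x \<ge> 0 \<and> \<not> P x}"
proof -
  have "(AE x in halfline. P x) \<longleftrightarrow> (AE x in lebesgue. x \<ge> 0 \<longrightarrow> P x)"
    by (subst AE_restrict_space_iff) auto
  also have "\<dots> \<longleftrightarrow> negligible {x. x \<ge> 0 \<and> \<not> P x}"
    unfolding eventually_ae_filter_negligible not_imp
    by (metis (no_types, lifting) negligible_subset order_refl)
  finally show ?thesis .
qed

lemma AE_halflineI:
  assumes "negligible N" "\<And>x. x \<ge> 0 \<Longrightarrow> x \<notin> N \<Longrightarrow> P x"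
  shows "AE x in halfline. P x"
  unfolding AE_halfline_iff by (rule negligible_subset[OF assms(1)]) (use assms(2) in auto)

lemma AE_halflineE:
  assumes "AE x in halfline. P x"
  obtains N where "negligible N" "\<And>x. x \<ge> 0 \<Longrightarrow> x \<notin> N \<Longrightarrow> P x"
  by (rule that[of "{x. x \<ge> 0 \<and> \<not> P x}"]) (use assms[unfolded AE_halfline_iff] in auto)

lemma AE_halfline_local:
  assumes "\<And>n::nat. n > 0 \<Longrightarrow> \<exists>N. negligible N \<and> (\<forall>x\<in>{0<..<real n} - N. P x)"
  shows "AE x in halfline. P x"
proof -
  obtain N where N: "\<And>n::nat. n > 0 \<Longrightarrow> negligible (N n) \<and> (\<forall>x\<in>{0<..<real n} - N n. P x)"
    using assms by metis
  show ?thesis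
  proof (rule AE_halflineI)
    show "negligible ({0} \<union> (\<Union>n. N (Suc n)))"
      using N by (intro negligible_Un negligible_Union_nat) auto
    fix x :: real assume x: "x \<ge> 0" "x \<notin> {0} \<union> (\<Union>n. N (Suc n))"
    obtain n :: nat where "x < real n" using reals_Archimedean2 by blast
    then have "x < real (Suc n)" by simp
    then show "P x" using N[of "Suc n"] x by auto
  qed
qed

section \<open>Locally integrable functions\<close>

lemma L1_loc_integrable:
  assumes "L1_loc f" "0 \<le> a"
  shows "f integrable_on {a..b}" "f absolutely_integrable_on {a..b}" "(\<lambda>x. norm (f x)) integrable_on {a..b}"
proof -
  show *: "f absolutely_integrable_on {a..b}"
  proof (cases "a \<le> b")
    case True
    then have "f absolutely_integrable_on {0..b}" using assms by (auto simp: L1_loc_def)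
    then show ?thesis by (rule absolutely_integrable_on_subinterval) (use assms in auto)
  qed auto
  then show "f integrable_on {a..b}" "(\<lambda>x. norm (f x)) integrable_on {a..b}"
    by (auto simp: absolutely_integrable_on_def)
qed

lemma L1_loc_cong_AE:
  assumes "L1_loc f" "AE x in halfline. g x = f x"
  shows "L1_loc g"
proof -
  obtain N where "negligible N" "\<And>x. x \<ge> 0 \<Longrightarrow> x \<notin> N \<Longrightarrow> g x = f x"
    by (rule AE_halflineE[OF assms(2)]) (rule that, assumption, simp)
  note N = this
  show ?thesis unfolding L1_loc_def
  proof (intro allI impI)
    fix b :: real assume "b \<ge> 0"
    then have "f absolutely_integrable_on {0..b}" using assms(1) by (simp add: L1_loc_def)
    then show "g absolutely_integrable_on {0..b}"
      by (rule absolutely_integrable_spike[OF _ N(1)]) (use N(2) in auto)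
  qed
qed

lemma L1_loc_add: "L1_loc f \<Longrightarrow> L1_loc g \<Longrightarrow> L1_loc (\<lambda>x. f x + g x)"
  and L1_loc_diff: "L1_loc f \<Longrightarrow> L1_loc g \<Longrightarrow> L1_loc (\<lambda>x. f x - g x)"
  and L1_loc_norm: "L1_loc f \<Longrightarrow> L1_loc (\<lambda>x. norm (f x))"
  unfolding L1_loc_def
  by (simp_all add: set_integral_add(1) set_integral_diff(1) absolutely_integrable_norm[unfolded o_def])

lemma L1_loc_linear: "L1_loc f \<Longrightarrow> bounded_linear h \<Longrightarrow> L1_loc (\<lambda>x. h (f x))"
  unfolding L1_loc_def using absolutely_integrable_linear[where f = f and h = h] unfolding o_def by simp

lemma L1_loc_continuous: "continuous_on {0..} f \<Longrightarrow> L1_loc f"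
  unfolding L1_loc_def
  by (intro allI impI absolutely_integrable_continuous_real) (erule continuous_on_subset, auto)

lemma L1_loc_bounded_measurable:
  assumes "f \<in> borel_measurable halfline" "\<And>x. x \<ge> 0 \<Longrightarrow> norm (f x) \<le> B"
  shows "L1_loc f"
  unfolding L1_loc_def
proof (intro allI impI)
  fix b :: real
  have "f \<in> borel_measurable (lebesgue_on {0..b})"
    using assms(1) by (rule measurable_restrict_mono) auto
  then show "f absolutely_integrable_on {0..b}"
    by (rule measurable_bounded_by_integrable_imp_absolutely_integrable[where g = "\<lambda>x. B"]) (use assms(2) in auto)
qed

lemma L1_loc_bilinear:
  fixes h :: "'a::euclidean_space \<Rightarrow> 'b::euclidean_space \<Rightarrow> 'c::euclidean_space"
  assumes h: "bounded_bilinear h" and A: "L1_loc A" and y: "continuous_on {0..} y"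
  shows "L1_loc (\<lambda>x. h (y x) (A x))"
  unfolding L1_loc_def
proof (intro allI impI)
  fix b :: real assume "b \<ge> 0"
  have c: "continuous_on {0..b} y" using y by (rule continuous_on_subset) auto
  show "(\<lambda>x. h (y x) (A x)) absolutely_integrable_on {0..b}"
  proof (rule absolutely_integrable_bounded_measurable_product[where h = h and f = y and g = A])
    show "bilinear h" using h bilinear_conv_bounded_bilinear by blast
    show "y \<in> borel_measurable (lebesgue_on {0..b})"
      using c by (rule continuous_imp_measurable_on_sets_lebesgue) auto
    show "bounded (y ` {0..b})" by (intro compact_imp_bounded compact_continuous_image c) auto
    show "A absolutely_integrable_on {0..b}" using A \<open>b \<ge> 0\<close> by (auto simp: L1_loc_def)
  qed auto
qed

lemmas L1_loc_bilinear_flip = L1_loc_bilinear[OF bounded_bilinear.flip]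

lemma L1_loc_measurable:
  assumes "L1_loc f"
  shows "f \<in> borel_measurable halfline"
proof -
  have "(\<lambda>x. indicator {0..real n} x *\<^sub>R f x) \<in> borel_measurable lebesgue" for n :: nat
    using assms unfolding L1_loc_def set_integrable_def
    by (intro borel_measurable_integrable) simp
  then have "(\<lambda>x. indicator {0..real n} x *\<^sub>R f x) \<in> borel_measurable halfline" for n :: nat
    by (rule measurable_restrict_space1)
  then show ?thesis
  proof (rule borel_measurable_LIMSEQ_metric)
    fix x assume "x \<in> space halfline"
    then have x: "x \<ge> 0" by simp
    have "eventually (\<lambda>n. indicator {0..real n} x *\<^sub>R f x = f x) sequentially"
      using eventually_ge_at_top[of "nat \<lceil>x\<rceil>"] by eventually_elim (use x in \<open>auto simp: indicator_def nat_le_iff ceiling_le_iff\<close>)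
    then show "(\<lambda>n. indicator {0..real n} x *\<^sub>R f x) \<longlonglongrightarrow> f x" by (rule tendsto_eventually)
  qed
qed

lemma halfline_integrable_L1_loc:
  assumes "integrable halfline f"
  shows "L1_loc f"
  unfolding L1_loc_def
proof (intro allI impI)
  fix b :: real
  have "f absolutely_integrable_on {0..}"
    using assms by (simp add: integrable_restrict_space set_integrable_def)
  then show "f absolutely_integrable_on {0..b}" by (rule set_integrable_subset) auto
qed

section \<open>Functions with a locally integrable derivative\<close>

text \<open>\<open>y\<close> is locally absolutely continuous with derivative \<open>g\<close>, in integrated form. Values at negative
arguments are left open, since functions on the half-line are represented by functions on the
whole line.\<close>

definition primitive :: "(real \<Rightarrow> 'a::euclidean_space) \<Rightarrow> (real \<Rightarrow> 'a) \<Rightarrow> bool" where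
  "primitive y g \<longleftrightarrow> L1_loc g \<and> (\<forall>x\<ge>0. y x = y 0 + integral {0..x} g)"

lemma primitiveD:
  assumes "primitive y g"
  shows "L1_loc g" "x \<ge> 0 \<Longrightarrow> y x = y 0 + integral {0..x} g"
  using assms unfolding primitive_def by blast+

lemma continuous_on_halfline:
  fixes f :: "real \<Rightarrow> 'a::topological_space"
  assumes "\<And>b. b \<ge> 0 \<Longrightarrow> continuous_on {0..b} f"
  shows "continuous_on {0..} f"
  unfolding continuous_on_eq_continuous_within
proof
  fix x :: real assume x: "x \<in> {0..}"
  have "at x within {0..} = at x within {0..x+1}"
    by (rule at_within_nhd[of _ "{..<x+1}"]) auto
  then show "continuous (at x within {0..}) f"
    using assms[of "x+1"] x by (simp add: continuous_on_eq_continuous_within)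
qed

lemma primitive_continuous:
  assumes "primitive y g"
  shows "continuous_on {0..} y"
proof (rule continuous_on_halfline)
  fix b :: real assume "b \<ge> 0"
  have "continuous_on {0..b} (\<lambda>x. y 0 + integral {0..x} g)"
    by (intro continuous_intros indefinite_integral_continuous_1 L1_loc_integrable primitiveD[OF assms]) auto
  then show "continuous_on {0..b} y"
    by (rule continuous_on_cong[THEN iffD1, rotated 2]) (use primitiveD(2)[OF assms, symmetric] in auto)
qed

lemma primitive_increment:
  assumes "primitive y g" "0 \<le> u" "u \<le> v"
  shows "y v - y u = integral {u..v} g"
proof -
  have "integral {0..u} g + integral {u..v} g = integral {0..v} g"
    by (rule Henstock_Kurzweil_Integration.integral_combine)
       (use assms L1_loc_integrable[OF primitiveD(1)[OF assms(1)]] in auto)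
  then have "integral {0..v} g - integral {0..u} g = integral {u..v} g" by (metis add_diff_cancel_left')
  then show ?thesis using primitiveD(2)[OF assms(1), of u] primitiveD(2)[OF assms(1), of v] assms by simp
qed

lemma primitive_AE_derivative:
  assumes "primitive y g"
  shows "AE x in halfline. (y has_vector_derivative g x) (at x)"
proof (rule AE_halfline_local)
  fix n :: nat
  define N where "N = {x\<in>{0..real n}. \<not> ((\<lambda>x. integral {0..x} g) has_vector_derivative g x) (at x within {0..real n})}"
  have "negligible N" unfolding N_def
    by (intro negligible_not_derivative_of_integral L1_loc_integrable primitiveD[OF assms]) auto
  moreover have "(y has_vector_derivative g x) (at x)" if x: "x \<in> {0<..<real n} - N" for x
  proof -
    have "((\<lambda>x. integral {0..x} g) has_vector_derivative g x) (at x within {0..real n})"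
      using x by (auto simp: N_def)
    moreover have "at x within {0..real n} = at x" using x by (intro at_within_interior) auto
    ultimately have "((\<lambda>x. y 0 + integral {0..x} g) has_vector_derivative g x) (at x)"
      using has_vector_derivative_add[OF has_vector_derivative_const[of "y 0"], of "\<lambda>x. integral {0..x} g" "g x" "at x"] by simp
    then show ?thesis
    proof (rule has_vector_derivative_transform_within_open)
      show "open {0<..<real n}" "x \<in> {0<..<real n}" using x by auto
      show "y 0 + integral {0..t} g = y t" if "t \<in> {0<..<real n}" for t
        using primitiveD(2)[OF assms, of t] that by simp
    qed
  qed
  ultimately show "\<exists>N. negligible N \<and> (\<forall>x\<in>{0<..<real n} - N. (y has_vector_derivative g x) (at x))" by blast
qed

lemma primitive_vector_derivative:
  "primitive y g \<Longrightarrow> AE x in halfline. vector_derivative y (at x) = g x"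
  by (erule primitive_AE_derivative[THEN eventually_mono]) (rule vector_derivative_at)

lemma AC_loc_differentiable_AE:
  fixes y :: "real \<Rightarrow> 'a::euclidean_space"
  assumes "AC_loc y"
  shows "AE x in halfline. \<exists>D. (y has_vector_derivative D) (at x)"
proof (rule AE_halfline_local)
  fix n :: nat
  have "absolutely_continuous_on_interval 0 (real n) y" using assms by (auto simp: AC_loc_def)
  then show "\<exists>N. negligible N \<and> (\<forall>x\<in>{0<..<real n} - N. \<exists>D. (y has_vector_derivative D) (at x))"
    by (rule absolutely_continuous_differentiable_AE) blast
qed

lemma AC_loc_primitive:
  fixes y :: "real \<Rightarrow> 'a::euclidean_space"
  assumes "AC_loc y" "L1_loc g" "AE x in halfline. (y has_vector_derivative g x) (at x)"
  shows "primitive y g"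
proof -
  obtain N where N: "negligible N" "\<And>x. x \<ge> 0 \<Longrightarrow> x \<notin> N \<Longrightarrow> (y has_vector_derivative g x) (at x)"
    by (rule AE_halflineE[OF assms(3)]) (rule that, assumption, simp)
  have "y x = y 0 + integral {0..x} g" if x: "x \<ge> 0" for x
  proof -
    have "(g has_integral y x - y 0) {0..x}"
    proof (rule integral_derivative_absolutely_continuous[OF x _ N(1)])
      show "absolutely_continuous_on_interval 0 x y" using assms(1) x by (auto simp: AC_loc_def)
    qed (auto intro: has_vector_derivative_at_within N(2))
    then show ?thesis by (simp add: integral_unique)
  qed
  then show ?thesis using assms(2) unfolding primitive_def by blast
qed

text \<open>The part of \<open>norm (g x)\<close> above a high level has a small integral, and the part below the level
contributes at most the level times the total length.\<close>

lemma integral_norm_absolutely_continuous: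
  fixes g :: "real \<Rightarrow> 'a::euclidean_space"
  assumes g: "g absolutely_integrable_on {a..b}" and e: "e > 0"
  obtains d where "d > 0" "\<And>D. D division_of \<Union>D \<Longrightarrow> \<Union>D \<subseteq> {a..b} \<Longrightarrow> (\<Sum>K\<in>D. content K) < d \<Longrightarrow>
      (\<Sum>K\<in>D. integral K (\<lambda>x. norm (g x))) < e"
proof -
  define t where "t n x = min (norm (g x)) (real n)" for n :: nat and x
  have gn: "(\<lambda>x. norm (g x)) absolutely_integrable_on {a..b}"
    using absolutely_integrable_norm[OF g] by (simp add: o_def)
  have t: "t n absolutely_integrable_on {a..b}" for n
    unfolding t_def by (intro absolutely_integrable_min_1 gn) auto
  have "(\<lambda>n. integral {a..b} (t n)) \<longlonglongrightarrow> integral {a..b} (\<lambda>x. norm (g x))"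
  proof (rule dominated_convergence(2)[where h = "\<lambda>x. norm (g x)"])
    show "t n integrable_on {a..b}" for n using t[of n] by (simp add: absolutely_integrable_on_def)
    show "(\<lambda>x. norm (g x)) integrable_on {a..b}" using gn by (simp add: absolutely_integrable_on_def)
    show "(\<lambda>n. t n x) \<longlonglongrightarrow> norm (g x)" for x
    proof (rule tendsto_eventually)
      obtain m :: nat where "norm (g x) < m" using reals_Archimedean2 by blast
      then show "eventually (\<lambda>n. t n x = norm (g x)) sequentially"
        unfolding eventually_sequentially t_def by (intro exI[of _ m]) auto
    qed
  qed (auto simp: t_def)
  then obtain n where n: "\<bar>integral {a..b} (t n) - integral {a..b} (\<lambda>x. norm (g x))\<bar> < e / 2"
    using e by (metis (no_types, lifting) LIMSEQ_iff half_gt_zero order_refl real_norm_def)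
  define r where "r x = norm (g x) - t n x" for x
  have r: "r integrable_on {a..b}" "\<And>x. 0 \<le> r x" "integral {a..b} r < e / 2"
  proof -
    have i: "t n integrable_on {a..b}" "(\<lambda>x. norm (g x)) integrable_on {a..b}"
      using t[of n] gn by (auto simp: absolutely_integrable_on_def)
    show "r integrable_on {a..b}" unfolding r_def by (intro integrable_diff i)
    show "integral {a..b} r < e / 2" unfolding r_def using n[unfolded abs_less_iff] by (subst integral_diff) (auto simp: i)
    show "0 \<le> r x" for x by (simp add: r_def t_def)
  qed
  define d where "d = e / (2 * (real n + 1))"
  have d: "d > 0" "real n * d \<le> e / 2" using e by (auto simp: d_def field_simps)
  show ?thesis
  proof (rule that[OF d(1)])
    fix D assume D: "D division_of \<Union>D" "\<Union>D \<subseteq> {a..b}" "(\<Sum>K\<in>D. content K) < d"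
    have K: "integral K (\<lambda>x. norm (g x)) \<le> integral K r + real n * content K" "r integrable_on K" if KD: "K \<in> D" for K
    proof -
      obtain u v where uv: "K = {u..v}" using division_ofD(4)[OF D(1) KD] by auto
      have sub: "{u..v} \<subseteq> {a..b}" using D(2) KD uv by blast
      have i: "(\<lambda>x. norm (g x)) integrable_on {u..v}" "r integrable_on {u..v}"
        using gn r(1) sub by (auto simp: absolutely_integrable_on_def intro: integrable_on_subinterval)
      show "r integrable_on K" using i uv by simp
      have "integral {u..v} (\<lambda>x. norm (g x)) \<le> integral {u..v} (\<lambda>x. r x + real n)"
      proof (rule integral_le)
        show "(\<lambda>x. r x + real n) integrable_on {u..v}" using i by (intro integrable_add) auto
      qed (use i in \<open>auto simp: r_def t_def\<close>)
      also have "\<dots> = integral {u..v} r + real n * content {u..v}"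
        by (subst integral_add) (use i in auto)
      finally show "integral K (\<lambda>x. norm (g x)) \<le> integral K r + real n * content K" by (simp add: uv)
    qed
    have "(\<Sum>K\<in>D. integral K (\<lambda>x. norm (g x))) \<le> (\<Sum>K\<in>D. integral K r + real n * content K)"
      by (rule sum_mono) (rule K)
    also have "\<dots> = (\<Sum>K\<in>D. integral K r) + real n * (\<Sum>K\<in>D. content K)"
      by (simp add: sum.distrib sum_distrib_left)
    also have "(\<Sum>K\<in>D. integral K r) = integral (\<Union>D) r"
      by (rule integral_combine_division_bottomup[OF D(1), symmetric]) (rule K)
    also have "\<dots> \<le> integral {a..b} r"
      by (rule integral_subset_le) (use D r K in \<open>auto intro: integrable_combine_division\<close>)
    also have "real n * (\<Sum>K\<in>D. content K) \<le> real n * d" using D(3) by (intro mult_left_mono) auto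
    finally show "(\<Sum>K\<in>D. integral K (\<lambda>x. norm (g x))) < e" using r(3) d(2) by linarith
  qed
qed

lemma primitive_AC_loc:
  assumes "primitive y g"
  shows "AC_loc y"
  unfolding AC_loc_def absolutely_continuous_on_interval_def
proof (intro allI impI)
  fix b e :: real assume b: "b \<ge> 0" and e: "e > 0"
  obtain d where d: "d > 0" and D: "\<And>D. D division_of \<Union>D \<Longrightarrow> \<Union>D \<subseteq> {0..b} \<Longrightarrow> (\<Sum>K\<in>D. content K) < d \<Longrightarrow>
      (\<Sum>K\<in>D. integral K (\<lambda>x. norm (g x))) < e"
    by (rule integral_norm_absolutely_continuous[OF L1_loc_integrable(2)[OF primitiveD(1)[OF assms] order_refl, of b] e])
       (rule that, assumption, simp)
  show "\<exists>d>0. \<forall>D. D division_of \<Union>D \<and> \<Union>D \<subseteq> {0..b} \<and> (\<Sum>K\<in>D. Sup K - Inf K) < d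
        \<longrightarrow> (\<Sum>K\<in>D. norm (y (Sup K) - y (Inf K))) < e"
  proof (intro exI[of _ d] conjI allI impI d, elim conjE)
    fix D assume div: "D division_of \<Union>D" and sub: "\<Union>D \<subseteq> {0..b}" and small: "(\<Sum>K\<in>D. Sup K - Inf K) < d"
    have K: "\<exists>u v. K = {u..v} \<and> 0 \<le> u \<and> u \<le> v" if KD: "K \<in> D" for K
    proof -
      obtain u v where uv: "K = {u..v}" using division_ofD(4)[OF div KD] by auto
      have "{u..v} \<noteq> {}" using division_ofD(3)[OF div KD] uv by auto
      moreover have "{u..v} \<subseteq> {0..b}" using sub KD uv by blast
      ultimately have "{u..v} \<noteq> {}" "{u..v} \<subseteq> {0..b}" by blast+
      then show ?thesis using uv by auto
    qed
    have "(\<Sum>K\<in>D. norm (y (Sup K) - y (Inf K))) \<le> (\<Sum>K\<in>D. integral K (\<lambda>x. norm (g x)))"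
    proof (rule sum_mono)
      fix K assume "K \<in> D"
      then obtain u v where uv: "K = {u..v}" "0 \<le> u" "u \<le> v" using K by blast
      then show "norm (y (Sup K) - y (Inf K)) \<le> integral K (\<lambda>x. norm (g x))"
        using primitive_increment[OF assms, of u v] L1_loc_integrable[OF primitiveD(1)[OF assms], of u v]
        by (simp add: integral_norm_bound_integral)
    qed
    also have "\<dots> < e"
    proof (rule D[OF div sub])
      have "(\<Sum>K\<in>D. content K) = (\<Sum>K\<in>D. Sup K - Inf K)"
        using K by (intro sum.cong refl) fastforce
      then show "(\<Sum>K\<in>D. content K) < d" using small by simp
    qed
    finally show "(\<Sum>K\<in>D. norm (y (Sup K) - y (Inf K))) < e" .
  qed
qed

lemma primitive_cong_AE:
  assumes "primitive y g" "AE x in halfline. g' x = g x"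
  shows "primitive y g'"
proof -
  obtain N where N: "negligible N" "\<And>x. x \<ge> 0 \<Longrightarrow> x \<notin> N \<Longrightarrow> g' x = g x"
    by (rule AE_halflineE[OF assms(2)]) (rule that, assumption, simp)
  have "integral {0..x} g' = integral {0..x} g" for x
    by (rule integral_spike[OF N(1)]) (use N(2) in auto)
  then show ?thesis
    using assms L1_loc_cong_AE[OF primitiveD(1)[OF assms(1)] assms(2)] unfolding primitive_def by metis
qed

lemma primitive_cong_halfline:
  assumes "primitive y g" "\<And>x. x \<ge> 0 \<Longrightarrow> y' x = y x"
  shows "primitive y' g"
  using assms unfolding primitive_def by (metis order_refl)

lemma primitive_add:
  assumes "primitive y g" "primitive z k"
  shows "primitive (\<lambda>x. y x + z x) (\<lambda>x. g x + k x)"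
proof -
  have i: "integral {0..x} (\<lambda>x. g x + k x) = integral {0..x} g + integral {0..x} k" for x
    by (intro integral_add L1_loc_integrable primitiveD[OF assms(1)] primitiveD[OF assms(2)]) auto
  have "y x + z x = y 0 + z 0 + integral {0..x} (\<lambda>x. g x + k x)" if "x \<ge> 0" for x
    unfolding i primitiveD(2)[OF assms(1) that] primitiveD(2)[OF assms(2) that] by (simp add: algebra_simps)
  then show ?thesis
    using L1_loc_add[OF primitiveD(1)[OF assms(1)] primitiveD(1)[OF assms(2)]]
    unfolding primitive_def by blast
qed

lemma primitive_linear:
  fixes h :: "'a::euclidean_space \<Rightarrow> 'b::euclidean_space"
  assumes y: "primitive y g" and h: "bounded_linear h"
  shows "primitive (\<lambda>x. h (y x)) (\<lambda>x. h (g x))"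
proof -
  have "integral {0..x} (\<lambda>x. h (g x)) = h (integral {0..x} g)" for x
    using integral_linear[OF L1_loc_integrable(1)[OF primitiveD(1)[OF y] order_refl, of x] h] by (simp add: o_def)
  then have "h (y x) = h (y 0) + integral {0..x} (\<lambda>x. h (g x))" if "x \<ge> 0" for x
    using arg_cong[OF primitiveD(2)[OF y that], of h] by (simp only: linear_add[OF bounded_linear.linear[OF h]])
  then show ?thesis
    using L1_loc_linear[OF primitiveD(1)[OF y] h] unfolding primitive_def by blast
qed

lemma primitive_diff:
  assumes "primitive y g" "primitive z k"
  shows "primitive (\<lambda>x. y x - z x) (\<lambda>x. g x - k x)"
  using primitive_add[OF assms(1) primitive_linear[OF assms(2) bounded_linear_minus[OF bounded_linear_ident]]] by simp

lemma primitive_integral: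
  assumes "L1_loc g"
  shows "primitive (\<lambda>x. c + integral {0..x} g) g"
  using assms by (simp add: primitive_def)

lemma absolutely_continuous_bilinear:
  assumes h: "bounded_bilinear h"
    and y: "absolutely_continuous_on_interval a b y" and z: "absolutely_continuous_on_interval a b z"
  shows "absolutely_continuous_on_interval a b (\<lambda>x. h (y x) (z x))"
  unfolding absolutely_continuous_on_interval_def
proof (intro allI impI)
  fix e :: real assume e: "e > 0"
  have "bounded (y ` {a..b})" "bounded (z ` {a..b})"
    by (intro compact_imp_bounded compact_continuous_image absolutely_continuous_on_continuous y z compact_Icc)+
  then obtain B1 B2 where B': "B1 > 0" "\<And>x. x \<in> {a..b} \<Longrightarrow> norm (y x) \<le> B1" "B2 > 0" "\<And>x. x \<in> {a..b} \<Longrightarrow> norm (z x) \<le> B2"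
    unfolding bounded_pos by (auto simp: image_iff) 
  define B where "B = max B1 B2"
  have B: "B > 0" "\<And>x. x \<in> {a..b} \<Longrightarrow> norm (y x) \<le> B" "\<And>x. x \<in> {a..b} \<Longrightarrow> norm (z x) \<le> B"
    using B' by (auto simp: B_def intro: max.coboundedI1 max.coboundedI2)
  obtain K where K: "K > 0" "\<And>u v. norm (h u v) \<le> norm u * norm v * K"
    using bounded_bilinear.pos_bounded[OF h] by blast
  define e' where "e' = e / (2 * (B * K))"
  have e': "e' > 0" using e B K by (simp add: e'_def)
  obtain d1 where d1: "d1 > 0" and D1: "\<And>D. D division_of \<Union>D \<Longrightarrow> \<Union>D \<subseteq> {a..b} \<Longrightarrow>
      (\<Sum>K\<in>D. Sup K - Inf K) < d1 \<Longrightarrow> (\<Sum>K\<in>D. norm (y (Sup K) - y (Inf K))) < e'"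
    by (rule absolutely_continuous_onE[OF y e']) (rule that, assumption, simp)
  obtain d2 where d2: "d2 > 0" and D2: "\<And>D. D division_of \<Union>D \<Longrightarrow> \<Union>D \<subseteq> {a..b} \<Longrightarrow>
      (\<Sum>K\<in>D. Sup K - Inf K) < d2 \<Longrightarrow> (\<Sum>K\<in>D. norm (z (Sup K) - z (Inf K))) < e'"
    by (rule absolutely_continuous_onE[OF z e']) (rule that, assumption, simp)
  show "\<exists>d>0. \<forall>D. D division_of \<Union>D \<and> \<Union>D \<subseteq> {a..b} \<and> (\<Sum>K\<in>D. Sup K - Inf K) < d
      \<longrightarrow> (\<Sum>K\<in>D. norm (h (y (Sup K)) (z (Sup K)) - h (y (Inf K)) (z (Inf K)))) < e"
  proof (intro exI[of _ "min d1 d2"] conjI allI impI, use d1 d2 in simp, elim conjE)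
    fix D assume div: "D division_of \<Union>D" and sub: "\<Union>D \<subseteq> {a..b}" and small: "(\<Sum>K\<in>D. Sup K - Inf K) < min d1 d2"
    have "norm (h (y (Sup I)) (z (Sup I)) - h (y (Inf I)) (z (Inf I)))
       \<le> B * K * norm (y (Sup I) - y (Inf I)) + B * K * norm (z (Sup I) - z (Inf I))" if I: "I \<in> D" for I
    proof -
      obtain u v where uv: "I = {u..v}" using division_ofD(4)[OF div I] by auto
      have "{u..v} \<noteq> {}" using division_ofD(3)[OF div I] uv by auto
      moreover have "{u..v} \<subseteq> {a..b}" using sub I uv by blast
      ultimately have uv': "u \<in> {a..b}" "v \<in> {a..b}" "Sup I = v" "Inf I = u" using uv by auto
      have eq: "h (y v) (z v) - h (y u) (z u) = h (y v - y u) (z v) + h (y u) (z v - z u)"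
        by (simp add: bounded_bilinear.diff_left[OF h] bounded_bilinear.diff_right[OF h])
      have "norm (h (y v) (z v) - h (y u) (z u)) \<le> norm (y v - y u) * norm (z v) * K + norm (y u) * norm (z v - z u) * K"
        unfolding eq using norm_triangle_ineq[of "h (y v - y u) (z v)" "h (y u) (z v - z u)"] K(2)[of "y v - y u" "z v"] K(2)[of "y u" "z v - z u"]
        by linarith
      also have "\<dots> \<le> norm (y v - y u) * B * K + B * norm (z v - z u) * K"
        using B(2)[OF uv'(1)] B(3)[OF uv'(2)] K(1) by (intro add_mono mult_right_mono mult_left_mono) auto
      finally show ?thesis unfolding uv' by (simp add: mult.commute mult.left_commute)
    qed
    then have "(\<Sum>I\<in>D. norm (h (y (Sup I)) (z (Sup I)) - h (y (Inf I)) (z (Inf I))))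
       \<le> (\<Sum>I\<in>D. B * K * norm (y (Sup I) - y (Inf I)) + B * K * norm (z (Sup I) - z (Inf I)))"
      by (rule sum_mono)
    also have "\<dots> = B * K * (\<Sum>I\<in>D. norm (y (Sup I) - y (Inf I))) + B * K * (\<Sum>I\<in>D. norm (z (Sup I) - z (Inf I)))"
      by (simp add: sum.distrib sum_distrib_left)
    also have "\<dots> < B * K * e' + B * K * e'"
      using D1[OF div sub] D2[OF div sub] small B(1) K(1) by (intro add_strict_mono mult_strict_left_mono) auto
    also have "\<dots> = e" using B(1) K(1) by (simp add: e'_def field_simps)
    finally show "(\<Sum>K\<in>D. norm (h (y (Sup K)) (z (Sup K)) - h (y (Inf K)) (z (Inf K)))) < e" .
  qed
qed

text \<open>Products of absolutely continuous functions are absolutely continuous, so the product rule, which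
holds pointwise almost everywhere, can be integrated.\<close>

lemma primitive_bilinear:
  fixes h :: "'a::euclidean_space \<Rightarrow> 'b::euclidean_space \<Rightarrow> 'c::euclidean_space"
  assumes h: "bounded_bilinear h" and y: "primitive y g" and z: "primitive z k"
  shows "primitive (\<lambda>x. h (y x) (z x)) (\<lambda>x. h (y x) (k x) + h (g x) (z x))"
proof (rule AC_loc_primitive)
  show "AC_loc (\<lambda>x. h (y x) (z x))"
    using primitive_AC_loc[OF y] primitive_AC_loc[OF z] absolutely_continuous_bilinear[OF h]
    unfolding AC_loc_def by blast
  show "L1_loc (\<lambda>x. h (y x) (k x) + h (g x) (z x))"
    by (intro L1_loc_add L1_loc_bilinear[OF h] L1_loc_bilinear_flip[OF h] primitive_continuous[OF y]
      primitive_continuous[OF z] primitiveD(1)[OF y] primitiveD(1)[OF z])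
  show "AE x in halfline. ((\<lambda>x. h (y x) (z x)) has_vector_derivative h (y x) (k x) + h (g x) (z x)) (at x)"
    using primitive_AE_derivative[OF y] primitive_AE_derivative[OF z]
    by eventually_elim (rule bounded_bilinear.has_vector_derivative[OF h])
qed

lemma primitive_unique_derivative:
  assumes "primitive y g" "primitive z k" "\<And>x. x \<ge> 0 \<Longrightarrow> y x = z x"
  shows "AE x in halfline. g x = k x"
proof -
  have "primitive z g" by (rule primitive_cong_halfline[OF assms(1)]) (simp add: assms(3))
  from primitive_AE_derivative[OF this] primitive_AE_derivative[OF assms(2)]
  show ?thesis by eventually_elim (rule vector_derivative_unique_at)
qed

section \<open>Linear differential equations with locally integrable coefficients\<close>

lemma primitive_power:
  fixes M :: "real \<Rightarrow> real"
  assumes "primitive M a"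
  shows "primitive (\<lambda>x. M x ^ Suc k) (\<lambda>x. real (Suc k) * M x ^ k * a x)"
proof (induction k)
  case 0
  then show ?case using assms by simp
next
  case (Suc k)
  have "(\<lambda>x. M x * M x ^ Suc k) = (\<lambda>x. M x ^ Suc (Suc k))" by simp
  with primitive_bilinear[OF bounded_bilinear_mult assms Suc.IH]
  have "primitive (\<lambda>x. M x ^ Suc (Suc k)) (\<lambda>x. M x * (real (Suc k) * M x ^ k * a x) + a x * M x ^ Suc k)"
    by (simp only:)
  then show ?case by (rule primitive_cong_AE) (auto simp: algebra_simps)
qed

text \<open>Picard iteration for \<open>y' = A y + f\<close>. With \<open>M\<close> an indefinite integral of \<open>K * norm (A t)\<close>, the
\<open>k\<close>-th correction is at most a constant times \<open>M^k / k!\<close>, because \<open>M^(k+1) / (k+1)!\<close> is an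
indefinite integral of \<open>M^k / k!\<close> times the derivative of \<open>M\<close>. This replaces the powers of the
independent variable that appear for bounded coefficients.\<close>

context
  fixes h :: "'m::euclidean_space \<Rightarrow> 'a::euclidean_space \<Rightarrow> 'a" and K :: real
    and A :: "real \<Rightarrow> 'm" and M :: "real \<Rightarrow> real"
  assumes h: "bounded_bilinear h" and K: "\<And>u v. norm (h u v) \<le> K * norm u * norm v" "K \<ge> 0"
    and A: "L1_loc A"
  defines "M \<equiv> \<lambda>x. integral {0..x} (\<lambda>t. K * norm (A t))"
begin

lemma growth_primitive: "primitive M (\<lambda>t. K * norm (A t))"
  unfolding M_def
  using primitive_integral[of "\<lambda>t. K * norm (A t)" 0] L1_loc_linear[OF L1_loc_norm[OF A] bounded_linear_mult_right] by simp

lemma growth_nonneg: "M x \<ge> 0"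
  unfolding M_def
  by (rule Henstock_Kurzweil_Integration.integral_nonneg)
     (use K L1_loc_integrable[OF primitiveD(1)[OF growth_primitive] order_refl] in auto)

lemma integral_coefficient_bound:
  assumes u: "continuous_on {0..} u" and bound: "\<And>x. x \<in> {0..b} \<Longrightarrow> norm (u x) \<le> B * M x ^ k / fact k"
    and x: "x \<in> {0..b}"
  shows "norm (integral {0..x} (\<lambda>t. h (A t) (u t))) \<le> B * M x ^ Suc k / fact (Suc k)"
proof -
  note p = primitive_linear[OF primitive_power[OF growth_primitive, of k] bounded_linear_mult_right[of "B / fact (Suc k)"]]
  have "norm (integral {0..x} (\<lambda>t. h (A t) (u t))) \<le>
      integral {0..x} (\<lambda>t. B / fact (Suc k) * (real (Suc k) * M t ^ k * (K * norm (A t))))"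
  proof (rule Henstock_Kurzweil_Integration.integral_norm_bound_integral)
    show "(\<lambda>t. h (A t) (u t)) integrable_on {0..x}"
      by (intro L1_loc_integrable L1_loc_bilinear_flip[OF h] A u) simp
    show "(\<lambda>t. B / fact (Suc k) * (real (Suc k) * M t ^ k * (K * norm (A t)))) integrable_on {0..x}"
      by (rule L1_loc_integrable[OF primitiveD(1)[OF p] order_refl])
    fix t assume "t \<in> {0..x}"
    then have "norm (u t) \<le> B * M t ^ k / fact k" using bound x by simp
    then have "K * norm (A t) * norm (u t) \<le> K * norm (A t) * (B * M t ^ k / fact k)"
      using K by (intro mult_left_mono) auto
    also have "\<dots> = B / fact (Suc k) * (real (Suc k) * M t ^ k * (K * norm (A t)))"
      by (simp add: field_simps del: of_nat_Suc)
    finally show "norm (h (A t) (u t)) \<le> B / fact (Suc k) * (real (Suc k) * M t ^ k * (K * norm (A t)))"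
      using K(1)[of "A t" "u t"] by linarith
  qed
  also have "\<dots> = B / fact (Suc k) * M x ^ Suc k"
  proof -
    have "M 0 = 0" by (simp add: M_def)
    then have "M 0 ^ Suc k = 0" by simp
    then show ?thesis using primitiveD(2)[OF p, of x] x by (auto simp del: of_nat_Suc power_Suc fact_Suc)
  qed
  finally show ?thesis by simp
qed

text \<open>The solution reproduces itself under integration, so it is bounded by every term of an
exponential series.\<close>

lemma linear_ode_unique_zero:
  assumes y: "primitive y (\<lambda>x. h (A x) (y x))" and y0: "y 0 = 0" and x: "x \<ge> 0"
  shows "y x = 0"
proof -
  have c: "continuous_on {0..} y" by (rule primitive_continuous[OF y])
  have "bounded (y ` {0..x})"
    by (intro compact_imp_bounded compact_continuous_image continuous_on_subset[OF c]) auto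
  then obtain B where B: "\<And>t. t \<in> {0..x} \<Longrightarrow> norm (y t) \<le> B"
    unfolding bounded_iff by blast
  have le: "\<forall>t\<in>{0..x}. norm (y t) \<le> B * M t ^ k / fact k" for k
  proof (induction k)
    case 0
    then show ?case using B by simp
  next
    case (Suc k)
    show ?case
    proof
      fix t assume t: "t \<in> {0..x}"
      have "y t = integral {0..t} (\<lambda>x. h (A x) (y x))" using primitiveD(2)[OF y, of t] t y0 by simp
      then show "norm (y t) \<le> B * M t ^ Suc k / fact (Suc k)"
        using integral_coefficient_bound[OF c _ t, of B k] Suc.IH by simp
    qed
  qed
  have "(\<lambda>k. inverse (fact k) * M x ^ k) \<longlonglongrightarrow> 0" by (rule summable_LIMSEQ_zero[OF summable_exp])
  from tendsto_mult_left[OF this, of B] have "(\<lambda>k. B * M x ^ k / fact k) \<longlonglongrightarrow> 0"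
    by (simp add: field_simps)
  moreover have "norm (y x) \<le> B * M x ^ k / fact k" for k using le[of k] x by simp
  ultimately have "norm (y x) \<le> 0" by (intro LIMSEQ_le_const) auto
  then show ?thesis by simp
qed

text \<open>The explicit bound gives continuous dependence on the initial value, which the passage to the
limit in the boundary problems uses.\<close>

lemma linear_ode_exists:
  assumes f: "L1_loc f"
  obtains y where "y 0 = c" "primitive y (\<lambda>x. h (A x) (y x) + f x)"
    "\<And>x. x \<ge> 0 \<Longrightarrow> norm (y x) \<le> (norm c + integral {0..x} (\<lambda>t. norm (f t))) * exp (M x)"
proof -
  define u where "u = rec_nat (\<lambda>x. c + integral {0..x} f) (\<lambda>k v x. integral {0..x} (\<lambda>t. h (A t) (v t)))"
  have u0: "u 0 = (\<lambda>x. c + integral {0..x} f)"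
    and uS: "u (Suc k) = (\<lambda>x. integral {0..x} (\<lambda>t. h (A t) (u k t)))" for k
    by (simp_all add: u_def)
  have cont: "continuous_on {0..} (u k)" for k
  proof (induction k)
    case 0
    show ?case unfolding u0 by (rule primitive_continuous[OF primitive_integral[OF f]])
  next
    case (Suc k)
    show ?case unfolding uS
      using primitive_continuous[OF primitive_integral[OF L1_loc_bilinear_flip[OF h A Suc.IH], of 0]] by simp
  qed
  define B where "B b = norm c + integral {0..b} (\<lambda>t. norm (f t))" for b
  have B: "\<forall>x\<in>{0..b}. norm (u k x) \<le> B b * M x ^ k / fact k" for k b
  proof (induction k)
    case 0
    show ?case
    proof
      fix x assume x: "x \<in> {0..b}"
      have "norm (integral {0..x} f) \<le> integral {0..x} (\<lambda>t. norm (f t))"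
        using L1_loc_integrable[OF f order_refl] by (intro Henstock_Kurzweil_Integration.integral_norm_bound_integral) auto
      also have "\<dots> \<le> integral {0..b} (\<lambda>t. norm (f t))"
        by (rule integral_subset_le) (use x L1_loc_integrable[OF f order_refl] in auto)
      finally show "norm (u 0 x) \<le> B b * M x ^ 0 / fact 0"
        unfolding u0 B_def using norm_triangle_ineq[of c "integral {0..x} f"] by simp
    qed
  next
    case (Suc k)
    show ?case unfolding uS using integral_coefficient_bound[OF cont[of k]] Suc.IH by blast
  qed
  have B_nonneg: "B b \<ge> 0" for b
    unfolding B_def
    by (intro add_nonneg_nonneg Henstock_Kurzweil_Integration.integral_nonneg L1_loc_integrable[OF f]) auto
  have exp: "(\<lambda>k. B b * M x ^ k / fact k) sums (B b * exp (M x))" for b x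
    using sums_mult[OF exp_converges[of "M x"], of "B b"] by (simp add: field_simps)
  have norm_summable: "summable (\<lambda>k. norm (u k x))" if x: "x \<ge> 0" for x
    by (rule summable_comparison_test[OF _ sums_summable[OF exp[of x x]]]) (use B[of x] x in auto)
  define y where "y x = (\<Sum>k. u k x)" for x
  have partial_bound: "norm (\<Sum>k<n. u k x) \<le> B b * exp (M x)" if "x \<in> {0..b}" for n x b
  proof -
    have "norm (\<Sum>k<n. u k x) \<le> (\<Sum>k<n. B b * M x ^ k / fact k)"
      by (rule order_trans[OF norm_sum sum_mono]) (use B[of b] that in auto)
    also have "\<dots> \<le> (\<Sum>k. B b * M x ^ k / fact k)"
      by (rule sum_le_suminf[OF sums_summable[OF exp]]) (auto intro!: divide_nonneg_pos mult_nonneg_nonneg B_nonneg zero_le_power growth_nonneg)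
    finally show ?thesis using sums_unique[OF exp[of b x]] by (simp only:)
  qed
  have lim: "(\<lambda>n. \<Sum>k<n. u k x) \<longlonglongrightarrow> y x" if "x \<ge> 0" for x
    unfolding y_def by (rule summable_LIMSEQ[OF summable_norm_cancel[OF norm_summable[OF that]]])
  have y_bound: "norm (y x) \<le> B b * exp (M x)" if "x \<in> {0..b}" for x b
    using LIMSEQ_le_const2[OF tendsto_norm[OF lim[of x]], of "B b * exp (M x)"] partial_bound[OF that] that by auto
  have M_mono: "M x \<le> M b" if "x \<in> {0..b}" for x b
    unfolding M_def
    by (rule integral_subset_le)
       (use that K L1_loc_integrable[OF primitiveD(1)[OF growth_primitive] order_refl] in auto)
  \<comment> \<open>The integral of \<open>h A\<close> applied to a partial sum is the next partial sum without its first
    term; dominated convergence carries this over to the limit.\<close>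
  have hA: "(\<lambda>t. h (A t) (\<Sum>k<n. u k t)) integrable_on {0..x}" for n x
    by (intro L1_loc_integrable L1_loc_bilinear_flip[OF h] A continuous_on_sum cont) simp
  have dom: "norm (h (A t) v) \<le> K * norm (A t) * (B x * exp (M x))"
    if "t \<in> {0..x}" "norm v \<le> B x * exp (M t)" for t v x
  proof -
    have "norm v \<le> B x * exp (M x)"
      using that(2) mult_left_mono[OF exp_le_cancel_iff[THEN iffD2, OF M_mono[OF that(1)]] B_nonneg[of x]] by linarith
    then have "K * norm (A t) * norm v \<le> K * norm (A t) * (B x * exp (M x))"
      using K by (intro mult_left_mono) auto
    then show ?thesis using K(1)[of "A t" v] by linarith
  qed
  have dom_int: "(\<lambda>t. K * norm (A t) * (B x * exp (M x))) integrable_on {0..x}" for x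
    by (intro integrable_on_mult_left L1_loc_integrable[OF primitiveD(1)[OF growth_primitive] order_refl])
  have conv: "(\<lambda>n. h (A t) (\<Sum>k<n. u k t)) \<longlonglongrightarrow> h (A t) (y t)" if "t \<in> {0..x}" for t x
    using bounded_linear.tendsto[OF bounded_bilinear.bounded_linear_right[OF h] lim[of t]] that by simp
  have bound: "norm (h (A t) (\<Sum>k<n. u k t)) \<le> K * norm (A t) * (B x * exp (M x))" if "t \<in> {0..x}" for n t x
    by (rule dom[OF that partial_bound[OF that]])
  have int_y: "(\<lambda>t. h (A t) (y t)) integrable_on {0..x}" for x
    by (rule dominated_convergence(1)[OF hA dom_int bound conv])
  have lim_int: "(\<lambda>n. integral {0..x} (\<lambda>t. h (A t) (\<Sum>k<n. u k t))) \<longlonglongrightarrow> integral {0..x} (\<lambda>t. h (A t) (y t))" for x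
    by (rule dominated_convergence(2)[OF hA dom_int bound conv])
  have L1: "L1_loc (\<lambda>t. h (A t) (y t))"
    unfolding L1_loc_def
  proof (intro allI impI)
    fix b :: real assume "b \<ge> 0"
    show "(\<lambda>t. h (A t) (y t)) absolutely_integrable_on {0..b}"
      by (rule absolutely_integrable_integrable_bound[OF _ int_y dom_int]) (rule dom, auto intro: y_bound)
  qed
  have eq: "y x = c + integral {0..x} (\<lambda>t. h (A t) (y t) + f t)" if x: "x \<ge> 0" for x
  proof -
    have "integral {0..x} (\<lambda>t. h (A t) (\<Sum>k<n. u k t)) = (\<Sum>k<Suc n. u k x) - u 0 x" for n
    proof -
      have "(\<lambda>t. h (A t) (\<Sum>k<n. u k t)) = (\<lambda>t. \<Sum>k<n. h (A t) (u k t))"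
        by (simp add: bounded_bilinear.sum_right[OF h])
      then have "integral {0..x} (\<lambda>t. h (A t) (\<Sum>k<n. u k t)) = (\<Sum>k<n. u (Suc k) x)"
        unfolding uS by (simp only:) (intro integral_sum L1_loc_integrable L1_loc_bilinear_flip[OF h] A cont, auto)
      then show ?thesis by (simp only: sum.lessThan_Suc_shift) simp
    qed
    then have "(\<lambda>n. (\<Sum>k<Suc n. u k x) - u 0 x) \<longlonglongrightarrow> integral {0..x} (\<lambda>t. h (A t) (y t))"
      using lim_int[of x] by simp
    moreover have "(\<lambda>n. (\<Sum>k<Suc n. u k x) - u 0 x) \<longlonglongrightarrow> y x - u 0 x"
      by (intro tendsto_diff tendsto_const LIMSEQ_Suc lim x)
    ultimately have "y x - u 0 x = integral {0..x} (\<lambda>t. h (A t) (y t))"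
      using LIMSEQ_unique by blast
    then show ?thesis
      unfolding u0 by (subst integral_add) (use int_y L1_loc_integrable[OF f order_refl] in \<open>auto simp: algebra_simps\<close>)
  qed
  have y0: "y 0 = c" using eq[of 0] by simp
  show ?thesis
  proof (rule that)
    show "y 0 = c" by (rule y0)
    show "primitive y (\<lambda>x. h (A x) (y x) + f x)"
      unfolding primitive_def y0 using L1_loc_add[OF L1 f] eq by blast
    show "norm (y x) \<le> (norm c + integral {0..x} (\<lambda>t. norm (f t))) * exp (M x)" if "x \<ge> 0" for x
      using y_bound[of x x] that unfolding B_def by simp
  qed
qed

end

section \<open>Matrices acting on complex vectors\<close>

lemma bounded_bilinear_matrix_vector_mult:
  "bounded_bilinear ((*v) :: complex ^ 'n ^ 'm \<Rightarrow> complex ^ 'n \<Rightarrow> complex ^ 'm)"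
  unfolding bilinear_conv_bounded_bilinear[symmetric] bilinear_def
  by (auto intro!: linearI simp: matrix_vector_mult_def vec_eq_iff algebra_simps sum.distrib scaleR_sum_right)

lemmas mv_add = bounded_bilinear.add_right[OF bounded_bilinear_matrix_vector_mult]
lemmas mv_diff = bounded_bilinear.diff_right[OF bounded_bilinear_matrix_vector_mult]
lemmas mv_minus = bounded_bilinear.minus_right[OF bounded_bilinear_matrix_vector_mult]
lemmas mv_zero = bounded_bilinear.zero_right[OF bounded_bilinear_matrix_vector_mult]
lemmas mv_scaleR = bounded_bilinear.scaleR_right[OF bounded_bilinear_matrix_vector_mult]
lemmas mv_sum = bounded_bilinear.sum_right[OF bounded_bilinear_matrix_vector_mult]
lemmas mv_bounded_linear = bounded_bilinear.bounded_linear_right[OF bounded_bilinear_matrix_vector_mult]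
lemmas mv_add_left = bounded_bilinear.add_left[OF bounded_bilinear_matrix_vector_mult]
lemmas mv_diff_left = bounded_bilinear.diff_left[OF bounded_bilinear_matrix_vector_mult]
lemmas mv_minus_left = bounded_bilinear.minus_left[OF bounded_bilinear_matrix_vector_mult]
lemmas mv_zero_left = bounded_bilinear.zero_left[OF bounded_bilinear_matrix_vector_mult]
lemmas mv_scaleR_left = bounded_bilinear.scaleR_left[OF bounded_bilinear_matrix_vector_mult]
lemmas mv_bounded_linear_left = bounded_bilinear.bounded_linear_left[OF bounded_bilinear_matrix_vector_mult]

lemma mv_scale: "A *v (c *s u) = c *s (A *v u)" for A :: "complex ^ 'n ^ 'm"
  by (simp add: matrix_vector_mult_def vec_eq_iff sum_distrib_left algebra_simps)

lemma bounded_bilinear_cdot: "bounded_bilinear (cdot :: complex ^ 'n \<Rightarrow> complex ^ 'n \<Rightarrow> complex)"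
  unfolding bilinear_conv_bounded_bilinear[symmetric] bilinear_def
  by (auto intro!: linearI simp: cdot_def algebra_simps sum.distrib scaleR_sum_right)

lemmas cdot_diff_left = bounded_bilinear.diff_left[OF bounded_bilinear_cdot]
lemmas cdot_diff_right = bounded_bilinear.diff_right[OF bounded_bilinear_cdot]
lemmas cdot_minus_left = bounded_bilinear.minus_left[OF bounded_bilinear_cdot]
lemmas cdot_minus_right = bounded_bilinear.minus_right[OF bounded_bilinear_cdot]
lemmas cdot_zero_left = bounded_bilinear.zero_left[OF bounded_bilinear_cdot]
lemmas cdot_zero_right = bounded_bilinear.zero_right[OF bounded_bilinear_cdot]

lemma cdot_ctranspose: "cdot (A *v u) v = cdot u (ctranspose A *v v)"
  for A :: "complex ^ 'n ^ 'm"
proof -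
  have "cdot (A *v u) v = (\<Sum>i\<in>UNIV. \<Sum>j\<in>UNIV. A $ i $ j * u $ j * cnj (v $ i))"
    by (simp add: cdot_def matrix_vector_mult_def sum_distrib_right)
  also have "\<dots> = (\<Sum>j\<in>UNIV. \<Sum>i\<in>UNIV. A $ i $ j * u $ j * cnj (v $ i))"
    by (rule sum.swap)
  also have "\<dots> = cdot u (ctranspose A *v v)"
    by (simp add: cdot_def matrix_vector_mult_def ctranspose_def sum_distrib_left algebra_simps)
  finally show ?thesis .
qed

lemma scale_of_real: "complex_of_real r *s u = r *\<^sub>R u"
  by (simp add: vec_eq_iff scaleR_conv_of_real[where 'a = complex])

lemma mat_mult_vector: "mat l *v u = l *s u" for u :: "complex ^ 'n"
  by (simp add: mat_def matrix_vector_mult_def vec_eq_iff if_distrib[where f = "\<lambda>x. x * _"] cong: if_cong)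

lemma L1_loc_ctranspose:
  assumes "L1_loc Q"
  shows "L1_loc (\<lambda>x. ctranspose (Q x))"
proof -
  have "linear (ctranspose :: complex ^ 'a ^ 'b \<Rightarrow> _)"
    by (auto intro!: linearI simp: ctranspose_def vec_eq_iff)
  then show ?thesis using L1_loc_linear[OF assms] by (simp add: linear_conv_bounded_linear)
qed

lemma ctranspose_ctranspose: "ctranspose (ctranspose A) = A"
  by (simp add: ctranspose_def vec_eq_iff)

definition join :: "'a ^ 'p \<Rightarrow> 'a ^ 'p \<Rightarrow> 'a ^ ('p::finite + 'p)" where
  "join a b = (\<chi> i. case i of Inl i \<Rightarrow> a $ i | Inr i \<Rightarrow> b $ i)"

lemma upper_join: "upper (join a b) = a" and lower_join: "lower (join a b) = b"
  by (simp_all add: upper_def lower_def join_def vec_eq_iff)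

lemma upper_lower_eqI: "upper u = upper v \<Longrightarrow> lower u = lower v \<Longrightarrow> u = v"
  unfolding upper_def lower_def vec_eq_iff by (metis sumE vec_lambda_beta)

lemma upper_lower_simps:
  "upper (u + v) = upper u + upper v" "lower (u + v) = lower u + lower v"
  "upper (u - v) = upper u - upper v" "lower (u - v) = lower u - lower v"
  "upper (0 :: complex ^ ('p::finite + 'p)) = 0" "lower (0 :: complex ^ ('p::finite + 'p)) = 0"
  "upper (c *s w) = c *s upper w" "lower (c *s w) = c *s lower w"
  "upper (r *\<^sub>R w) = r *\<^sub>R upper w" "lower (r *\<^sub>R w) = r *\<^sub>R lower w"
  for u v w :: "complex ^ ('p::finite + 'p)"
  by (simp_all add: upper_def lower_def vec_eq_iff)

lemma sum_UNIV_Plus: "(\<Sum>i\<in>UNIV. f i) = (\<Sum>i\<in>UNIV. f (Inl i)) + (\<Sum>i\<in>UNIV. f (Inr i))"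
  for f :: "'p::finite + 'q::finite \<Rightarrow> 'b::comm_monoid_add"
  by (simp flip: UNIV_Plus_UNIV add: sum.Plus)

lemma upper_J: "upper (J *v u) = - lower u" and lower_J: "lower (J *v u) = upper u"
proof -
  have "(if i = j then - 1 else (0::complex)) * u = (if j = i then - u else 0)"
    "(if i = j then 1 else (0::complex)) * u = (if j = i then u else 0)" for i j :: 'a and u
    by auto
  then show "upper (J *v u) = - lower u" "lower (J *v u) = upper u"
    by (simp_all add: upper_def lower_def J_def matrix_vector_mult_def vec_eq_iff sum_UNIV_Plus)
qed

lemma cdot_upper_lower: "cdot u v = cdot (upper u) (upper v) + cdot (lower u) (lower v)"
  by (simp add: cdot_def sum_UNIV_Plus upper_def lower_def)

lemma J_J: "J *v (J *v u) = - u"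
  by (rule upper_lower_eqI) (simp_all add: upper_J lower_J, simp_all add: upper_def lower_def vec_eq_iff)

lemma cdot_J_J: "cdot (J *v u) (J *v v) = cdot u v"
  by (simp add: cdot_upper_lower[of "J *v u"] cdot_upper_lower[of u v] upper_J lower_J cdot_minus_left cdot_minus_right)

lemma norm_J: "norm (J *v u) = norm u"
proof -
  have "(norm (J *v u))\<^sup>2 = (norm u)\<^sup>2"
    using cdot_J_J[of u u] unfolding cdot_self by (simp only: of_real_eq_iff)
  then show ?thesis by simp
qed

section \<open>Solutions of the inhomogeneous equation\<close>

text \<open>The integrated form of \<open>J y' + Q y = g\<close>, solved for \<open>y'\<close> by means of \<open>J^2 = -1\<close>.\<close>

definition solves ::
    "(real \<Rightarrow> complex ^ ('p::finite + 'p) ^ ('p + 'p)) \<Rightarrow> (real \<Rightarrow> complex ^ ('p + 'p)) \<Rightarrow> (real \<Rightarrow> complex ^ ('p + 'p)) \<Rightarrow> bool"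
  where "solves Q y g \<longleftrightarrow> primitive y (\<lambda>x. J *v (Q x *v y x - g x))"

lemma solves_continuous: "solves Q y g \<Longrightarrow> continuous_on {0..} y"
  unfolding solves_def by (rule primitive_continuous)

lemma solves_add: "solves Q y g \<Longrightarrow> solves Q z k \<Longrightarrow> solves Q (\<lambda>x. y x + z x) (\<lambda>x. g x + k x)"
  unfolding solves_def
  by (drule (1) primitive_add, erule back_subst[where P = "primitive _"]) (simp add: mv_add mv_diff fun_eq_iff)

lemma solves_diff: "solves Q y g \<Longrightarrow> solves Q z k \<Longrightarrow> solves Q (\<lambda>x. y x - z x) (\<lambda>x. g x - k x)"
  unfolding solves_def
  by (drule (1) primitive_diff, erule back_subst[where P = "primitive _"]) (simp add: mv_add mv_diff fun_eq_iff)

lemma solves_scale: "solves Q y g \<Longrightarrow> solves Q (\<lambda>x. c *s y x) (\<lambda>x. c *s g x)"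
  unfolding solves_def
  by (drule primitive_linear[OF _ bounded_linear_vector_scalar_mult[of c]], erule back_subst[where P = "primitive _"])
     (simp add: mv_diff mv_scale[symmetric] fun_eq_iff vector_ssub_ldistrib)

lemma solves_cong_AE:
  assumes "solves Q y g" "AE x in halfline. k x = g x"
  shows "solves Q y k"
  unfolding solves_def
  by (rule primitive_cong_AE[OF assms(1)[unfolded solves_def]]) (use assms(2) in \<open>auto elim: eventually_mono\<close>)

lemma solves_shift: "solves (\<lambda>x. Q x - mat l) y g \<longleftrightarrow> solves Q y (\<lambda>x. l *s y x + g x)"
proof -
  have "(Q x - mat l) *v u - v = Q x *v u - (l *s u + v)" for x u v
    by (simp add: mv_diff_left mat_mult_vector)
  then show ?thesis unfolding solves_def by (simp add: diff_diff_eq)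
qed

context
  fixes Q :: "real \<Rightarrow> complex ^ ('p::finite + 'p) ^ ('p + 'p)"
  assumes Q: "L1_loc Q"
begin

lemma L1_loc_J_Q: "L1_loc (\<lambda>x. J ** Q x)"
proof -
  have "linear (\<lambda>A :: complex ^ ('p + 'p) ^ ('p + 'p). J ** A)"
    by (auto intro!: linearI simp: matrix_matrix_mult_def vec_eq_iff algebra_simps sum.distrib scaleR_sum_right)
  then show ?thesis using L1_loc_linear[OF Q] by (simp add: linear_conv_bounded_linear)
qed

lemma solves_ode: "solves Q y g \<longleftrightarrow> primitive y (\<lambda>x. (J ** Q x) *v y x + - (J *v g x))"
  unfolding solves_def by (simp add: mv_diff matrix_vector_mul_assoc)

text \<open>The growth factor \<open>E\<close> depends on \<open>Q\<close> alone, so it serves for all right-hand sides and initial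
values at once.\<close>

lemma solves_exists:
  obtains E where "\<And>x y. 0 \<le> x \<Longrightarrow> x \<le> y \<Longrightarrow> E x \<le> E y" "\<And>x. E x > 0"
    "\<And>g c. L1_loc g \<Longrightarrow> \<exists>y. solves Q y g \<and> y 0 = c \<and>
      (\<forall>x\<ge>0. norm (y x) \<le> (norm c + integral {0..x} (\<lambda>t. norm (g t))) * E x)"
proof -
  obtain K where K: "K > 0" "\<And>(A :: complex ^ ('p + 'p) ^ ('p + 'p)) u. norm (A *v u) \<le> norm A * norm u * K"
    using bounded_bilinear.pos_bounded[OF bounded_bilinear_matrix_vector_mult] by blast
  have K': "norm (A *v u) \<le> K * norm A * norm u" for A :: "complex ^ ('p + 'p) ^ ('p + 'p)" and u
    using K(2)[of A u] by (simp add: mult.commute mult.left_commute)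
  define E where "E x = exp (integral {0..x} (\<lambda>t. K * norm (J ** Q t)))" for x
  have L: "L1_loc (\<lambda>t. K * norm (J ** Q t))"
    by (rule L1_loc_linear[OF L1_loc_norm[OF L1_loc_J_Q] bounded_linear_mult_right])
  show ?thesis
  proof (rule that[of E])
    show "E x \<le> E y" if "0 \<le> x" "x \<le> y" for x y
      unfolding E_def exp_le_cancel_iff
      by (rule integral_subset_le) (use that K L1_loc_integrable[OF L order_refl] in auto)
    show "E x > 0" for x by (simp add: E_def)
    fix g :: "real \<Rightarrow> complex ^ ('p + 'p)" and c
    assume g: "L1_loc g"
    have f: "L1_loc (\<lambda>x. - (J *v g x))"
      by (rule L1_loc_linear[OF g bounded_linear_minus[OF mv_bounded_linear]])
    obtain y where y: "y 0 = c" "primitive y (\<lambda>x. (J ** Q x) *v y x + - (J *v g x))"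
      "\<And>x. x \<ge> 0 \<Longrightarrow> norm (y x) \<le> (norm c + integral {0..x} (\<lambda>t. norm (- (J *v g t)))) * E x"
      by (rule linear_ode_exists[OF bounded_bilinear_matrix_vector_mult K' less_imp_le[OF K(1)] L1_loc_J_Q f, of c])
         (rule that, assumption, assumption, simp only: E_def)
    then show "\<exists>y. solves Q y g \<and> y 0 = c \<and>
      (\<forall>x\<ge>0. norm (y x) \<le> (norm c + integral {0..x} (\<lambda>t. norm (g t))) * E x)"
      unfolding solves_ode by (intro exI[of _ y]) (auto simp: norm_J)
  qed
qed

lemma solves_unique:
  assumes "solves Q y g" "solves Q z g" "y 0 = z 0" "x \<ge> 0"
  shows "y x = z x"
proof -
  obtain K where K: "K > 0" "\<And>(A :: complex ^ ('p + 'p) ^ ('p + 'p)) u. norm (A *v u) \<le> norm A * norm u * K"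
    using bounded_bilinear.pos_bounded[OF bounded_bilinear_matrix_vector_mult] by blast
  have K': "norm (A *v u) \<le> K * norm A * norm u" for A :: "complex ^ ('p + 'p) ^ ('p + 'p)" and u
    using K(2)[of A u] by (simp add: mult.commute mult.left_commute)
  have "solves Q (\<lambda>x. y x - z x) (\<lambda>x. g x - g x)" by (rule solves_diff[OF assms(1,2)])
  then have "primitive (\<lambda>x. y x - z x) (\<lambda>x. (J ** Q x) *v (y x - z x))"
    unfolding solves_ode by (simp add: mv_zero)
  from linear_ode_unique_zero[OF bounded_bilinear_matrix_vector_mult K' less_imp_le[OF K(1)] L1_loc_J_Q this _ assms(4)]
  show ?thesis using assms(3) by simp
qed

lemma solves_imp_AC: "solves Q y g \<Longrightarrow> AC_loc y"
  unfolding solves_def by (rule primitive_AC_loc)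

lemma solves_dirac_expr:
  assumes "solves Q y g"
  shows "AE x in halfline. dirac_expr Q y x = g x"
  using primitive_vector_derivative[OF assms[unfolded solves_def]]
  by (rule eventually_mono) (simp add: dirac_expr_def J_J)

text \<open>Here the definition of the operators through almost everywhere derivatives meets the integrated
form: absolute continuity supplies the derivative and recovers the function from it.\<close>

lemma AC_loc_solves:
  assumes y: "AC_loc y" and g: "L1_loc g" and "AE x in halfline. dirac_expr Q y x = g x"
  shows "solves Q y g"
  unfolding solves_def
proof (rule AC_loc_primitive[OF y])
  have "continuous_on {0..} y"
    by (rule continuous_on_halfline) (use y in \<open>auto simp: AC_loc_def intro: absolutely_continuous_on_continuous\<close>)
  from L1_loc_bilinear_flip[OF bounded_bilinear_matrix_vector_mult Q this]
  show "L1_loc (\<lambda>x. J *v (Q x *v y x - g x))"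
    by (intro L1_loc_linear[OF L1_loc_diff mv_bounded_linear] g)
  show "AE x in halfline. (y has_vector_derivative J *v (Q x *v y x - g x)) (at x)"
    using AC_loc_differentiable_AE[OF y] assms(3)
  proof eventually_elim
    case (elim x)
    then have "(y has_vector_derivative vector_derivative y (at x)) (at x)"
      using vector_derivative_works differentiableI_vector by blast
    moreover have "J *v (Q x *v y x - g x) = vector_derivative y (at x)"
      using elim(2) unfolding dirac_expr_def by (metis J_J add_diff_cancel_right' add.inverse_inverse minus_diff_eq mv_minus)
    ultimately show ?case by simp
  qed
qed

end

section \<open>Square-integrable functions and their classes\<close>

lemma square_integrable_L1_loc:
  assumes "square_integrable f"
  shows "L1_loc f"
  unfolding L1_loc_def
proof (intro allI impI)
  fix b :: real
  have "L1_loc (\<lambda>x. (norm (f x))\<^sup>2)"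
    using assms by (intro halfline_integrable_L1_loc) (simp add: square_integrable_def)
  then have i: "(\<lambda>x. 1 + (norm (f x))\<^sup>2) integrable_on {0..b}"
    using L1_loc_integrable(1)[OF _ order_refl] by (intro integrable_add) auto
  have "f \<in> borel_measurable (lebesgue_on {0..b})"
    using assms unfolding square_integrable_def by (elim conjE, elim measurable_restrict_mono) auto
  then show "f absolutely_integrable_on {0..b}"
  proof (rule measurable_bounded_by_integrable_imp_absolutely_integrable[OF _ _ i])
    fix x
    have "norm (f x) \<le> 1 + (norm (f x))\<^sup>2"
      using sum_squares_bound[of 1 "norm (f x)"] norm_ge_zero[of "f x"] unfolding one_power2 by linarith
    then show "norm (f x) \<le> 1 + (norm (f x))\<^sup>2" .
  qed auto
qed

lemma square_integrable_cong_AE: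
  assumes f: "square_integrable f" and ae: "AE x in halfline. g x = f x"
  shows "square_integrable g"
proof -
  have m: "g \<in> borel_measurable halfline"
    by (intro L1_loc_measurable L1_loc_cong_AE[OF square_integrable_L1_loc[OF f] ae])
  have "integrable halfline (\<lambda>x. (norm (g x))\<^sup>2)"
    by (rule integrable_cong_AE_imp[where g = "\<lambda>x. (norm (f x))\<^sup>2"])
       (use f m ae in \<open>auto simp: square_integrable_def elim: eventually_mono\<close>)
  with m show ?thesis by (simp add: square_integrable_def)
qed

lemma square_integrable_diff:
  assumes "square_integrable f" "square_integrable g"
  shows "square_integrable (\<lambda>x. f x - g x)"
  using square_integrable_add[OF assms(1) square_integrable_scale[OF assms(2), of "-1"]]
  by (simp add: vec_eq_iff)

lemma square_integrable_J:
  assumes "square_integrable f"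
  shows "square_integrable (\<lambda>x. J *v f x)"
proof -
  have "(\<lambda>x. J *v f x) \<in> borel_measurable halfline"
    using assms by (intro L1_loc_measurable L1_loc_linear[OF _ mv_bounded_linear] square_integrable_L1_loc)
  then show ?thesis using assms by (simp add: square_integrable_def norm_J)
qed

lemma L2_eq_refl: "L2_eq f f \<longleftrightarrow> square_integrable f"
  by (auto simp: L2_eq_def)

lemma L2_class_eq_iff:
  assumes "square_integrable f" "square_integrable g"
  shows "L2_class f = L2_class g \<longleftrightarrow> (AE x in halfline. f x = g x)"
  using Quotient3_rel[OF Quotient3_L2, of f g] assms by (simp add: L2_eq_def)

lemma L2_class_surj:
  obtains f where "square_integrable f" "F = L2_class f"
  using Quotient3_abs_rep[OF Quotient3_L2, of F] Quotient3_rep_reflp[OF Quotient3_L2, of F] that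
  unfolding L2_eq_refl by metis

lemma L2_class_add: "square_integrable f \<Longrightarrow> square_integrable g \<Longrightarrow> L2_class f + L2_class g = L2_class (\<lambda>x. f x + g x)"
  by (rule plus_L2.abs_eq) (simp_all add: L2_eq_refl)

lemma L2_class_scale: "square_integrable f \<Longrightarrow> scaleC_L2 c (L2_class f) = L2_class (\<lambda>x. c *s f x)"
  by (rule scaleC_L2.abs_eq) (simp_all add: L2_eq_refl)

lemma L2_class_zero: "L2_class (\<lambda>x. 0) = 0"
  by (simp add: zero_L2_def)

lemma L2_class_diff:
  assumes f: "square_integrable f" and g: "square_integrable g"
  shows "L2_class f - L2_class g = L2_class (\<lambda>x. f x - g x)"
proof -
  have "(\<lambda>x. f x + - 1 *s g x) = (\<lambda>x. f x - g x)" by (simp add: fun_eq_iff vec_eq_iff)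
  then show ?thesis
    unfolding minus_L2_def uminus_L2_def L2_class_scale[OF g]
      L2_class_add[OF f square_integrable_scale[OF g]] by (simp only:)
qed

lemma cinner_L2_class: "square_integrable f \<Longrightarrow> square_integrable g \<Longrightarrow>
    cinner_L2 (L2_class f) (L2_class g) = integral\<^sup>L halfline (\<lambda>x. cdot (f x) (g x))"
  by (rule cinner_L2.abs_eq) (simp_all add: L2_eq_refl)

lemma norm_L2_class: "square_integrable f \<Longrightarrow> (norm (L2_class f))\<^sup>2 = integral\<^sup>L halfline (\<lambda>x. (norm (f x))\<^sup>2)"
  by (simp add: power2_norm_eq_inner inner_L2_def cinner_L2_class cdot_self del: of_real_power)

section \<open>Integrals over the half-line as limits\<close>

lemma integral_halfline_cut:
  fixes k :: "real \<Rightarrow> 'a::euclidean_space"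
  assumes "L1_loc k" "b \<ge> 0"
  shows "integrable halfline (\<lambda>x. indicator {0..b} x *\<^sub>R k x)"
    and "integral\<^sup>L halfline (\<lambda>x. indicator {0..b} x *\<^sub>R k x) = integral {0..b} k"
proof -
  have ai: "k absolutely_integrable_on {0..b}" using assms by (auto simp: L1_loc_def)
  have eq: "indicator {0..} x * indicator {0..b} x = (indicator {0..b} x :: real)" for x :: real
    by (auto simp: indicator_def)
  show "integrable halfline (\<lambda>x. indicator {0..b} x *\<^sub>R k x)"
    using ai by (subst integrable_restrict_space) (simp_all add: set_integrable_def eq)
  have "integral\<^sup>L halfline (\<lambda>x. indicator {0..b} x *\<^sub>R k x) = integral\<^sup>L lebesgue (\<lambda>x. indicator {0..b} x *\<^sub>R k x)"
    by (subst integral_restrict_space) (simp_all add: eq)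
  also have "\<dots> = integral {0..b} k"
    using set_lebesgue_integral_eq_integral(2)[OF ai] by (simp add: set_lebesgue_integral_def)
  finally show "integral\<^sup>L halfline (\<lambda>x. indicator {0..b} x *\<^sub>R k x) = integral {0..b} k" .
qed

lemma integral_halfline_LIMSEQ:
  fixes k :: "real \<Rightarrow> 'a::euclidean_space"
  assumes "integrable halfline k"
  shows "((\<lambda>b. integral {0..b} k) \<longlongrightarrow> integral\<^sup>L halfline k) at_top"
proof -
  have "((\<lambda>b. integral\<^sup>L halfline (\<lambda>x. indicator {0..b} x *\<^sub>R k x)) \<longlongrightarrow> integral\<^sup>L halfline k) at_top"
  proof (rule integral_dominated_convergence_at_top[where w = "\<lambda>x. norm (k x)"])
    show "eventually (\<lambda>b. AE x in halfline. norm (indicator {0..b} x *\<^sub>R k x) \<le> norm (k x)) at_top"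
      by (intro always_eventually allI AE_I2) (auto simp: indicator_def)
    show "AE x in halfline. ((\<lambda>b. indicator {0..b} x *\<^sub>R k x) \<longlongrightarrow> k x) at_top"
    proof (rule AE_I2)
      fix x assume "x \<in> space halfline"
      then have x: "x \<ge> 0" by simp
      have "eventually (\<lambda>b. indicator {0..b} x *\<^sub>R k x = k x) at_top"
        using eventually_ge_at_top[of x] by eventually_elim (use x in \<open>auto simp: indicator_def\<close>)
      then show "((\<lambda>b. indicator {0..b} x *\<^sub>R k x) \<longlongrightarrow> k x) at_top" by (rule tendsto_eventually)
    qed
    have "(\<lambda>x. indicator {0..b} x *\<^sub>R k x) \<in> borel_measurable halfline" for b :: real
      using assms by (intro borel_measurable_scaleR borel_measurable_indicator borel_measurable_integrable)
        (auto simp: sets_restrict_space_iff)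
    then show "(\<lambda>x. indicator {0..b} x *\<^sub>R k x) \<in> borel_measurable halfline" for b :: real .
  qed (use assms in auto)
  moreover have "eventually (\<lambda>b. integral\<^sup>L halfline (\<lambda>x. indicator {0..b} x *\<^sub>R k x) = integral {0..b} k) at_top"
    using eventually_ge_at_top[of 0]
    by eventually_elim (rule integral_halfline_cut(2)[OF halfline_integrable_L1_loc[OF assms]])
  ultimately show ?thesis using tendsto_cong by force
qed

lemma integrable_halfline_bounded:
  fixes f :: "real \<Rightarrow> real"
  assumes f: "L1_loc f" and nonneg: "\<And>x. f x \<ge> 0" and bound: "\<And>b. b \<ge> 0 \<Longrightarrow> integral {0..b} f \<le> B"
  shows "integrable halfline f"
proof -
  define c where "c n = integral {0..real n} f" for n :: nat
  have "incseq c" unfolding incseq_def c_def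
    by (intro allI impI integral_subset_le) (use L1_loc_integrable[OF f order_refl] nonneg in auto)
  moreover have "bdd_above (range c)"
    using bound by (intro bdd_aboveI2[of _ _ B]) (auto simp: c_def)
  ultimately obtain l where l: "c \<longlonglongrightarrow> l" using LIMSEQ_incseq_SUP by blast
  show ?thesis
  proof (rule integrable_monotone_convergence)
    show "integrable halfline (\<lambda>x. indicator {0..real n} x *\<^sub>R f x)" for n
      by (rule integral_halfline_cut(1)[OF f]) simp
    show "AE x in halfline. mono (\<lambda>n. indicator {0..real n} x *\<^sub>R f x)"
      by (intro AE_I2) (auto simp: mono_def indicator_def nonneg)
    show "AE x in halfline. (\<lambda>n. indicator {0..real n} x *\<^sub>R f x) \<longlonglongrightarrow> f x"
    proof (rule AE_I2)
      fix x assume "x \<in> space halfline"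
      then have x: "x \<ge> 0" by simp
      have "eventually (\<lambda>n. indicator {0..real n} x *\<^sub>R f x = f x) sequentially"
        using eventually_ge_at_top[of "nat \<lceil>x\<rceil>"]
        by eventually_elim (use x in \<open>auto simp: indicator_def nat_le_iff ceiling_le_iff\<close>)
      then show "(\<lambda>n. indicator {0..real n} x *\<^sub>R f x) \<longlonglongrightarrow> f x" by (rule tendsto_eventually)
    qed
    show "(\<lambda>n. integral\<^sup>L halfline (\<lambda>x. indicator {0..real n} x *\<^sub>R f x)) \<longlonglongrightarrow> l"
      using l[unfolded c_def[abs_def]] by (simp add: integral_halfline_cut(2)[OF f] del: real_scaleR_def)
    show "f \<in> borel_measurable halfline" by (rule L1_loc_measurable[OF f])
  qed
qed

text \<open>An integrable derivative gives \<open>w\<close> a limit at infinity, and an integrable function has no other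
limit than 0. This is why infinity contributes no
boundary term.\<close>

lemma primitive_integrable_integral_derivative:
  fixes w :: "real \<Rightarrow> 'a::euclidean_space"
  assumes w: "primitive w k" "integrable halfline w" and k: "integrable halfline k"
  shows "integral\<^sup>L halfline k = - w 0"
proof (rule ccontr)
  define L where "L = w 0 + integral\<^sup>L halfline k"
  assume "integral\<^sup>L halfline k \<noteq> - w 0"
  then have L: "norm L > 0" by (simp add: L_def eq_neg_iff_add_eq_0 add.commute)
  have "((\<lambda>x. w 0 + integral {0..x} k) \<longlongrightarrow> L) at_top"
    unfolding L_def by (intro tendsto_intros integral_halfline_LIMSEQ k)
  then have "eventually (\<lambda>x. dist (w 0 + integral {0..x} k) L < norm L / 2) at_top"
    using L by (intro tendstoD) auto
  then obtain X0 where X0: "\<And>x. x \<ge> X0 \<Longrightarrow> dist (w 0 + integral {0..x} k) L < norm L / 2"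
    unfolding eventually_at_top_linorder by blast
  define X where "X = max X0 0"
  have big: "norm L / 2 \<le> norm (w x)" if "x \<ge> X" for x
  proof -
    have "w x = w 0 + integral {0..x} k" using primitiveD(2)[OF w(1), of x] that by (simp add: X_def)
    then have "dist (w x) L < norm L / 2" using X0[of x] that by (simp add: X_def)
    then show ?thesis using norm_triangle_ineq2[of L "w x"] by (simp add: dist_norm norm_minus_commute)
  qed
  define I where "I = integral\<^sup>L halfline (\<lambda>x. norm (w x))"
  have wn: "L1_loc (\<lambda>x. norm (w x))" using w(2) by (intro halfline_integrable_L1_loc) auto
  obtain n :: nat where n: "real n > I / (norm L / 2)" using reals_Archimedean2 by blast
  have "real n * (norm L / 2) = integral {X..X + real n} (\<lambda>x. norm L / 2)" by simp
  also have "\<dots> \<le> integral {X..X + real n} (\<lambda>x. norm (w x))"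
    by (rule integral_le) (use big L1_loc_integrable(1)[OF wn, of X] in \<open>auto simp: X_def\<close>)
  also have "\<dots> \<le> integral {0..X + real n} (\<lambda>x. norm (w x))"
    by (rule integral_subset_le) (use L1_loc_integrable(1)[OF wn] in \<open>auto simp: X_def\<close>)
  also have "\<dots> = integral\<^sup>L halfline (\<lambda>x. indicator {0..X + real n} x *\<^sub>R norm (w x))"
    by (rule integral_halfline_cut(2)[OF wn, symmetric]) (simp add: X_def)
  also have "\<dots> \<le> I" unfolding I_def
    by (rule integral_mono) (use integral_halfline_cut(1)[OF wn, of "X + real n"] w(2) in \<open>auto simp: X_def indicator_def\<close>)
  finally show False using n L by (simp add: field_simps)
qed

section \<open>The Lagrange identity\<close>

text \<open>The contributions of \<open>Q\<close> and of its adjoint cancel, and \<open>J\<close>, being constant, contributes no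
derivative.\<close>

lemma lagrange_identity:
  assumes "solves Q y g" "solves (\<lambda>x. ctranspose (Q x)) z k"
  shows "primitive (\<lambda>x. cdot (J *v y x) (z x)) (\<lambda>x. cdot (g x) (z x) - cdot (y x) (k x))"
proof -
  have "primitive (\<lambda>x. J *v y x) (\<lambda>x. J *v (J *v (Q x *v y x - g x)))"
    using assms(1) unfolding solves_def by (rule primitive_linear[OF _ mv_bounded_linear])
  from primitive_bilinear[OF bounded_bilinear_cdot this assms(2)[unfolded solves_def]]
  show ?thesis
    by (rule back_subst[where P = "primitive _"])
       (simp add: fun_eq_iff cdot_J_J J_J cdot_diff_left cdot_diff_right cdot_minus_left cdot_ctranspose[of "Q _"])
qed

text \<open>With the same \<open>Q\<close> on both sides, the Hermitian part of \<open>Q\<close> drops out because its form is real.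
The derivative is written with \<open>g - Q y\<close> since the form of \<open>Q\<close> alone is what the bounds of the
imaginary part control.\<close>

lemma lagrange_identity_self:
  assumes "solves Q y g"
  shows "primitive (\<lambda>x. cdot (J *v y x) (y x)) (\<lambda>x. 2 * \<i> * of_real (Im (cdot (g x - Q x *v y x) (y x))))"
proof -
  have "primitive (\<lambda>x. J *v y x) (\<lambda>x. J *v (J *v (Q x *v y x - g x)))"
    using assms unfolding solves_def by (rule primitive_linear[OF _ mv_bounded_linear])
  from primitive_bilinear[OF bounded_bilinear_cdot this assms[unfolded solves_def]]
  have "primitive (\<lambda>x. cdot (J *v y x) (y x)) (\<lambda>x. cdot (y x) (Q x *v y x - g x) - cdot (Q x *v y x - g x) (y x))"
    by (rule back_subst[where P = "primitive _"]) (simp add: fun_eq_iff cdot_J_J J_J cdot_minus_left cdot_diff_left)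
  moreover have "cdot (y x) (Q x *v y x - g x) - cdot (Q x *v y x - g x) (y x)
      = 2 * \<i> * of_real (Im (cdot (g x - Q x *v y x) (y x)))" for x
  proof -
    have "cdot (y x) (Q x *v y x - g x) = cnj (cdot (Q x *v y x - g x) (y x))" by (rule cdot_commute)
    moreover have "cdot (g x - Q x *v y x) (y x) = - cdot (Q x *v y x - g x) (y x)"
      by (simp add: cdot_diff_left)
    ultimately show ?thesis by (simp add: complex_eq_iff)
  qed
  ultimately show ?thesis by simp
qed

text \<open>The boundary form is integrable for square-integrable functions, so the Lagrange identity can be
integrated up to infinity.\<close>

lemma green_formula:
  assumes "solves Q y g" "solves (\<lambda>x. ctranspose (Q x)) z k"
    and "square_integrable y" "square_integrable g" "square_integrable z" "square_integrable k"
  shows "cinner_L2 (L2_class g) (L2_class z) - cinner_L2 (L2_class y) (L2_class k) = - cdot (J *v y 0) (z 0)"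
proof -
  have "integral\<^sup>L halfline (\<lambda>x. cdot (g x) (z x) - cdot (y x) (k x)) = - cdot (J *v y 0) (z 0)"
    by (rule primitive_integrable_integral_derivative[OF lagrange_identity[OF assms(1,2)]])
       (intro integrable_cdot square_integrable_J assms Bochner_Integration.integrable_diff)+
  then show ?thesis
    by (simp add: cinner_L2_class assms integrable_cdot)
qed

section \<open>Lagrangian boundary conditions\<close>

text \<open>The properties of \<open>cos \<Phi>\<close> and \<open>sin \<Phi>\<close> on which everything depends. They make the solution set of
the boundary condition Lagrangian for the form \<open>cdot (J *v u) v\<close>. Stating them separately admits
the conditions \<open>y\<^sub>1(0) = 0\<close> and \<open>y\<^sub>2(0) = 0\<close> as well, from which the minimal operator is obtained.\<close>

locale lagrangian =
  fixes C S :: "complex ^ 'p ^ ('p::finite)"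
  assumes hermitian: "ctranspose C = C" "ctranspose S = S"
    and commute: "C ** S = S ** C"
    and pythagoras: "C ** C + S ** S = mat 1"
begin

definition boundary :: "(complex ^ ('p + 'p)) set" where
  "boundary = {u. C *v upper u + S *v lower u = 0}"

definition param :: "complex ^ 'p \<Rightarrow> complex ^ ('p + 'p)" where
  "param k = join (- (S *v k)) (C *v k)"

lemma pyth: "C *v (C *v k) + S *v (S *v k) = k"
  using arg_cong[OF pythagoras, of "\<lambda>A. A *v k"]
  by (simp add: mv_add_left matrix_vector_mul_assoc)

lemma comm: "C *v (S *v k) = S *v (C *v k)"
  by (simp add: matrix_vector_mul_assoc commute)

lemma param_in_boundary: "param k \<in> boundary"
  by (simp add: boundary_def param_def upper_join lower_join mv_minus comm)

lemma boundary_param: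
  assumes "u \<in> boundary"
  shows "param (C *v lower u - S *v upper u) = u"
proof -
  have e: "C *v upper u = - (S *v lower u)"
    using assms by (simp add: boundary_def eq_neg_iff_add_eq_0)
  have "- (S *v (C *v lower u - S *v upper u)) = C *v (C *v upper u) + S *v (S *v upper u)"
    by (simp add: mv_diff e mv_minus comm)
  moreover have "C *v (C *v lower u - S *v upper u) = C *v (C *v lower u) + S *v (S *v lower u)"
    by (simp add: mv_diff comm e mv_minus)
  ultimately show ?thesis
    by (intro upper_lower_eqI) (simp_all add: param_def upper_join lower_join pyth)
qed

lemma param_add: "param (k + k') = param k + param k'"
  and param_scale: "param (c *s k) = c *s param k"
  by (intro upper_lower_eqI; simp add: param_def upper_lower_simps upper_join lower_join mv_add mv_scale vec_eq_iff)+

lemma param_eq_0: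
  assumes "param k = 0"
  shows "k = 0"
proof -
  have "upper (param k) = 0" "lower (param k) = 0" using assms by (simp_all add: upper_lower_simps)
  then have "S *v k = 0" "C *v k = 0" by (simp_all add: param_def upper_join lower_join)
  then show "k = 0" using pyth[of k] by (simp add: mv_zero)
qed

lemma param_sum: "param (\<chi> j. c j) = (\<Sum>j\<in>UNIV. c j *s param (axis j 1))"
proof -
  have p0: "param 0 = 0" using param_scale[of 0 0] by (simp add: vec_eq_iff)
  have sum: "param (\<Sum>j\<in>A. f j) = (\<Sum>j\<in>A. param (f j))" if "finite A" for f :: "'p \<Rightarrow> complex ^ 'p" and A
    using that by (induction A rule: finite_induct) (simp_all add: param_add p0)
  have "(\<chi> j. c j) = (\<Sum>j\<in>UNIV. c j *s axis j 1)"
    using basis_expansion[of "\<chi> j. c j"] by simp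
  then show ?thesis by (simp add: sum param_scale)
qed

lemma boundary_isotropic:
  assumes "u \<in> boundary" "v \<in> boundary"
  shows "cdot (J *v u) v = 0"
proof -
  obtain k m where "u = param k" "v = param m"
    using boundary_param assms by metis
  then have "cdot (J *v u) v = cdot (C *v k) (S *v m) - cdot (S *v k) (C *v m)"
    by (simp add: cdot_upper_lower upper_J lower_J param_def upper_join lower_join cdot_minus_left cdot_minus_right)
  also have "\<dots> = 0"
    by (simp add: cdot_ctranspose[of C] cdot_ctranspose[of S] hermitian comm)
  finally show ?thesis .
qed

lemma boundary_subspace:
  "0 \<in> boundary" "u \<in> boundary \<Longrightarrow> v \<in> boundary \<Longrightarrow> u + v \<in> boundary" "u \<in> boundary \<Longrightarrow> c *s u \<in> boundary"
  "u \<in> boundary \<Longrightarrow> v \<in> boundary \<Longrightarrow> u - v \<in> boundary"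
proof -
  show "0 \<in> boundary" by (simp add: boundary_def upper_lower_simps mv_zero)
  show "u + v \<in> boundary" if "u \<in> boundary" "v \<in> boundary"
  proof -
    have "C *v upper (u + v) + S *v lower (u + v)
        = (C *v upper u + S *v lower u) + (C *v upper v + S *v lower v)"
      by (simp add: upper_lower_simps mv_add)
    then show ?thesis using that by (simp add: boundary_def)
  qed
  show "u - v \<in> boundary" if "u \<in> boundary" "v \<in> boundary"
  proof -
    have "C *v upper (u - v) + S *v lower (u - v)
        = (C *v upper u + S *v lower u) - (C *v upper v + S *v lower v)"
      by (simp add: upper_lower_simps mv_diff)
    then show ?thesis using that by (simp add: boundary_def)
  qed
  show "c *s u \<in> boundary" if "u \<in> boundary"
  proof -
    have eq: "C *v upper (c *s u) + S *v lower (c *s u) = c *s (C *v upper u + S *v lower u)"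
      by (simp add: upper_lower_simps mv_scale vector_add_ldistrib)
    have z: "c *s (0 :: complex ^ 'p) = 0" by (simp add: vec_eq_iff)
    show ?thesis using that unfolding boundary_def mem_Collect_eq eq by (simp only: z)
  qed
qed

lemma closed_boundary: "closed boundary"
proof -
  have "linear (upper :: complex ^ ('p + 'p) \<Rightarrow> complex ^ 'p)" "linear (lower :: complex ^ ('p + 'p) \<Rightarrow> complex ^ 'p)"
    by (auto intro!: linearI simp: upper_lower_simps)
  then have "continuous_on UNIV (\<lambda>u. C *v upper u + S *v lower u)"
    by (intro continuous_on_add linear_continuous_on bounded_linear_compose[OF mv_bounded_linear])
       (auto simp: linear_conv_bounded_linear)
  then show ?thesis unfolding boundary_def
    by (intro closed_Collect_eq continuous_on_const) auto
qed

end

section \<open>Solvability for coercive coefficients\<close>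

text \<open>The imaginary part of \<open>-P\<close> is definite with sign \<open>s\<close>. For \<open>P = Q - l\<close> the sign is 1 when \<open>Im l\<close>
lies above the bounds of the imaginary part of \<open>Q\<close>, and -1 when it lies below.\<close>

definition coercive :: "(real \<Rightarrow> complex ^ 'n ^ 'n) \<Rightarrow> real \<Rightarrow> real \<Rightarrow> bool" where
  "coercive P s d \<longleftrightarrow> \<bar>s\<bar> = 1 \<and> d > 0 \<and>
     (AE x in halfline. \<forall>u. d * (norm u)\<^sup>2 \<le> s * Im (cdot (- (P x *v u)) u))"

lemma integral_mono_AE_halfline:
  fixes f g :: "real \<Rightarrow> real"
  assumes "L1_loc f" "L1_loc g" "AE x in halfline. f x \<le> g x" "b \<ge> 0"
  shows "integral {0..b} f \<le> integral {0..b} g"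
proof -
  have "integral\<^sup>L halfline (\<lambda>x. indicator {0..b} x *\<^sub>R f x) \<le> integral\<^sup>L halfline (\<lambda>x. indicator {0..b} x *\<^sub>R g x)"
    by (intro integral_mono_AE integral_halfline_cut assms eventually_mono[OF assms(3)]) (auto simp: indicator_def)
  then show ?thesis using integral_halfline_cut(2)[OF assms(1,4)] integral_halfline_cut(2)[OF assms(2,4)] by simp
qed

lemma L1_loc_power2_norm:
  "continuous_on {0..} y \<Longrightarrow> L1_loc (\<lambda>x. (norm (y x))\<^sup>2)"
  "square_integrable f \<Longrightarrow> L1_loc (\<lambda>x. (norm (f x))\<^sup>2)"
proof -
  show "L1_loc (\<lambda>x. (norm (y x))\<^sup>2)" if "continuous_on {0..} y"
    using that by (intro L1_loc_continuous continuous_intros)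
  show "L1_loc (\<lambda>x. (norm (f x))\<^sup>2)" if "square_integrable f"
    using that by (intro halfline_integrable_L1_loc) (simp add: square_integrable_def)
qed

text \<open>Integrating the Lagrange identity for \<open>y\<close> with itself, the boundary terms vanish, so the form of
the definite part is bounded by the pairing of \<open>f\<close> with \<open>y\<close>; Young's inequality absorbs half of
it. The constant does not depend on \<open>b\<close>.\<close>

lemma local_energy_estimate:
  assumes y: "solves P y f" and f: "square_integrable f"
    and bc: "cdot (J *v y 0) (y 0) = 0" "cdot (J *v y b) (y b) = 0" and b: "b \<ge> 0"
    and P: "coercive P s d"
  shows "integral {0..b} (\<lambda>x. (norm (y x))\<^sup>2) \<le> integral {0..b} (\<lambda>x. (norm (f x))\<^sup>2) / d\<^sup>2"
proof -
  define q where "q x = Im (cdot (f x - P x *v y x) (y x))" for x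
  have d: "d > 0" and s: "\<bar>s\<bar> = 1" using P by (auto simp: coercive_def)
  have "bounded_linear (\<lambda>z :: complex. Im z / 2)"
    using bounded_linear_compose[OF bounded_linear_divide bounded_linear_Im] by simp
  from primitive_linear[OF lagrange_identity_self[OF y] this]
  have q: "primitive (\<lambda>x. Im (cdot (J *v y x) (y x)) / 2) q"
    by (rule back_subst[where P = "primitive _"]) (simp add: fun_eq_iff q_def)
  have q0: "integral {0..b} q = 0" using primitiveD(2)[OF q b] bc by simp
  have yc: "continuous_on {0..} y" by (rule solves_continuous[OF y])
  have L: "L1_loc (\<lambda>x. d / 2 * (norm (y x))\<^sup>2)" "L1_loc (\<lambda>x. s * q x)" "L1_loc (\<lambda>x. 1 / (2 * d) * (norm (f x))\<^sup>2)"
    by (intro L1_loc_linear[OF _ bounded_linear_mult_right] L1_loc_power2_norm yc f primitiveD(1)[OF q])+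
  have "AE x in halfline. d / 2 * (norm (y x))\<^sup>2 \<le> s * q x + 1 / (2 * d) * (norm (f x))\<^sup>2"
    using P[unfolded coercive_def, THEN conjunct2, THEN conjunct2]
  proof eventually_elim
    case (elim x)
    have "cdot (- (P x *v y x)) (y x) = cdot (f x - P x *v y x) (y x) - cdot (f x) (y x)"
      by (simp add: cdot_diff_left cdot_minus_left)
    then have "d * (norm (y x))\<^sup>2 \<le> s * q x - s * Im (cdot (f x) (y x))"
      using elim[rule_format, of "y x"] by (simp add: q_def right_diff_distrib)
    moreover have "- s * Im (cdot (f x) (y x)) \<le> norm (f x) * norm (y x)"
    proof -
      have "- s * Im (cdot (f x) (y x)) \<le> \<bar>s * Im (cdot (f x) (y x))\<bar>" by linarith
      also have "\<dots> = \<bar>Im (cdot (f x) (y x))\<bar>" by (simp add: abs_mult s)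
      also have "\<dots> \<le> norm (f x) * norm (y x)" by (rule order_trans[OF abs_Im_le_cmod norm_cdot_le])
      finally show ?thesis .
    qed
    moreover have "norm (f x) * norm (y x) \<le> d / 2 * (norm (y x))\<^sup>2 + 1 / (2 * d) * (norm (f x))\<^sup>2"
    proof -
      have "0 \<le> (d * norm (y x) - norm (f x))\<^sup>2 / (2 * d)" using d by simp
      also have "\<dots> = d / 2 * (norm (y x))\<^sup>2 + 1 / (2 * d) * (norm (f x))\<^sup>2 - norm (f x) * norm (y x)"
        using d by (simp add: power2_diff power_mult_distrib field_simps power2_eq_square)
      finally show ?thesis by simp
    qed
    ultimately show ?case by linarith
  qed
  from integral_mono_AE_halfline[OF L(1) L1_loc_add[OF L(2,3)] this b]
  have "integral {0..b} (\<lambda>x. d / 2 * (norm (y x))\<^sup>2) \<le> integral {0..b} (\<lambda>x. s * q x) + integral {0..b} (\<lambda>x. 1 / (2 * d) * (norm (f x))\<^sup>2)"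
    using L1_loc_integrable(1)[OF L(2) order_refl, of b] L1_loc_integrable(1)[OF L(3) order_refl, of b]
    by (simp only: integral_add)
  then have "d / 2 * integral {0..b} (\<lambda>x. (norm (y x))\<^sup>2) \<le> 1 / (2 * d) * integral {0..b} (\<lambda>x. (norm (f x))\<^sup>2)"
    by (simp only: integral_mult_right q0)
  then show ?thesis using d by (simp add: field_simps power2_eq_square)
qed

lemma isotropic_upper_0: "upper u = 0 \<Longrightarrow> cdot (J *v u) u = 0"
  by (simp add: cdot_upper_lower upper_J lower_J cdot_zero_left cdot_zero_right)

context lagrangian
begin

text \<open>Shooting from 0: the map from the parameters of the initial value to the upper part at \<open>b\<close> is
linear between spaces of equal dimension, and by the energy estimate it is injective. Hence it is
surjective and can compensate the value of any particular solution at \<open>b\<close>.\<close>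

lemma regular_boundary_problem:
  assumes P: "L1_loc P" "coercive P s d" and f: "square_integrable f" and b: "b > 0"
  obtains y where "solves P y f" "y 0 \<in> boundary" "upper (y b) = 0"
proof -
  obtain E where E: "\<And>g c. L1_loc g \<Longrightarrow> \<exists>y. solves P y g \<and> y 0 = c \<and>
      (\<forall>x\<ge>0. norm (y x) \<le> (norm c + integral {0..x} (\<lambda>t. norm (g t))) * E x)"
    by (rule solves_exists[OF P(1)]) (rule that, assumption)
  have z: "L1_loc (\<lambda>x. 0 :: complex ^ ('p + 'p))" by (intro L1_loc_continuous continuous_on_const)
  have "\<forall>c. \<exists>y. solves P y (\<lambda>x. 0) \<and> y 0 = c" using E[OF z] by blast
  then obtain Y where Y: "\<And>c. solves P (Y c) (\<lambda>x. 0)" "\<And>c. Y c 0 = c" by metis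
  obtain y0 where y0: "solves P y0 f" "y0 0 = 0" using E[OF square_integrable_L1_loc[OF f], of 0] by blast
  have Y_add: "Y (c + c') b = Y c b + Y c' b" for c c'
    by (rule solves_unique[OF P(1) Y(1) _ _ less_imp_le[OF b]]) (use solves_add[OF Y(1)[of c] Y(1)[of c']] in \<open>auto simp: Y(2)\<close>)
  have Y_scale: "Y (r *\<^sub>R c) b = r *\<^sub>R Y c b" for r c
    by (rule solves_unique[OF P(1) Y(1) _ _ less_imp_le[OF b]])
       (use solves_scale[OF Y(1)[of c], of "complex_of_real r"] in \<open>auto simp: Y(2) scale_of_real\<close>)
  define G where "G k = upper (Y (param k) b)" for k
  have G: "linear G"
    by (intro linearI) (simp_all add: G_def param_add Y_add Y_scale upper_lower_simps param_scale[of "of_real _", unfolded scale_of_real])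
  moreover have "inj G"
    unfolding linear_injective_0[OF G]
  proof (intro allI impI)
    fix k assume k: "G k = 0"
    have "integral {0..b} (\<lambda>x. (norm (Y (param k) x))\<^sup>2) \<le> integral {0..b} (\<lambda>x. (norm (0 :: complex ^ ('p + 'p)))\<^sup>2) / d\<^sup>2"
      by (rule local_energy_estimate[OF Y(1) square_integrable_zero _ _ less_imp_le[OF b] P(2)])
         (use k in \<open>simp_all add: Y(2) boundary_isotropic param_in_boundary isotropic_upper_0 G_def\<close>)
    moreover have c: "continuous_on {0..b} (\<lambda>x. (norm (Y (param k) x))\<^sup>2)"
      by (intro continuous_intros continuous_on_subset[OF solves_continuous[OF Y(1)]]) auto
    moreover have "0 \<le> integral {0..b} (\<lambda>x. (norm (Y (param k) x))\<^sup>2)"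
      by (intro Henstock_Kurzweil_Integration.integral_nonneg integrable_continuous_real c) auto
    ultimately have "integral {0..b} (\<lambda>x. (norm (Y (param k) x))\<^sup>2) = 0" by simp
    then have "(norm (Y (param k) 0))\<^sup>2 = 0"
      using integral_eq_0_iff[OF c] b by auto
    then have "param k = 0" by (simp add: Y(2))
    then show "k = 0" by (rule param_eq_0)
  qed
  ultimately have "surj G" by (rule linear_injective_imp_surjective[OF _ _ refl])
  then obtain k where k: "G k = - upper (y0 b)" by (metis surjD)
  show ?thesis
  proof (rule that)
    show "solves P (\<lambda>x. Y (param k) x + y0 x) f"
      using solves_add[OF Y(1)[of "param k"] y0(1)] by simp
    show "Y (param k) 0 + y0 0 \<in> boundary" by (simp add: Y(2) y0 param_in_boundary)
    show "upper (Y (param k) b + y0 b) = 0" using k by (simp add: upper_lower_simps G_def)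
  qed
qed

end

text \<open>When \<open>P\<close> is merely locally integrable, \<open>P y\<close> is not controlled by the square integral of \<open>y\<close>, and
neither is \<open>y'\<close>. Instead, \<open>y\<close> is paired with the solution \<open>z\<close> of the homogeneous adjoint equation
that starts at \<open>J y(0)\<close>. In the Lagrange identity \<open>P\<close> has disappeared, and its boundary term at 0
is \<open>\<bar>y(0)\<bar>\<^sup>2\<close>; averaging over the unit interval gives the bound.\<close>

lemma initial_value_bound:
  assumes P: "L1_loc P" and f: "L1_loc f"
  obtains B where "\<And>y. solves P y f \<Longrightarrow> (norm (y 0))\<^sup>2 \<le> B * (1 + integral {0..1} (\<lambda>x. (norm (y x))\<^sup>2))"
proof -
  have P': "L1_loc (\<lambda>x. ctranspose (P x))" by (rule L1_loc_ctranspose[OF P])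
  obtain E where E: "\<And>x y. 0 \<le> x \<Longrightarrow> x \<le> y \<Longrightarrow> E x \<le> E y" "\<And>x. E x > 0"
    "\<And>g c. L1_loc g \<Longrightarrow> \<exists>z. solves (\<lambda>x. ctranspose (P x)) z g \<and> z 0 = c \<and>
      (\<forall>x\<ge>0. norm (z x) \<le> (norm c + integral {0..x} (\<lambda>t. norm (g t))) * E x)"
    by (rule solves_exists[OF P']) (rule that, assumption+)
  have z0: "L1_loc (\<lambda>x. 0 :: complex ^ ('a + 'a))" by (intro L1_loc_continuous continuous_on_const)
  define F where "F = integral {0..1} (\<lambda>t. norm (f t))"
  have F: "F \<ge> 0" unfolding F_def
    by (rule Henstock_Kurzweil_Integration.integral_nonneg) (use L1_loc_integrable[OF f order_refl] in auto)
  define B where "B = 2 * (E 1)\<^sup>2 * max 1 (F\<^sup>2)"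
  show ?thesis
  proof (rule that[of B])
    fix y assume y: "solves P y f"
    define c where "c = y 0"
    obtain z where z: "solves (\<lambda>x. ctranspose (P x)) z (\<lambda>x. 0)" "z 0 = J *v c"
      "\<And>x. x \<ge> 0 \<Longrightarrow> norm (z x) \<le> norm c * E x"
      using E(3)[OF z0, of "J *v c"] by (auto simp: norm_J)
    have zE: "norm (z x) \<le> norm c * E 1" if "x \<in> {0..1}" for x
      using z(3)[of x] mult_left_mono[OF E(1)[of x 1] norm_ge_zero[of c]] that by simp
    have w: "primitive (\<lambda>x. cdot (J *v y x) (z x)) (\<lambda>x. cdot (f x) (z x))"
      using lagrange_identity[OF y z(1)] by (simp add: cdot_zero_right)
    have bound: "norm c \<le> E 1 * (norm (y x) + F)" if x: "x \<in> {0..1}" for x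
    proof -
      have "norm (integral {0..x} (\<lambda>x. cdot (f x) (z x))) \<le> integral {0..x} (\<lambda>t. norm c * E 1 * norm (f t))"
      proof (rule Henstock_Kurzweil_Integration.integral_norm_bound_integral)
        show "(\<lambda>x. cdot (f x) (z x)) integrable_on {0..x}"
          by (rule L1_loc_integrable[OF primitiveD(1)[OF w] order_refl])
        show "(\<lambda>t. norm c * E 1 * norm (f t)) integrable_on {0..x}"
          by (intro integrable_on_mult_right L1_loc_integrable[OF f]) simp
        fix t assume "t \<in> {0..x}"
        then have "norm (f t) * norm (z t) \<le> norm (f t) * (norm c * E 1)"
          using zE[of t] x by (intro mult_left_mono) auto
        then show "norm (cdot (f t) (z t)) \<le> norm c * E 1 * norm (f t)"
          using norm_cdot_le[of "f t" "z t"] by (simp add: mult.commute)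
      qed
      also have "\<dots> = norm c * E 1 * integral {0..x} (\<lambda>t. norm (f t))" by simp
      also have "\<dots> \<le> norm c * E 1 * F"
        unfolding F_def using E(2)[of 1] x L1_loc_integrable[OF f order_refl]
        by (intro mult_left_mono integral_subset_le) auto
      finally have 1: "norm (integral {0..x} (\<lambda>x. cdot (f x) (z x))) \<le> norm c * E 1 * F" .
      have "norm (cdot (J *v y x) (z x)) \<le> norm (y x) * norm (z x)"
        using norm_cdot_le[of "J *v y x" "z x"] by (simp add: norm_J)
      also have "\<dots> \<le> norm (y x) * (norm c * E 1)" using zE[OF x] by (intro mult_left_mono) auto
      finally have 2: "norm (cdot (J *v y x) (z x)) \<le> norm (y x) * (norm c * E 1)" .
      have "cdot (J *v y x) (z x) = of_real ((norm c)\<^sup>2) + integral {0..x} (\<lambda>x. cdot (f x) (z x))"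
        using primitiveD(2)[OF w, of x] x by (simp add: z(2) c_def[symmetric] cdot_J_J cdot_self norm_J)
      then have "of_real ((norm c)\<^sup>2) = cdot (J *v y x) (z x) - integral {0..x} (\<lambda>x. cdot (f x) (z x))"
        by simp
      then have "norm (of_real ((norm c)\<^sup>2) :: complex) \<le> norm (y x) * (norm c * E 1) + norm c * E 1 * F"
        using norm_triangle_ineq4[of "cdot (J *v y x) (z x)" "integral {0..x} (\<lambda>x. cdot (f x) (z x))"] 1 2
        by (simp only:)
      then have "(norm c)\<^sup>2 \<le> norm (y x) * (norm c * E 1) + norm c * E 1 * F"
        by (simp only: norm_of_real abs_power2)
      then have *: "norm c * norm c \<le> norm c * (E 1 * (norm (y x) + F))"
        by (simp add: power2_eq_square algebra_simps)
      show ?thesis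
      proof (cases "norm c = 0")
        case True
        then show ?thesis using E(2)[of 1] F by simp
      next
        case False
        then show ?thesis using * by (simp add: mult_le_cancel_left)
      qed
    qed
    have bound2: "(norm c)\<^sup>2 \<le> 2 * (E 1)\<^sup>2 * (norm (y x))\<^sup>2 + 2 * (E 1)\<^sup>2 * F\<^sup>2" if "x \<in> {0..1}" for x
    proof -
      have "(norm c)\<^sup>2 \<le> (E 1 * (norm (y x) + F))\<^sup>2" by (intro power_mono bound[OF that]) auto
      also have "\<dots> = (E 1)\<^sup>2 * (norm (y x) + F)\<^sup>2" by (simp add: power_mult_distrib)
      also have "\<dots> \<le> (E 1)\<^sup>2 * (2 * (norm (y x))\<^sup>2 + 2 * F\<^sup>2)"
        using sum_squares_bound[of "norm (y x)" F] by (intro mult_left_mono) (auto simp: power2_sum)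
      finally show ?thesis by (simp add: algebra_simps)
    qed
    have i: "(\<lambda>x. (norm (y x))\<^sup>2) integrable_on {0..1}"
      by (intro L1_loc_integrable(1)[OF L1_loc_power2_norm(1)[OF solves_continuous[OF y]]]) simp
    have "(norm c)\<^sup>2 = integral {0..1::real} (\<lambda>x. (norm c)\<^sup>2)" by simp
    also have "\<dots> \<le> integral {0..1} (\<lambda>x. 2 * (E 1)\<^sup>2 * (norm (y x))\<^sup>2 + 2 * (E 1)\<^sup>2 * F\<^sup>2)"
      by (rule integral_le) (use bound2 i in \<open>auto intro!: integrable_add integrable_on_mult_right\<close>)
    also have "\<dots> = 2 * (E 1)\<^sup>2 * integral {0..1} (\<lambda>x. (norm (y x))\<^sup>2) + 2 * (E 1)\<^sup>2 * F\<^sup>2"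
      by (subst integral_add) (use i in \<open>auto intro!: integrable_on_mult_right\<close>)
    also have "\<dots> \<le> B * integral {0..1} (\<lambda>x. (norm (y x))\<^sup>2) + B * 1"
      unfolding B_def
    proof (intro add_mono)
      have "0 \<le> integral {0..1} (\<lambda>x. (norm (y x))\<^sup>2)"
        by (rule Henstock_Kurzweil_Integration.integral_nonneg[OF i]) simp
      moreover have "2 * (E 1)\<^sup>2 * 1 \<le> 2 * (E 1)\<^sup>2 * max 1 (F\<^sup>2)"
        by (intro mult_left_mono) auto
      ultimately show "2 * (E 1)\<^sup>2 * integral {0..1} (\<lambda>x. (norm (y x))\<^sup>2) \<le>
          2 * (E 1)\<^sup>2 * max 1 (F\<^sup>2) * integral {0..1} (\<lambda>x. (norm (y x))\<^sup>2)"
        using mult_right_mono by fastforce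
      show "2 * (E 1)\<^sup>2 * F\<^sup>2 \<le> 2 * (E 1)\<^sup>2 * max 1 (F\<^sup>2) * 1"
        by (simp add: mult_left_mono)
    qed
    finally show "(norm (y 0))\<^sup>2 \<le> B * (1 + integral {0..1} (\<lambda>x. (norm (y x))\<^sup>2))"
      by (simp add: c_def algebra_simps)
  qed
qed

context lagrangian
begin

text \<open>The solutions of the problems on \<open>[0, m+1]\<close> satisfy an energy bound that does not depend on \<open>m\<close>.
Their initial values stay bounded, so some subsequence of initial values converges, and the
solution that starts at the limit has a square integral on \<open>[0, b]\<close> that is bounded independently
of \<open>b\<close>.\<close>

lemma halfline_boundary_problem:
  assumes P: "L1_loc P" "coercive P s d" and f: "square_integrable f"
  obtains y where "solves P y f" "y 0 \<in> boundary" "square_integrable y"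
proof -
  have fL: "L1_loc f" by (rule square_integrable_L1_loc[OF f])
  have "\<forall>m::nat. \<exists>y. solves P y f \<and> y 0 \<in> boundary \<and> upper (y (real (Suc m))) = 0"
    using regular_boundary_problem[OF P f] by (metis of_nat_0_less_iff zero_less_Suc)
  then obtain u where u: "\<And>m::nat. solves P (u m) f" "\<And>m. u m 0 \<in> boundary" "\<And>m. upper (u m (real (Suc m))) = 0"
    by metis
  have d: "d > 0" using P(2) by (simp add: coercive_def)
  define K where "K = integral\<^sup>L halfline (\<lambda>x. (norm (f x))\<^sup>2) / d\<^sup>2"
  have fK: "integral {0..b} (\<lambda>x. (norm (f x))\<^sup>2) / d\<^sup>2 \<le> K" if "b \<ge> 0" for b
    unfolding K_def integral_halfline_cut(2)[OF L1_loc_power2_norm(2)[OF f] that, symmetric]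
    by (intro divide_right_mono integral_mono integral_halfline_cut(1)[OF L1_loc_power2_norm(2)[OF f] that])
       (use f in \<open>auto simp: square_integrable_def indicator_def\<close>)
  have uL: "L1_loc (\<lambda>x. (norm (u m x))\<^sup>2)" for m by (rule L1_loc_power2_norm(1)[OF solves_continuous[OF u(1)]])
  have uK: "integral {0..b} (\<lambda>x. (norm (u m x))\<^sup>2) \<le> K" if "b \<le> real (Suc m)" for b m
  proof -
    have "integral {0..b} (\<lambda>x. (norm (u m x))\<^sup>2) \<le> integral {0..real (Suc m)} (\<lambda>x. (norm (u m x))\<^sup>2)"
      by (rule integral_subset_le) (use that L1_loc_integrable(1)[OF uL order_refl] in auto)
    also have "\<dots> \<le> integral {0..real (Suc m)} (\<lambda>x. (norm (f x))\<^sup>2) / d\<^sup>2"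
      by (rule local_energy_estimate[OF u(1) f _ _ _ P(2)])
         (use u in \<open>auto intro: boundary_isotropic isotropic_upper_0\<close>)
    also have "\<dots> \<le> K" by (rule fK) simp
    finally show ?thesis .
  qed
  obtain B where B: "\<And>y. solves P y f \<Longrightarrow> (norm (y 0))\<^sup>2 \<le> B * (1 + integral {0..1} (\<lambda>x. (norm (y x))\<^sup>2))"
    by (rule initial_value_bound[OF P(1) fL]) (rule that, assumption)
  have "(norm (u m 0))\<^sup>2 \<le> \<bar>B\<bar> * (1 + K)" for m
  proof -
    have nn: "0 \<le> integral {0..1} (\<lambda>x. (norm (u m x))\<^sup>2)"
      by (rule Henstock_Kurzweil_Integration.integral_nonneg) (use L1_loc_integrable(1)[OF uL order_refl] in auto)
    have "(norm (u m 0))\<^sup>2 \<le> B * (1 + integral {0..1} (\<lambda>x. (norm (u m x))\<^sup>2))" by (rule B[OF u(1)])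
    also have "\<dots> \<le> \<bar>B\<bar> * (1 + integral {0..1} (\<lambda>x. (norm (u m x))\<^sup>2))" using nn by (intro mult_right_mono) auto
    also have "\<dots> \<le> \<bar>B\<bar> * (1 + K)" using uK[of 1 m] by (intro mult_left_mono) auto
    finally show ?thesis .
  qed
  then have "norm (u m 0) \<le> sqrt (\<bar>B\<bar> * (1 + K))" for m by (simp add: real_le_rsqrt)
  then have "bounded (range (\<lambda>m. u m 0))" unfolding bounded_iff by blast
  then obtain l r where r: "strict_mono r" "((\<lambda>m. u m 0) \<circ> r) \<longlonglongrightarrow> l"
    using bounded_imp_convergent_subsequence by blast
  then have lim: "(\<lambda>m. u (r m) 0) \<longlonglongrightarrow> l" by (simp add: o_def)
  have lb: "l \<in> boundary"
    by (rule closed_sequentially[OF closed_boundary _ lim]) (use u(2) in auto)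
  obtain E where E: "\<And>x y. 0 \<le> x \<Longrightarrow> x \<le> y \<Longrightarrow> E x \<le> E y" "\<And>x. E x > 0"
    "\<And>g c. L1_loc g \<Longrightarrow> \<exists>y. solves P y g \<and> y 0 = c \<and>
      (\<forall>x\<ge>0. norm (y x) \<le> (norm c + integral {0..x} (\<lambda>t. norm (g t))) * E x)"
    by (rule solves_exists[OF P(1)]) (rule that, assumption+)
  obtain y where y: "solves P y f" "y 0 = l" using E(3)[OF fL, of l] by blast
  have z0: "L1_loc (\<lambda>x. 0 :: complex ^ ('p + 'p))" by (intro L1_loc_continuous continuous_on_const)
  have diff: "norm (y x - u m x) \<le> norm (l - u m 0) * E x" if "x \<ge> 0" for x m
  proof -
    have s: "solves P (\<lambda>x. y x - u m x) (\<lambda>x. 0)" using solves_diff[OF y(1) u(1)[of m]] by simp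
    obtain v where v: "solves P v (\<lambda>x. 0)" "v 0 = l - u m 0" "\<forall>x\<ge>0. norm (v x) \<le> norm (l - u m 0) * E x"
      using E(3)[OF z0, of "l - u m 0"] by auto
    have "y x - u m x = v x" by (rule solves_unique[OF P(1) s v(1) _ that]) (simp add: y v)
    then show ?thesis using v(3) that by simp
  qed
  have yL: "L1_loc (\<lambda>x. (norm (y x))\<^sup>2)" by (rule L1_loc_power2_norm(1)[OF solves_continuous[OF y(1)]])
  have bound: "integral {0..b} (\<lambda>x. (norm (y x))\<^sup>2) \<le> 2 * K + 1" if b: "b \<ge> 0" for b
  proof -
    have "(\<lambda>m. 2 * (norm (l - u (r m) 0) * E b)\<^sup>2 * b) \<longlonglongrightarrow> 2 * (norm (l - l) * E b)\<^sup>2 * b"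
      by (intro tendsto_intros lim)
    then have "eventually (\<lambda>m. 2 * (norm (l - u (r m) 0) * E b)\<^sup>2 * b < 1) sequentially"
      by (intro order_tendstoD(2)) auto
    moreover have "eventually (\<lambda>m. b \<le> real m) sequentially"
      by (rule eventually_sequentiallyI[of "nat \<lceil>b\<rceil>"]) (auto simp: nat_le_iff ceiling_le_iff)
    ultimately have "eventually (\<lambda>m. 2 * (norm (l - u (r m) 0) * E b)\<^sup>2 * b < 1 \<and> b \<le> real m) sequentially"
      by eventually_elim simp
    then obtain m where m: "2 * (norm (l - u (r m) 0) * E b)\<^sup>2 * b < 1" "b \<le> real m"
      using eventually_happens'[OF sequentially_bot] by blast
    have "b \<le> real (Suc (r m))" using m(2) seq_suble[OF r(1), of m] by simp
    note uKm = uK[OF this]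
    have "(norm (y x))\<^sup>2 \<le> 2 * (norm (u (r m) x))\<^sup>2 + 2 * (norm (l - u (r m) 0) * E b)\<^sup>2" if x: "x \<in> {0..b}" for x
    proof -
      have "norm (y x - u (r m) x) \<le> norm (l - u (r m) 0) * E b"
        using diff[of x "r m"] mult_left_mono[OF E(1)[of x b] norm_ge_zero[of "l - u (r m) 0"]] x by simp
      then have "norm (y x) \<le> norm (u (r m) x) + norm (l - u (r m) 0) * E b"
        using norm_triangle_sub[of "y x" "u (r m) x"] by linarith
      then have "(norm (y x))\<^sup>2 \<le> (norm (u (r m) x) + norm (l - u (r m) 0) * E b)\<^sup>2"
        by (intro power_mono) auto
      also have "\<dots> \<le> 2 * (norm (u (r m) x))\<^sup>2 + 2 * (norm (l - u (r m) 0) * E b)\<^sup>2"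
        using sum_squares_bound[of "norm (u (r m) x)" "norm (l - u (r m) 0) * E b"] by (simp add: power2_sum)
      finally show ?thesis .
    qed
    then have "integral {0..b} (\<lambda>x. (norm (y x))\<^sup>2) \<le>
        integral {0..b} (\<lambda>x. 2 * (norm (u (r m) x))\<^sup>2 + 2 * (norm (l - u (r m) 0) * E b)\<^sup>2)"
      using L1_loc_integrable(1)[OF uL order_refl, of "r m" b] L1_loc_integrable(1)[OF yL order_refl, of b]
      by (intro integral_le) (auto intro!: integrable_add integrable_on_mult_right)
    also have "\<dots> = 2 * integral {0..b} (\<lambda>x. (norm (u (r m) x))\<^sup>2) + 2 * (norm (l - u (r m) 0) * E b)\<^sup>2 * b"
      using L1_loc_integrable(1)[OF uL order_refl, of "r m" b] b
      by (subst integral_add) (auto intro!: integrable_on_mult_right)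
    also have "\<dots> \<le> 2 * K + 1" using uKm m(1) by simp
    finally show ?thesis .
  qed
  have "integrable halfline (\<lambda>x. (norm (y x))\<^sup>2)"
    by (rule integrable_halfline_bounded[OF yL _ bound]) auto
  moreover have "y \<in> borel_measurable halfline"
    by (intro L1_loc_measurable L1_loc_continuous solves_continuous[OF y(1)])
  ultimately have "square_integrable y" by (simp add: square_integrable_def)
  then show ?thesis using that[of y] y lb by simp
qed

end

section \<open>The graphs of the operators\<close>

text \<open>The graph of the operator that is restricted by \<open>y(0) \<in> M\<close>. For \<open>M = UNIV\<close> it is the maximal
operator and for \<open>M = {0}\<close> it turns out to be the minimal one.\<close>

definition boundary_op ::
    "(real \<Rightarrow> complex ^ ('p::finite + 'p) ^ ('p + 'p)) \<Rightarrow> (complex ^ ('p + 'p)) set \<Rightarrow> (('p + 'p) L2 \<times> ('p + 'p) L2) set"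
  where "boundary_op Q M = {(L2_class y, L2_class g) | y g.
    solves Q y g \<and> square_integrable y \<and> square_integrable g \<and> y 0 \<in> M}"

lemma boundary_opI:
  "solves Q y g \<Longrightarrow> square_integrable y \<Longrightarrow> square_integrable g \<Longrightarrow> y 0 \<in> M \<Longrightarrow>
    (L2_class y, L2_class g) \<in> boundary_op Q M"
  unfolding boundary_op_def by blast

lemma boundary_opE:
  assumes "(F, G) \<in> boundary_op Q M"
  obtains y g where "F = L2_class y" "G = L2_class g" "solves Q y g" "square_integrable y" "square_integrable g" "y 0 \<in> M"
  using assms unfolding boundary_op_def by blast

lemma boundary_op_mono: "M \<subseteq> N \<Longrightarrow> boundary_op Q M \<subseteq> boundary_op Q N"
  unfolding boundary_op_def by blast

lemma max_domain_solves:
  assumes "L1_loc Q" "y \<in> max_domain Q"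
  shows "solves Q y (dirac_expr Q y)" "square_integrable y" "square_integrable (dirac_expr Q y)"
proof -
  show sq: "square_integrable y" "square_integrable (dirac_expr Q y)"
    using assms(2) by (auto simp: max_domain_def)
  have ac: "AC_loc y" using assms(2) by (simp add: max_domain_def)
  show "solves Q y (dirac_expr Q y)"
    by (rule AC_loc_solves[OF assms(1) ac square_integrable_L1_loc[OF sq(2)] AE_I2]) (rule refl)
qed

lemma solves_max_domain:
  assumes Q: "L1_loc Q" and "solves Q y g" "square_integrable y" "square_integrable g"
  shows "y \<in> max_domain Q" "L2_class (dirac_expr Q y) = L2_class g"
proof -
  note ae = solves_dirac_expr[OF assms(1,2)]
  have sq: "square_integrable (dirac_expr Q y)" by (rule square_integrable_cong_AE[OF assms(4) ae])
  show "y \<in> max_domain Q" using assms(3) sq solves_imp_AC[OF assms(1,2)] by (simp add: max_domain_def)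
  show "L2_class (dirac_expr Q y) = L2_class g" using ae by (simp add: L2_class_eq_iff sq assms(4))
qed

lemma D_bc_eq_boundary_op:
  assumes "L1_loc Q"
  shows "D_bc Q \<Phi> = boundary_op Q {u. cos_matrix \<Phi> *v upper u + sin_matrix \<Phi> *v lower u = 0}"
proof
  show "D_bc Q \<Phi> \<subseteq> boundary_op Q {u. cos_matrix \<Phi> *v upper u + sin_matrix \<Phi> *v lower u = 0}"
    unfolding D_bc_def by (auto intro!: boundary_opI max_domain_solves[OF assms])
  show "boundary_op Q {u. cos_matrix \<Phi> *v upper u + sin_matrix \<Phi> *v lower u = 0} \<subseteq> D_bc Q \<Phi>"
  proof (clarify, elim boundary_opE)
    fix F G y g assume "F = L2_class y" "G = L2_class g" "solves Q y g" "square_integrable y" "square_integrable g"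
      "y 0 \<in> {u. cos_matrix \<Phi> *v upper u + sin_matrix \<Phi> *v lower u = 0}"
    then show "(F, G) \<in> D_bc Q \<Phi>"
      unfolding D_bc_def using solves_max_domain[OF assms, of y g] by (intro CollectI exI[of _ y]) auto
  qed
qed

lemma continuous_eq_of_AE_eq:
  fixes y z :: "real \<Rightarrow> 'a::real_normed_vector"
  assumes "continuous_on {0..} y" "continuous_on {0..} z" "AE x in halfline. y x = z x" "x \<ge> 0"
  shows "y x = z x"
proof (rule ccontr)
  assume ne: "y x \<noteq> z x"
  have "continuous_on {0..} (\<lambda>t. y t - z t)" by (intro continuous_intros assms)
  then have "continuous (at x within {0..}) (\<lambda>t. y t - z t)"
    using assms(4) by (simp add: continuous_on_eq_continuous_within)
  then obtain d where d: "d > 0" "\<forall>t\<in>{0..}. dist x t < d \<longrightarrow> y t - z t \<noteq> 0"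
    using continuous_within_avoid[of x "{0..}" "\<lambda>t. y t - z t" 0] ne by auto
  have "{x<..<x+d} \<subseteq> {t. t \<ge> 0 \<and> \<not> (y t = z t)}"
    using d(2) assms(4) by (auto simp: dist_real_def)
  then have "negligible {x<..<x+d}"
    using assms(3) unfolding AE_halfline_iff by (rule negligible_subset[rotated])
  then show False using d(1) open_not_negligible[of "{x<..<x+d}"] by auto
qed

text \<open>By continuity. It makes the trace \<open>y(0)\<close> a function of the class of \<open>y\<close>.\<close>

lemma solves_class_eq:
  assumes "solves Q y g" "solves Q z k" "square_integrable y" "square_integrable z"
    and "L2_class y = L2_class z" "x \<ge> 0"
  shows "y x = z x"
  using assms by (intro continuous_eq_of_AE_eq[of y z] solves_continuous) (simp_all add: L2_class_eq_iff)

lemma solves_unique_rhs: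
  assumes "solves Q y g" "solves Q z k" "\<And>x. x \<ge> 0 \<Longrightarrow> y x = z x"
  shows "AE x in halfline. g x = k x"
proof -
  have ae: "AE x in halfline. J *v (Q x *v y x - g x) = J *v (Q x *v z x - k x)"
    using assms unfolding solves_def by (rule primitive_unique_derivative)
  have nn: "AE x in halfline. x \<ge> 0" by (rule AE_halflineI[of "{}"]) auto
  from ae nn show ?thesis
  proof eventually_elim
    case (elim x)
    then have "J *v (J *v (Q x *v y x - g x)) = J *v (J *v (Q x *v y x - k x))" using assms(3)[of x] by simp
    then show ?case by (simp add: J_J)
  qed
qed

lemma linear_operator_boundary_op:
  assumes "0 \<in> M" "\<And>u v. u \<in> M \<Longrightarrow> v \<in> M \<Longrightarrow> u + v \<in> M" "\<And>c u. u \<in> M \<Longrightarrow> c *s u \<in> M"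
  shows "linear_operator (boundary_op Q M)"
  unfolding linear_operator_def
proof (intro conjI allI impI)
  show "single_valued (boundary_op Q M)"
  proof (rule single_valuedI)
    fix F G G' assume "(F, G) \<in> boundary_op Q M" "(F, G') \<in> boundary_op Q M"
    then obtain y g z k where *: "F = L2_class y" "G = L2_class g" "solves Q y g" "square_integrable y" "square_integrable g"
      "F = L2_class z" "G' = L2_class k" "solves Q z k" "square_integrable z" "square_integrable k"
      by (elim boundary_opE) blast
    then have "AE x in halfline. g x = k x"
      by (intro solves_unique_rhs[of Q y g z k] solves_class_eq[of Q y g z k]) auto
    then show "G = G'" using * by (simp add: L2_class_eq_iff)
  qed
  have z: "solves Q (\<lambda>x. 0) (\<lambda>x. 0)"
    unfolding solves_def primitive_def by (simp add: mv_zero L1_loc_continuous)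
  show "(0, 0) \<in> boundary_op Q M"
    using boundary_opI[OF z square_integrable_zero square_integrable_zero] assms(1) by (simp add: L2_class_zero)
next
  fix f g f' g' assume "(f, g) \<in> boundary_op Q M" "(f', g') \<in> boundary_op Q M"
  then show "(f + f', g + g') \<in> boundary_op Q M"
    by (elim boundary_opE) (auto simp: L2_class_add intro!: boundary_opI solves_add square_integrable_add assms(2))
next
  fix c f g assume "(f, g) \<in> boundary_op Q M"
  then show "(scaleC_L2 c f, scaleC_L2 c g) \<in> boundary_op Q M"
    by (elim boundary_opE) (auto simp: L2_class_scale intro!: boundary_opI solves_scale square_integrable_scale assms(3))
qed

section \<open>Elementary Hilbert space facts\<close>

lemma cinner_L2_add_right: "cinner_L2 f (g + h) = cinner_L2 f g + cinner_L2 f h"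
  by (metis cinner_L2_add_left cinner_L2_commute complex_cnj_add)

lemma cinner_L2_scale_right: "cinner_L2 f (scaleC_L2 c g) = cnj c * cinner_L2 f g"
  by (metis cinner_L2_scale_left cinner_L2_commute complex_cnj_mult)

lemma cinner_L2_diff_left: "cinner_L2 (f - g) h = cinner_L2 f h - cinner_L2 g h"
  using cinner_L2_add_left[of "f - g" g h] by simp

lemma cinner_L2_diff_right: "cinner_L2 f (g - h) = cinner_L2 f g - cinner_L2 f h"
  using cinner_L2_add_right[of f "g - h" h] by simp

lemma cinner_L2_self: "cinner_L2 f f = of_real ((norm f)\<^sup>2)"
proof (rule complex_eqI)
  show "Re (cinner_L2 f f) = Re (of_real ((norm f)\<^sup>2))"
    by (simp add: power2_norm_eq_inner inner_L2_def)
  have "cinner_L2 f f = cnj (cinner_L2 f f)" by (rule cinner_L2_commute)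
  then show "Im (cinner_L2 f f) = Im (of_real ((norm f)\<^sup>2))"
    by (metis Im_complex_of_real Reals_cnj_iff complex_is_Real_iff)
qed

lemma norm_scaleC_L2: "norm (scaleC_L2 c f) = cmod c * norm f"
proof -
  have "complex_of_real ((norm (scaleC_L2 c f))\<^sup>2) = c * cnj c * of_real ((norm f)\<^sup>2)"
    by (simp only: cinner_L2_self[symmetric] cinner_L2_scale_left cinner_L2_scale_right) simp
  also have "\<dots> = of_real ((cmod c * norm f)\<^sup>2)"
    by (simp add: complex_norm_square[symmetric] power_mult_distrib)
  finally show ?thesis
    by (simp only: of_real_eq_iff) (simp add: power2_eq_iff_nonneg)
qed

lemma cinner_L2_Complex: "cinner_L2 f g = Complex (f \<bullet> g) (scaleC_L2 (- \<i>) f \<bullet> g)"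
  unfolding inner_L2_def cinner_L2_scale_left by (rule complex_eqI) simp_all

lemma Im_cinner_L2_le: "\<bar>Im (cinner_L2 f g)\<bar> \<le> norm f * norm g"
  using Cauchy_Schwarz_ineq2[of "scaleC_L2 (- \<i>) f" g] by (simp add: cinner_L2_Complex norm_scaleC_L2)

lemma scaleC_L2_diff: "scaleC_L2 c (f - g) = scaleC_L2 c f - scaleC_L2 c g"
  by (rule L2.scale_right_diff_distrib)

lemma closed_adjoint_op: "closed (adjoint_op T)"
proof -
  have "adjoint_op T = (\<Inter>(f, g)\<in>T. {p. cinner_L2 g (fst p) = cinner_L2 f (snd p)})"
    by (auto simp: adjoint_op_def)
  moreover have "closed {p. cinner_L2 g (fst p) = cinner_L2 f (snd p)}" for f g :: "'a L2"
    unfolding cinner_L2_Complex by (intro closed_Collect_eq continuous_intros continuous_on_Complex)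
  ultimately show ?thesis by (auto intro!: closed_INT)
qed

lemma adjoint_op_antimono: "S \<subseteq> T \<Longrightarrow> adjoint_op T \<subseteq> adjoint_op S"
  unfolding adjoint_op_def by blast

text \<open>Surjectivity together with a lower bound gives the inverse and its boundedness.\<close>

lemma mem_resolvent_set:
  assumes T: "linear_operator T" and surj: "\<And>h. \<exists>(f, g)\<in>T. g - scaleC_L2 l f = h"
    and d: "d > 0" "\<And>f g. (f, g) \<in> T \<Longrightarrow> d * norm f \<le> norm (g - scaleC_L2 l f)"
  shows "l \<in> resolvent_set T"
proof -
  have add: "(f, g) \<in> T \<Longrightarrow> (f', g') \<in> T \<Longrightarrow> (f + f', g + g') \<in> T"
    and scale: "(f, g) \<in> T \<Longrightarrow> (scaleC_L2 c f, scaleC_L2 c g) \<in> T" for f g f' g' c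
    using T by (auto simp: linear_operator_def)
  have uniq: "f = f'" if "(f, g) \<in> T" "(f', g') \<in> T" "g - scaleC_L2 l f = g' - scaleC_L2 l f'" for f g f' g'
  proof -
    have "(f + scaleC_L2 (- 1) f', g + scaleC_L2 (- 1) g') \<in> T" by (intro add scale that)
    then have "(f - f', g - g') \<in> T" unfolding minus_L2_def uminus_L2_def .
    from d(2)[OF this] have "d * norm (f - f') \<le> norm (g - g' - (scaleC_L2 l f - scaleC_L2 l f'))"
      by (simp add: scaleC_L2_diff)
    also have "g - g' - (scaleC_L2 l f - scaleC_L2 l f') = 0" using that(3) by (simp add: algebra_simps)
    finally show ?thesis using d(1) by (simp add: mult_le_0_iff)
  qed
  have "\<forall>h. \<exists>f. \<exists>g. (f, g) \<in> T \<and> g - scaleC_L2 l f = h" using surj by fast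
  then obtain R where R: "\<And>h. \<exists>g. (R h, g) \<in> T \<and> g - scaleC_L2 l (R h) = h"
    unfolding choice_iff by blast
  have Rf: "R (g - scaleC_L2 l f) = f" if "(f, g) \<in> T" for f g
    using R[of "g - scaleC_L2 l f"] uniq that by blast
  have "bounded_linear R"
  proof (rule bounded_linear_intro[where K = "1 / d"])
    show "R (x + y) = R x + R y" for x y
    proof -
      obtain g g' where g: "(R x, g) \<in> T" "g - scaleC_L2 l (R x) = x" "(R y, g') \<in> T" "g' - scaleC_L2 l (R y) = y"
        using R by metis
      have "g + g' - scaleC_L2 l (R x + R y) = (g - scaleC_L2 l (R x)) + (g' - scaleC_L2 l (R y))"
        by (simp add: scaleC_L2_add_right)
      with Rf[OF add[OF g(1,3)]] show ?thesis by (simp only: g)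
    qed
    show "R (r *\<^sub>R x) = r *\<^sub>R R x" for r x
    proof -
      obtain g where g: "(R x, g) \<in> T" "g - scaleC_L2 l (R x) = x" using R by metis
      have "scaleC_L2 (of_real r) g - scaleC_L2 l (scaleC_L2 (of_real r) (R x)) = scaleC_L2 (of_real r) (g - scaleC_L2 l (R x))"
        by (simp add: scaleC_L2_diff scaleC_L2_scaleC_L2 mult.commute)
      with Rf[OF scale[OF g(1), of "of_real r"]] show ?thesis by (simp only: g scaleR_L2_def)
    qed
    show "norm (R x) \<le> norm x * (1 / d)" for x
    proof -
      obtain g where g: "(R x, g) \<in> T" "g - scaleC_L2 l (R x) = x" using R by metis
      have "d * norm (R x) \<le> norm x" using d(2)[OF g(1)] by (simp only: g(2))
      then show ?thesis using d(1) by (simp add: pos_le_divide_eq mult.commute)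
    qed
  qed
  moreover have "{(g - scaleC_L2 l f, f) |f g. (f, g) \<in> T} = {(h, R h) |h. True}"
  proof
    show "{(g - scaleC_L2 l f, f) |f g. (f, g) \<in> T} \<subseteq> {(h, R h) |h. True}"
      using Rf by fastforce
    show "{(h, R h) |h. True} \<subseteq> {(g - scaleC_L2 l f, f) |f g. (f, g) \<in> T}"
    proof clarify
      fix h
      obtain g where g: "(R h, g) \<in> T" "g - scaleC_L2 l (R h) = h" using R by metis
      then show "\<exists>f g. (h, R h) = (g - scaleC_L2 l f, f) \<and> (f, g) \<in> T"
        by (intro exI[of _ "R h"] exI[of _ g]) simp
    qed
  qed
  ultimately show ?thesis unfolding resolvent_set_def by blast
qed

section \<open>Cut-off functions\<close>

text \<open>Equal to 1 up to \<open>n\<close>, then decreasing linearly, and 0 from \<open>2n\<close> on. It is written as an integral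
so that its derivative \<open>cutoff'\<close> comes with the definition.\<close>

definition cutoff :: "nat \<Rightarrow> real \<Rightarrow> real" where
  "cutoff n x = 1 - integral {0..x} (\<lambda>t. indicator {real n..2 * real n} t / real n)"

definition cutoff' :: "nat \<Rightarrow> real \<Rightarrow> real" where
  "cutoff' n x = - (indicator {real n..2 * real n} x / real n)"

lemma cutoff'_measurable: "cutoff' n \<in> borel_measurable halfline"
proof -
  have "cutoff' n \<in> borel_measurable borel" unfolding cutoff'_def[abs_def] by measurable
  then have "cutoff' n \<in> borel_measurable lborel" by simp
  then show ?thesis by (intro measurable_restrict_space1 measurable_completion)
qed

lemma cutoff'_le: "n > 0 \<Longrightarrow> \<bar>cutoff' n x\<bar> \<le> 1"
  by (auto simp: cutoff'_def indicator_def)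

lemma cutoff_primitive:
  assumes "n > 0"
  shows "primitive (cutoff n) (cutoff' n)"
proof -
  have L: "L1_loc (cutoff' n)"
    by (rule L1_loc_bounded_measurable[where B = 1, OF cutoff'_measurable]) (use cutoff'_le[OF assms] in auto)
  have "cutoff n x = 1 + integral {0..x} (cutoff' n)" for x
    unfolding cutoff_def cutoff'_def[abs_def] by simp
  then have "cutoff n = (\<lambda>x. 1 + integral {0..x} (cutoff' n))" by (rule ext)
  then show ?thesis using primitive_integral[OF L] by (simp only:)
qed

lemma cutoff_values:
  assumes n: "n > 0" and x: "x \<ge> 0"
  shows "0 \<le> cutoff n x" "cutoff n x \<le> 1" "x \<le> real n \<Longrightarrow> cutoff n x = 1" "x \<ge> 2 * real n \<Longrightarrow> cutoff n x = 0"
proof -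
  let ?S = "{real n..2 * real n} \<inter> {0..x}"
  have S: "?S = {real n..min (2 * real n) x}" using n by auto
  have "integral {0..x} (\<lambda>t. indicator {real n..2 * real n} t / real n) = integral {0..x} (indicator {real n..2 * real n}) / real n"
    by simp
  also have "integral {0..x} (indicator {real n..2 * real n}) = measure lebesgue ?S"
    unfolding S[symmetric] by (rule integral_indicator) (simp add: S)
  also have "\<dots> = (if real n \<le> min (2 * real n) x then min (2 * real n) x - real n else 0)"
    unfolding S by (simp del: min_le_iff_disj)
  finally have eq: "cutoff n x = 1 - (if real n \<le> min (2 * real n) x then min (2 * real n) x - real n else 0) / real n"
    by (simp add: cutoff_def)
  show "0 \<le> cutoff n x" "cutoff n x \<le> 1" "x \<le> real n \<Longrightarrow> cutoff n x = 1" "x \<ge> 2 * real n \<Longrightarrow> cutoff n x = 0"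
    unfolding eq using n x by (auto simp: min_def field_simps)
qed

text \<open>Multiplication by the cut-off commutes with \<open>Q\<close> and with the constant \<open>J\<close>, so the commutator with
the expression is bounded by \<open>1/n\<close> independently of \<open>Q\<close>.\<close>

lemma solves_cutoff:
  assumes "solves Q y g" "n > 0"
  shows "solves Q (\<lambda>x. cutoff n x *\<^sub>R y x) (\<lambda>x. cutoff n x *\<^sub>R g x + cutoff' n x *\<^sub>R (J *v y x))"
proof -
  from primitive_bilinear[OF bounded_bilinear_scaleR cutoff_primitive[OF assms(2)] assms(1)[unfolded solves_def]]
  show ?thesis unfolding solves_def
    by (rule back_subst[where P = "primitive _"])
       (simp add: fun_eq_iff mv_diff mv_add mv_scaleR J_J scaleR_diff_right)
qed

lemma square_integrable_bounded_mult:
  fixes \<psi> :: "real \<Rightarrow> real"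
  assumes f: "square_integrable f" and m: "\<psi> \<in> borel_measurable halfline" and b: "\<And>x. x \<ge> 0 \<Longrightarrow> \<bar>\<psi> x\<bar> \<le> 1"
  shows "square_integrable (\<lambda>x. \<psi> x *\<^sub>R f x)"
  unfolding square_integrable_def
proof
  have fm: "f \<in> borel_measurable halfline" "integrable halfline (\<lambda>x. (norm (f x))\<^sup>2)"
    using f by (auto simp: square_integrable_def)
  show me: "(\<lambda>x. \<psi> x *\<^sub>R f x) \<in> borel_measurable halfline" using m fm by measurable
  show "integrable halfline (\<lambda>x. (norm (\<psi> x *\<^sub>R f x))\<^sup>2)"
  proof (rule Bochner_Integration.integrable_bound[OF fm(2)])
    show "(\<lambda>x. (norm (\<psi> x *\<^sub>R f x))\<^sup>2) \<in> borel_measurable halfline" using me by measurable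
    have "(norm (\<psi> x *\<^sub>R f x))\<^sup>2 \<le> (norm (f x))\<^sup>2" if "x \<ge> 0" for x
      using mult_right_mono[OF b[OF that] norm_ge_zero[of "f x"]] by (intro power_mono) auto
    then show "AE x in halfline. norm ((norm (\<psi> x *\<^sub>R f x))\<^sup>2) \<le> norm ((norm (f x))\<^sup>2)"
      by (intro AE_I2) simp
  qed
qed

lemma L2_class_bounded_mult_tendsto_0:
  fixes \<psi> :: "nat \<Rightarrow> real \<Rightarrow> real"
  assumes f: "square_integrable f" and m: "\<And>n. \<psi> n \<in> borel_measurable halfline"
    and b: "\<And>n x. x \<ge> 0 \<Longrightarrow> \<bar>\<psi> n x\<bar> \<le> 1" and z: "\<And>x. x \<ge> 0 \<Longrightarrow> eventually (\<lambda>n. \<psi> n x = 0) sequentially"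
  shows "(\<lambda>n. L2_class (\<lambda>x. \<psi> n x *\<^sub>R f x)) \<longlonglongrightarrow> 0"
proof -
  have sq: "square_integrable (\<lambda>x. \<psi> n x *\<^sub>R f x)" for n
    by (rule square_integrable_bounded_mult[OF f m b])
  have "(\<lambda>n. integral\<^sup>L halfline (\<lambda>x. (norm (\<psi> n x *\<^sub>R f x))\<^sup>2)) \<longlonglongrightarrow> integral\<^sup>L halfline (\<lambda>x. 0)"
  proof (rule integral_dominated_convergence[where w = "\<lambda>x. (norm (f x))\<^sup>2"])
    show "integrable halfline (\<lambda>x. (norm (f x))\<^sup>2)" using f by (simp add: square_integrable_def)
    show "(\<lambda>x. (norm (\<psi> n x *\<^sub>R f x))\<^sup>2) \<in> borel_measurable halfline" for n
      using sq[of n] unfolding square_integrable_def by (blast dest: borel_measurable_integrable)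
    show "AE x in halfline. (\<lambda>n. (norm (\<psi> n x *\<^sub>R f x))\<^sup>2) \<longlonglongrightarrow> 0"
    proof (rule AE_I2)
      fix x assume "x \<in> space halfline"
      then have "eventually (\<lambda>n. (norm (\<psi> n x *\<^sub>R f x))\<^sup>2 = 0) sequentially"
        using z[of x] by (auto elim: eventually_mono)
      then show "(\<lambda>n. (norm (\<psi> n x *\<^sub>R f x))\<^sup>2) \<longlonglongrightarrow> 0" by (rule tendsto_eventually)
    qed
    have "(norm (\<psi> n x *\<^sub>R f x))\<^sup>2 \<le> (norm (f x))\<^sup>2" if "x \<ge> 0" for x n
      using mult_right_mono[OF b[OF that] norm_ge_zero[of "f x"]] by (intro power_mono) auto
    then show "AE x in halfline. norm ((norm (\<psi> n x *\<^sub>R f x))\<^sup>2) \<le> (norm (f x))\<^sup>2" for n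
      by (intro AE_I2) simp
  qed auto
  then have "(\<lambda>n. (norm (L2_class (\<lambda>x. \<psi> n x *\<^sub>R f x)))\<^sup>2) \<longlonglongrightarrow> 0"
    by (simp add: norm_L2_class[OF sq])
  then have "(\<lambda>n. norm (L2_class (\<lambda>x. \<psi> n x *\<^sub>R f x))) \<longlonglongrightarrow> 0"
    using tendsto_real_sqrt by fastforce
  then show ?thesis by (rule tendsto_norm_zero_cancel)
qed

lemma square_integrable_cut_continuous:
  fixes \<psi> :: "real \<Rightarrow> real"
  assumes y: "continuous_on {0..} y" and m: "\<psi> \<in> borel_measurable halfline"
    and b: "\<And>x. x \<ge> 0 \<Longrightarrow> \<bar>\<psi> x\<bar> \<le> indicator {0..c} x" and c: "c \<ge> 0"
  shows "square_integrable (\<lambda>x. \<psi> x *\<^sub>R y x)"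
  unfolding square_integrable_def
proof
  have ym: "y \<in> borel_measurable halfline" by (intro L1_loc_measurable L1_loc_continuous y)
  show me: "(\<lambda>x. \<psi> x *\<^sub>R y x) \<in> borel_measurable halfline" using m ym by measurable
  show "integrable halfline (\<lambda>x. (norm (\<psi> x *\<^sub>R y x))\<^sup>2)"
  proof (rule Bochner_Integration.integrable_bound[OF integral_halfline_cut(1)[OF L1_loc_power2_norm(1)[OF y] c]])
    show "(\<lambda>x. (norm (\<psi> x *\<^sub>R y x))\<^sup>2) \<in> borel_measurable halfline" using me by measurable
    have "(norm (\<psi> x *\<^sub>R y x))\<^sup>2 \<le> indicator {0..c} x * (norm (y x))\<^sup>2" if "x \<ge> 0" for x
    proof (cases "x \<le> c")
      case True
      then have "\<bar>\<psi> x\<bar> * norm (y x) \<le> 1 * norm (y x)"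
        using b[OF that] that by (intro mult_right_mono) auto
      then have "(norm (\<psi> x *\<^sub>R y x))\<^sup>2 \<le> (norm (y x))\<^sup>2" by (intro power_mono) auto
      then show ?thesis using True that by simp
    next
      case False
      then show ?thesis using b[OF that] by simp
    qed
    then show "AE x in halfline. norm ((norm (\<psi> x *\<^sub>R y x))\<^sup>2) \<le> norm (indicator {0..c} x *\<^sub>R (norm (y x))\<^sup>2)"
      by (intro AE_I2) simp
  qed
qed

text \<open>A solution of the homogeneous equation, cut off so as to vanish from 2 on, lies in the domain of the maximal
operator.\<close>

lemma initial_value_attained:
  assumes Q: "L1_loc Q"
  obtains y g where "solves Q y g" "square_integrable y" "square_integrable g" "y 0 = c"
proof -
  have z0: "L1_loc (\<lambda>x. 0 :: complex ^ ('a + 'a))" by (intro L1_loc_continuous continuous_on_const)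
  obtain u where u: "solves Q u (\<lambda>x. 0)" "u 0 = c"
    by (rule solves_exists[OF Q]) (use z0 in blast)
  have cm: "cutoff 1 \<in> borel_measurable halfline"
    by (intro L1_loc_measurable L1_loc_continuous primitive_continuous[OF cutoff_primitive]) simp
  have uc: "continuous_on {0..} u" by (rule solves_continuous[OF u(1)])
  have "square_integrable (\<lambda>x. cutoff 1 x *\<^sub>R u x)"
  proof (rule square_integrable_cut_continuous[OF uc cm, where c = 2])
    show "\<bar>cutoff 1 x\<bar> \<le> indicator {0..2} x" if "x \<ge> 0" for x
      using cutoff_values[of 1 x] that by (cases "x \<le> 2") auto
  qed simp
  moreover have "square_integrable (\<lambda>x. cutoff' 1 x *\<^sub>R (J *v u x))"
    by (rule square_integrable_cut_continuous[OF bounded_linear.continuous_on[OF mv_bounded_linear uc] cutoff'_measurable, where c = 2])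
       (auto simp: cutoff'_def indicator_def)
  moreover have "solves Q (\<lambda>x. cutoff 1 x *\<^sub>R u x) (\<lambda>x. cutoff' 1 x *\<^sub>R (J *v u x))"
    using solves_cutoff[OF u(1), of 1] by simp
  moreover have "cutoff 1 0 *\<^sub>R u 0 = c" using cutoff_values(3)[of 1 0] u by simp
  ultimately show ?thesis using that by blast
qed

text \<open>Cutting off approximates in the graph norm, because the commutator term tends to 0 in \<open>L\<^sup>2\<close>.\<close>

lemma boundary_op_zero_subset_D_min:
  assumes Q: "L1_loc Q"
  shows "boundary_op Q {0} \<subseteq> D_min Q"
proof (clarify, elim boundary_opE)
  fix F G y g
  assume FG: "F = L2_class y" "G = L2_class g" and y: "solves Q y g" "square_integrable y" "square_integrable g" "y 0 \<in> {0}"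
  define Y where "Y n x = cutoff (Suc n) x *\<^sub>R y x" for n x
  define H where "H n x = cutoff (Suc n) x *\<^sub>R g x + cutoff' (Suc n) x *\<^sub>R (J *v y x)" for n x
  have cm: "cutoff (Suc n) \<in> borel_measurable halfline" for n
    by (intro L1_loc_measurable L1_loc_continuous primitive_continuous[OF cutoff_primitive]) simp
  have c1: "\<bar>cutoff (Suc n) x\<bar> \<le> 1" "\<bar>cutoff (Suc n) x - 1\<bar> \<le> 1" if "x \<ge> 0" for n x
    using cutoff_values(1,2)[of "Suc n" x] that by auto
  have sq: "square_integrable (\<lambda>x. cutoff (Suc n) x *\<^sub>R f x)" if "square_integrable f" for n and f :: "real \<Rightarrow> complex ^ ('a + 'a)"
    by (rule square_integrable_bounded_mult[OF that cm c1(1)])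
  have sq': "square_integrable (\<lambda>x. cutoff' (Suc n) x *\<^sub>R (J *v y x))" for n
    by (rule square_integrable_bounded_mult[OF square_integrable_J[OF y(2)] cutoff'_measurable]) (simp add: cutoff'_le)
  have Ysol: "solves Q (Y n) (H n)" "square_integrable (Y n)" "square_integrable (H n)" for n
    using solves_cutoff[OF y(1), of "Suc n"] sq[OF y(2)] square_integrable_add[OF sq[OF y(3)] sq']
    by (auto simp: Y_def[abs_def] H_def[abs_def])
  have lim: "(\<lambda>n. L2_class (\<lambda>x. cutoff (Suc n) x *\<^sub>R f x)) \<longlonglongrightarrow> L2_class f"
    if f: "square_integrable f" for f :: "real \<Rightarrow> complex ^ ('a + 'a)"
  proof -
    have "(\<lambda>n. L2_class (\<lambda>x. (cutoff (Suc n) x - 1) *\<^sub>R f x)) \<longlonglongrightarrow> 0"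
    proof (rule L2_class_bounded_mult_tendsto_0[OF f _ c1(2)])
      show "(\<lambda>x. cutoff (Suc n) x - 1) \<in> borel_measurable halfline" for n using cm by measurable
      fix x :: real assume x: "x \<ge> 0"
      show "eventually (\<lambda>n. cutoff (Suc n) x - 1 = 0) sequentially"
      proof (rule eventually_sequentiallyI[of "nat \<lceil>x\<rceil>"])
        fix n assume "nat \<lceil>x\<rceil> \<le> n"
        then have "x \<le> real (Suc n)" by linarith
        then show "cutoff (Suc n) x - 1 = 0" using cutoff_values(3)[of "Suc n" x] x by simp
      qed
    qed
    moreover have "L2_class (\<lambda>x. (cutoff (Suc n) x - 1) *\<^sub>R f x) = L2_class (\<lambda>x. cutoff (Suc n) x *\<^sub>R f x) - L2_class f" for n
      using L2_class_diff[OF sq[OF f, of n] f] by (simp add: scaleR_diff_left)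
    ultimately show ?thesis by (simp add: LIM_zero_iff)
  qed
  have lim': "(\<lambda>n. L2_class (\<lambda>x. cutoff' (Suc n) x *\<^sub>R (J *v y x))) \<longlonglongrightarrow> 0"
  proof (rule L2_class_bounded_mult_tendsto_0[OF square_integrable_J[OF y(2)] cutoff'_measurable])
    show "\<bar>cutoff' (Suc n) x\<bar> \<le> 1" for n x by (rule cutoff'_le) simp
    fix x :: real
    show "eventually (\<lambda>n. cutoff' (Suc n) x = 0) sequentially"
    proof (rule eventually_sequentiallyI[of "nat \<lceil>x\<rceil>"])
      fix n assume "nat \<lceil>x\<rceil> \<le> n"
      then have "x < real (Suc n)" by linarith
      then show "cutoff' (Suc n) x = 0" by (simp add: cutoff'_def)
    qed
  qed
  have "L2_class (H n) = L2_class (\<lambda>x. cutoff (Suc n) x *\<^sub>R g x) + L2_class (\<lambda>x. cutoff' (Suc n) x *\<^sub>R (J *v y x))" for n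
    unfolding H_def[abs_def] by (rule L2_class_add[OF sq[OF y(3)] sq', symmetric])
  then have "(\<lambda>n. L2_class (H n)) \<longlonglongrightarrow> G"
    using tendsto_add[OF lim[OF y(3)] lim'] by (simp add: FG)
  moreover have "(\<lambda>n. L2_class (Y n)) \<longlonglongrightarrow> F" unfolding Y_def[abs_def] FG by (rule lim[OF y(2)])
  ultimately have "(\<lambda>n. (L2_class (Y n), L2_class (H n))) \<longlonglongrightarrow> (F, G)" by (intro tendsto_Pair)
  moreover have "(L2_class (Y n), L2_class (H n)) \<in> {(L2_class y, L2_class (dirac_expr Q y)) |y.
     y \<in> max_domain Q \<and> (\<exists>b\<ge>0. \<forall>x>b. y x = 0) \<and> y 0 = 0}" for n
  proof (intro CollectI exI[of _ "Y n"] conjI)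
    show "(L2_class (Y n), L2_class (H n)) = (L2_class (Y n), L2_class (dirac_expr Q (Y n)))"
      using solves_max_domain(2)[OF Q Ysol] by simp
    show "Y n \<in> max_domain Q" by (rule solves_max_domain(1)[OF Q Ysol])
    show "\<exists>b\<ge>0. \<forall>x>b. Y n x = 0"
      by (rule exI[of _ "2 * real (Suc n)"]) (auto simp: Y_def cutoff_values(4)[of "Suc n"])
    show "Y n 0 = 0" using y(4) by (simp add: Y_def)
  qed
  ultimately show "(F, G) \<in> D_min Q"
    unfolding D_min_def closure_sequential by (intro exI[of _ "\<lambda>n. (L2_class (Y n), L2_class (H n))"]) blast
qed

section \<open>Numerical bounds of the imaginary part\<close>

definition Im_bounds :: "(real \<Rightarrow> complex ^ 'n ^ 'n) \<Rightarrow> real \<Rightarrow> real \<Rightarrow> bool" where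
  "Im_bounds Q a b \<longleftrightarrow> (AE x in halfline. \<forall>u. a * (norm u)\<^sup>2 \<le> Im (cdot (Q x *v u) u) \<and>
     Im (cdot (Q x *v u) u) \<le> b * (norm u)\<^sup>2)"

lemma Im_bounds_ctranspose: "Im_bounds Q a b \<Longrightarrow> Im_bounds (\<lambda>x. ctranspose (Q x)) (- b) (- a)"
proof -
  have "Im (cdot (ctranspose A *v u) u) = - Im (cdot (A *v u) u)" for A :: "complex ^ 'a ^ 'a" and u
    using cdot_commute[of "ctranspose A *v u" u] by (simp add: cdot_ctranspose[of A])
  then show "Im_bounds Q a b \<Longrightarrow> Im_bounds (\<lambda>x. ctranspose (Q x)) (- b) (- a)"
    unfolding Im_bounds_def by (auto elim: eventually_mono)
qed

lemma coercive_shift: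
  assumes "Im_bounds Q a b"
  shows "Im l > b \<Longrightarrow> coercive (\<lambda>x. Q x - mat l) 1 (Im l - b)"
    and "Im l < a \<Longrightarrow> coercive (\<lambda>x. Q x - mat l) (- 1) (a - Im l)"
proof -
  have eq: "Im (cdot (- ((Q x - mat l) *v u)) u) = Im l * (norm u)\<^sup>2 - Im (cdot (Q x *v u) u)" for x u
    by (simp add: mv_diff_left mat_mult_vector
        cdot_diff_left cdot_scale_left cdot_self del: of_real_power)
  show "Im l > b \<Longrightarrow> coercive (\<lambda>x. Q x - mat l) 1 (Im l - b)"
    using assms unfolding coercive_def eq Im_bounds_def by (auto elim!: eventually_mono simp: left_diff_distrib)
  show "Im l < a \<Longrightarrow> coercive (\<lambda>x. Q x - mat l) (- 1) (a - Im l)"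
    using assms unfolding coercive_def eq Im_bounds_def by (auto elim!: eventually_mono simp: left_diff_distrib)
qed

lemma L1_loc_shift: "L1_loc Q \<Longrightarrow> L1_loc (\<lambda>x. Q x - mat l)"
  by (rule L1_loc_diff[OF _ L1_loc_continuous[OF continuous_on_const]])

lemma adjoint_opD: "(h, k) \<in> adjoint_op T \<Longrightarrow> (f, g) \<in> T \<Longrightarrow> cinner_L2 g h = cinner_L2 f k"
  unfolding adjoint_op_def by blast

context lagrangian
begin

lemma linear_operator_boundary: "linear_operator (boundary_op Q boundary)"
  by (rule linear_operator_boundary_op) (simp_all add: boundary_subspace)

lemma boundary_op_shift_surj:
  assumes Q: "L1_loc Q" and c: "coercive (\<lambda>x. Q x - mat l) s d"
  shows "\<exists>(f, g)\<in>boundary_op Q boundary. g - scaleC_L2 l f = h"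
proof -
  obtain f where f: "square_integrable f" "h = L2_class f" by (rule L2_class_surj)
  obtain y where y: "solves (\<lambda>x. Q x - mat l) y f" "y 0 \<in> boundary" "square_integrable y"
    by (rule halfline_boundary_problem[OF L1_loc_shift[OF Q] c f(1)])
  have sq: "square_integrable (\<lambda>x. l *s y x)" by (rule square_integrable_scale[OF y(3)])
  have "(L2_class y, L2_class (\<lambda>x. l *s y x + f x)) \<in> boundary_op Q boundary"
    using y(1) unfolding solves_shift by (intro boundary_opI y square_integrable_add sq f)
  moreover have "L2_class (\<lambda>x. l *s y x + f x) - scaleC_L2 l (L2_class y) = h"
    by (simp add: L2_class_add[OF sq f(1), symmetric] L2_class_scale[OF y(3), symmetric] f)
  ultimately show ?thesis by blast
qed

text \<open>By Green's formula, as the boundary form vanishes on a Lagrangian subspace.\<close>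

lemma boundary_op_subset_adjoint:
  "boundary_op (\<lambda>x. ctranspose (Q x)) boundary \<subseteq> adjoint_op (boundary_op Q boundary)"
proof (clarify, elim boundary_opE)
  fix F G z k assume z: "F = L2_class z" "G = L2_class k" "solves (\<lambda>x. ctranspose (Q x)) z k"
    "square_integrable z" "square_integrable k" "z 0 \<in> boundary"
  have "cinner_L2 g F = cinner_L2 f G" if fg: "(f, g) \<in> boundary_op Q boundary" for f g
  proof -
    obtain y w where y: "f = L2_class y" "g = L2_class w" "solves Q y w"
      "square_integrable y" "square_integrable w" "y 0 \<in> boundary"
      by (rule boundary_opE[OF fg])
    show ?thesis
      using green_formula[OF y(3) z(3) y(4,5) z(4,5)] boundary_isotropic[OF y(6) z(6)] by (simp add: y z)
  qed
  then show "(F, G) \<in> adjoint_op (boundary_op Q boundary)" by (auto simp: adjoint_op_def)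
qed

text \<open>Given \<open>(h, k)\<close> in the adjoint, solve the equation for the adjoint coefficient with right-hand side
\<open>k - l h\<close>. The solution differs from \<open>h\<close> by an element orthogonal to the range of the operator
minus \<open>cnj l\<close>, and this range is the whole space.\<close>

lemma adjoint_boundary_op:
  assumes Q: "L1_loc Q" and b: "Im_bounds Q a b"
  shows "adjoint_op (boundary_op Q boundary) = boundary_op (\<lambda>x. ctranspose (Q x)) boundary"
proof
  show "adjoint_op (boundary_op Q boundary) \<subseteq> boundary_op (\<lambda>x. ctranspose (Q x)) boundary"
  proof clarify
    fix h k assume hk: "(h, k) \<in> adjoint_op (boundary_op Q boundary)"
    \<comment> \<open>Far enough from the real axis that the shift by \<open>l\<close> of the adjoint coefficient and the shift
      by \<open>cnj l\<close> of \<open>Q\<close> are both coercive.\<close>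
    define l where "l = Complex 0 (\<bar>a\<bar> + \<bar>b\<bar> + 1)"
    have c1: "coercive (\<lambda>x. ctranspose (Q x) - mat l) 1 (Im l - (- a))"
      by (rule coercive_shift(1)[OF Im_bounds_ctranspose[OF b]]) (simp add: l_def)
    have c2: "coercive (\<lambda>x. Q x - mat (cnj l)) (- 1) (a - Im (cnj l))"
      by (rule coercive_shift(2)[OF b]) (simp add: l_def)
    obtain u w where u: "(u, w) \<in> boundary_op (\<lambda>x. ctranspose (Q x)) boundary" "w - scaleC_L2 l u = k - scaleC_L2 l h"
      using boundary_op_shift_surj[OF L1_loc_ctranspose[OF Q] c1, of "k - scaleC_L2 l h"] by auto
    obtain f g where f: "(f, g) \<in> boundary_op Q boundary" "g - scaleC_L2 (cnj l) f = h - u"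
      using boundary_op_shift_surj[OF Q c2, of "h - u"] by auto
    have "cinner_L2 g h = cinner_L2 f k" by (rule adjoint_opD[OF hk f(1)])
    moreover have "cinner_L2 g u = cinner_L2 f w"
      by (rule adjoint_opD[OF subsetD[OF boundary_op_subset_adjoint u(1)] f(1)])
    ultimately have "cinner_L2 g (h - u) = cinner_L2 f (k - w)" by (simp add: cinner_L2_diff_right)
    moreover have kw: "k - w = scaleC_L2 l (h - u)" using u(2) by (simp add: scaleC_L2_diff algebra_simps)
    ultimately have "cinner_L2 (g - scaleC_L2 (cnj l) f) (h - u) = 0"
      by (simp add: cinner_L2_diff_left cinner_L2_scale_left cinner_L2_scale_right)
    then have "h - u = 0" unfolding f(2) by (simp add: cinner_L2_self)
    then have "h = u" "k = w" using kw by auto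
    then show "(h, k) \<in> boundary_op (\<lambda>x. ctranspose (Q x)) boundary" using u by simp
  qed
qed (rule boundary_op_subset_adjoint)

lemma closed_boundary_op:
  assumes Q: "L1_loc Q" and b: "Im_bounds Q a b"
  shows "closed (boundary_op Q boundary)"
  using adjoint_boundary_op[OF L1_loc_ctranspose[OF Q] Im_bounds_ctranspose[OF b]]
    closed_adjoint_op[of "boundary_op (\<lambda>x. ctranspose (Q x)) boundary"]
  by (simp add: ctranspose_ctranspose)

end

section \<open>The minimal operator\<close>

lemma identity_zero_matrix:
  "ctranspose (mat 1 :: complex ^ 'p ^ 'p) = mat 1" "ctranspose (0 :: complex ^ 'p ^ 'p) = 0"
  "(0 :: complex ^ 'p ^ 'p) ** A = 0" "A ** (0 :: complex ^ 'p ^ 'p) = 0"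
  by (simp_all add: ctranspose_def vec_eq_iff mat_def matrix_matrix_mult_def if_distrib[where f = cnj] cong: if_cong)

interpretation upper_condition: lagrangian "mat 1 :: complex ^ 'p ^ ('p::finite)" 0
  by unfold_locales (simp_all add: identity_zero_matrix matrix_mul_lid matrix_mul_rid)

interpretation lower_condition: lagrangian 0 "mat 1 :: complex ^ 'p ^ ('p::finite)"
  by unfold_locales (simp_all add: identity_zero_matrix matrix_mul_lid matrix_mul_rid)

text \<open>The operator with \<open>y(0) = 0\<close> is the intersection of those with \<open>y\<^sub>1(0) = 0\<close> and with
\<open>y\<^sub>2(0) = 0\<close>, whose graphs are closed since they are adjoints. It contains the compactly supported
functions of the definition, hence their closure; the cut-offs give the converse.\<close>

lemma D_min_eq_boundary_op:
  fixes Q :: "real \<Rightarrow> complex ^ ('p::finite + 'p) ^ ('p + 'p)"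
  assumes Q: "L1_loc Q" and b: "Im_bounds Q a b"
  shows "D_min Q = boundary_op Q {0}"
proof
  let ?M1 = "upper_condition.boundary :: (complex ^ ('p + 'p)) set" and ?M2 = "lower_condition.boundary :: (complex ^ ('p + 'p)) set"
  have M1: "?M1 = {u. upper u = 0}"
    by (simp add: upper_condition.boundary_def mv_zero_left)
  have M2: "?M2 = {u. lower u = 0}"
    by (simp add: lower_condition.boundary_def mv_zero_left)
  have M: "?M1 \<inter> ?M2 = {0}"
    unfolding M1 M2 by (auto intro: upper_lower_eqI simp: upper_lower_simps)
  have "boundary_op Q {0} = boundary_op Q ?M1 \<inter> boundary_op Q ?M2"
  proof
    show "boundary_op Q {0} \<subseteq> boundary_op Q ?M1 \<inter> boundary_op Q ?M2"
      using M by (intro Int_greatest boundary_op_mono) auto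
    show "boundary_op Q ?M1 \<inter> boundary_op Q ?M2 \<subseteq> boundary_op Q {0}"
    proof clarify
      fix F G assume 1: "(F, G) \<in> boundary_op Q ?M1" and 2: "(F, G) \<in> boundary_op Q ?M2"
      obtain y g where y: "F = L2_class y" "G = L2_class g" "solves Q y g" "square_integrable y" "square_integrable g" "y 0 \<in> ?M1"
        by (rule boundary_opE[OF 1])
      obtain z k where z: "F = L2_class z" "G = L2_class k" "solves Q z k" "square_integrable z" "square_integrable k" "z 0 \<in> ?M2"
        by (rule boundary_opE[OF 2])
      have "y 0 = z 0" by (rule solves_class_eq[OF y(3) z(3) y(4) z(4)]) (use y z in auto)
      then have "y 0 \<in> {0}" using y(6) z(6) M by auto
      then show "(F, G) \<in> boundary_op Q {0}" using y by (auto intro: boundary_opI)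
    qed
  qed
  then have cl: "closed (boundary_op Q {0})"
    using upper_condition.closed_boundary_op[OF Q b] lower_condition.closed_boundary_op[OF Q b] by auto
  show "D_min Q \<subseteq> boundary_op Q {0}"
    unfolding D_min_def
    by (rule closure_minimal[OF _ cl]) (auto intro!: boundary_opI max_domain_solves[OF Q])
  show "boundary_op Q {0} \<subseteq> D_min Q" by (rule boundary_op_zero_subset_D_min[OF Q])
qed

context lagrangian
begin

lemma boundary_op_in_Ext:
  assumes Q: "L1_loc Q" and b: "Im_bounds Q a b"
  shows "boundary_op Q boundary \<in> Ext (D_min Q) (D_min (\<lambda>x. ctranspose (Q x)))"
  unfolding Ext_def D_min_eq_boundary_op[OF Q b] D_min_eq_boundary_op[OF L1_loc_ctranspose[OF Q] Im_bounds_ctranspose[OF b]]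
proof (intro CollectI conjI linear_operator_boundary)
  show "boundary_op Q {0} \<subseteq> boundary_op Q boundary" using boundary_subspace(1) by (intro boundary_op_mono) auto
  have "boundary_op Q boundary = adjoint_op (boundary_op (\<lambda>x. ctranspose (Q x)) boundary)"
    using adjoint_boundary_op[OF L1_loc_ctranspose[OF Q] Im_bounds_ctranspose[OF b]] by (simp add: ctranspose_ctranspose)
  also have "\<dots> \<subseteq> adjoint_op (boundary_op (\<lambda>x. ctranspose (Q x)) {0})"
    using boundary_subspace(1) by (intro adjoint_op_antimono boundary_op_mono) auto
  finally show "boundary_op Q boundary \<subseteq> adjoint_op (boundary_op (\<lambda>x. ctranspose (Q x)) {0})" .
qed

text \<open>Modulo the minimal domain only the trace \<open>y(0)\<close> counts, and it takes all values in the Lagrangian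
subspace. A basis of the quotient is formed by functions whose traces are the images under \<open>param\<close>
of the standard basis vectors. The basis has \<open>p\<close> elements for every \<open>Q\<close>, which is what
quasi-selfadjointness asks of \<open>Q\<close> and its adjoint.\<close>

lemma quotient_basis_boundary_op:
  assumes Q: "L1_loc Q"
  obtains B where "quotient_basis (Domain (boundary_op Q boundary)) (Domain (boundary_op Q {0})) B"
    "B \<approx> (UNIV :: 'p set)"
proof -
  have "\<forall>j::'p. \<exists>y g. solves Q y g \<and> square_integrable y \<and> square_integrable g \<and> y 0 = param (axis j 1)"
    using initial_value_attained[OF Q] by metis
  then obtain y g where y: "\<And>j::'p. solves Q (y j) (g j)" "\<And>j. square_integrable (y j)" "\<And>j. square_integrable (g j)"
    "\<And>j. y j 0 = param (axis j 1)" by metis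
  define s where "s j = L2_class (y j)" for j
  define comb where "comb c x = (\<Sum>j\<in>UNIV. c j *s y j x)" for c x
  have comb: "\<exists>h. solves Q (comb c) h \<and> square_integrable (comb c) \<and> square_integrable h \<and>
      (\<Sum>j\<in>UNIV. scaleC_L2 (c j) (s j)) = L2_class (comb c)" for c
  proof -
    have "\<exists>h. solves Q (\<lambda>x. \<Sum>j\<in>A. c j *s y j x) h \<and> square_integrable (\<lambda>x. \<Sum>j\<in>A. c j *s y j x) \<and> square_integrable h \<and>
      (\<Sum>j\<in>A. scaleC_L2 (c j) (s j)) = L2_class (\<lambda>x. \<Sum>j\<in>A. c j *s y j x)" if "finite A" for A
      using that
    proof (induction A rule: finite_induct)
      case empty
      have "solves Q (\<lambda>x. 0) (\<lambda>x. 0)"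
        unfolding solves_def primitive_def by (simp add: mv_zero L1_loc_continuous)
      then show ?case by (auto intro!: exI[of _ "\<lambda>x. 0"] simp: square_integrable_zero L2_class_zero)
    next
      case (insert i A)
      then obtain h where h: "solves Q (\<lambda>x. \<Sum>j\<in>A. c j *s y j x) h" "square_integrable (\<lambda>x. \<Sum>j\<in>A. c j *s y j x)" "square_integrable h"
        "(\<Sum>j\<in>A. scaleC_L2 (c j) (s j)) = L2_class (\<lambda>x. \<Sum>j\<in>A. c j *s y j x)" by blast
      show ?case
        using insert.hyps h solves_add[OF solves_scale[OF y(1)[of i], of "c i"] h(1)]
        by (intro exI[of _ "\<lambda>x. c i *s g i x + h x"])
           (simp add: square_integrable_add square_integrable_scale y L2_class_add L2_class_scale s_def)
    qed
    then show ?thesis unfolding comb_def[abs_def] by simp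
  qed
  have comb0: "comb c 0 = param (\<chi> j. c j)" for c by (simp add: comb_def y(4) param_sum)
  have zero: "c j = 0" if dom: "(\<Sum>j\<in>UNIV. scaleC_L2 (c j) (s j)) \<in> Domain (boundary_op Q {0})" for c j
  proof -
    obtain G where "(\<Sum>j\<in>UNIV. scaleC_L2 (c j) (s j), G) \<in> boundary_op Q {0}" using dom by blast
    then obtain z k where z: "(\<Sum>j\<in>UNIV. scaleC_L2 (c j) (s j)) = L2_class z" "solves Q z k" "square_integrable z" "z 0 = 0"
      by (elim boundary_opE) auto
    obtain h where h: "solves Q (comb c) h" "square_integrable (comb c)"
      "(\<Sum>j\<in>UNIV. scaleC_L2 (c j) (s j)) = L2_class (comb c)" using comb by blast
    have "comb c 0 = z 0" by (rule solves_class_eq[OF h(1) z(2) h(2) z(3)]) (use h z in auto)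
    then have "(\<chi> j. c j) = 0" using z(4) comb0 param_eq_0 by metis
    then show ?thesis by (simp add: vec_eq_iff)
  qed
  have zin: "0 \<in> Domain (boundary_op Q {0})"
    using linear_operator_boundary_op[of "{0}" Q] unfolding linear_operator_def by (auto simp: vec_eq_iff)
  have inj_s: "inj s"
  proof (rule injI)
    fix i j assume "s i = s j"
    have "y i 0 = y j 0" by (rule solves_class_eq[OF y(1) y(1) y(2) y(2)]) (use \<open>s i = s j\<close> in \<open>auto simp: s_def\<close>)
    then have "param (axis i 1) = param (axis j 1)" by (simp add: y(4))
    then have "lower (param (axis i 1)) = lower (param (axis j 1))" "upper (param (axis i 1)) = upper (param (axis j 1))"
      by (simp_all only:)
    then have e: "C *v axis i 1 = C *v axis j 1" "S *v axis i 1 = S *v axis j 1"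
      unfolding param_def upper_join lower_join neg_equal_iff_equal by this+
    have "(axis i 1 :: complex ^ 'p) = C *v (C *v axis i 1) + S *v (S *v axis i 1)" by (rule pyth[symmetric])
    also have "\<dots> = C *v (C *v axis j 1) + S *v (S *v axis j 1)" by (simp only: e)
    also have "\<dots> = axis j 1" by (rule pyth)
    finally show "i = j" by (simp add: axis_eq_axis)
  qed
  have fin: "finite (range s)" by simp
  have sum_s: "(\<Sum>v\<in>range s. scaleC_L2 (u v) v) = (\<Sum>j\<in>UNIV. scaleC_L2 (u (s j)) (s j))" for u
    using sum.reindex[OF inj_s, of "\<lambda>v. scaleC_L2 (u v) v"] by (simp only: o_def)
  have span: "L2.span (range s) = range (\<lambda>c. \<Sum>j\<in>UNIV. scaleC_L2 (c j) (s j))"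
  proof
    show "L2.span (range s) \<subseteq> range (\<lambda>c. \<Sum>j\<in>UNIV. scaleC_L2 (c j) (s j))"
    proof
      fix v assume "v \<in> L2.span (range s)"
      then obtain u where "v = (\<Sum>w\<in>range s. scaleC_L2 (u w) w)"
        unfolding L2.span_finite[OF fin] by (rule rangeE)
      then show "v \<in> range (\<lambda>c. \<Sum>j\<in>UNIV. scaleC_L2 (c j) (s j))"
        unfolding sum_s by (rule range_eqI[where x = "\<lambda>j. u (s j)"])
    qed
    show "range (\<lambda>c. \<Sum>j\<in>UNIV. scaleC_L2 (c j) (s j)) \<subseteq> L2.span (range s)"
      by (rule image_subsetI) (intro L2.span_sum L2.span_scale L2.span_base rangeI)
  qed
  have "quotient_basis (Domain (boundary_op Q boundary)) (Domain (boundary_op Q {0})) (range s)"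
    unfolding quotient_basis_def
  proof (intro conjI)
    show "range s \<subseteq> Domain (boundary_op Q boundary)"
    proof (rule image_subsetI)
      fix j
      have "y j 0 \<in> boundary" unfolding y(4) by (rule param_in_boundary)
      then show "s j \<in> Domain (boundary_op Q boundary)"
        unfolding s_def by (intro DomainI[OF boundary_opI[OF y(1-3)]])
    qed
    show "L2.independent (range s)"
      unfolding L2.dependent_finite[OF fin] sum_s
    proof clarify
      fix u j assume "(\<Sum>j\<in>UNIV. scaleC_L2 (u (s j)) (s j)) = 0" "u (s j) \<noteq> 0"
      then show False using zero[of "\<lambda>j. u (s j)" j] zin by simp
    qed
    show "L2.span (range s) \<inter> Domain (boundary_op Q {0}) = {0}"
    proof
      show "L2.span (range s) \<inter> Domain (boundary_op Q {0}) \<subseteq> {0}"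
      proof
        fix v assume v: "v \<in> L2.span (range s) \<inter> Domain (boundary_op Q {0})"
        then obtain c where c: "v = (\<Sum>j\<in>UNIV. scaleC_L2 (c j) (s j))" unfolding span by blast
        have "c j = 0" for j by (rule zero) (use v c in auto)
        then show "v \<in> {0}" using c by simp
      qed
      show "{0} \<subseteq> L2.span (range s) \<inter> Domain (boundary_op Q {0})" using zin L2.span_zero by blast
    qed
    show "Domain (boundary_op Q boundary) = {u + v |u v. u \<in> L2.span (range s) \<and> v \<in> Domain (boundary_op Q {0})}"
    proof (intro equalityI subsetI)
      fix F assume "F \<in> Domain (boundary_op Q boundary)"
      then obtain z k where z: "F = L2_class z" "solves Q z k" "square_integrable z" "square_integrable k" "z 0 \<in> boundary"
        by (elim DomainE boundary_opE) blast
      define m where "m = C *v lower (z 0) - S *v upper (z 0)"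
      have m: "param m = z 0" unfolding m_def by (rule boundary_param[OF z(5)])
      obtain h where h: "solves Q (comb (($) m)) h" "square_integrable (comb (($) m))" "square_integrable h"
        "(\<Sum>j\<in>UNIV. scaleC_L2 (m $ j) (s j)) = L2_class (comb (($) m))" using comb[of "($) m"] by blast
      have c0: "comb (($) m) 0 = z 0" by (simp add: comb0 m)
      have "(L2_class (\<lambda>x. z x - comb (($) m) x), L2_class (\<lambda>x. k x - h x)) \<in> boundary_op Q {0}"
        by (intro boundary_opI solves_diff square_integrable_diff z h) (simp add: c0)
      moreover have "F = L2_class (comb (($) m)) + L2_class (\<lambda>x. z x - comb (($) m) x)"
        using L2_class_diff[OF z(3) h(2)] z(1) by (simp add: algebra_simps)
      moreover have "L2_class (comb (($) m)) \<in> L2.span (range s)" unfolding span h(4)[symmetric] by blast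
      ultimately show "F \<in> {u + v |u v. u \<in> L2.span (range s) \<and> v \<in> Domain (boundary_op Q {0})}" by blast
    next
      fix F assume "F \<in> {u + v |u v. u \<in> L2.span (range s) \<and> v \<in> Domain (boundary_op Q {0})}"
      then obtain c v where F: "F = (\<Sum>j\<in>UNIV. scaleC_L2 (c j) (s j)) + v" "v \<in> Domain (boundary_op Q {0})"
        unfolding span by blast
      then obtain z k where z: "v = L2_class z" "solves Q z k" "square_integrable z" "square_integrable k" "z 0 = 0"
        by (elim DomainE boundary_opE) blast
      obtain h where h: "solves Q (comb c) h" "square_integrable (comb c)" "square_integrable h"
        "(\<Sum>j\<in>UNIV. scaleC_L2 (c j) (s j)) = L2_class (comb c)" using comb[of c] by blast
      have "(L2_class (\<lambda>x. comb c x + z x), L2_class (\<lambda>x. h x + k x)) \<in> boundary_op Q boundary"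
        by (intro boundary_opI solves_add square_integrable_add z h) (simp add: z(5) comb0 param_in_boundary)
      moreover have "F = L2_class (\<lambda>x. comb c x + z x)" using F h z by (simp add: L2_class_add)
      ultimately show "F \<in> Domain (boundary_op Q boundary)" by blast
    qed
  qed
  moreover have "range s \<approx> (UNIV :: 'p set)" by (rule inj_on_image_eqpoll_self[OF inj_s])
  ultimately show ?thesis using that by blast
qed

lemma quasi_selfadjoint_boundary_op:
  assumes Q: "L1_loc Q" and b: "Im_bounds Q a b"
  shows "quasi_selfadjoint (D_min Q) (D_min (\<lambda>x. ctranspose (Q x))) (boundary_op Q boundary)"
  unfolding quasi_selfadjoint_def
proof
  show "boundary_op Q boundary \<in> Ext (D_min Q) (D_min (\<lambda>x. ctranspose (Q x)))"
    by (rule boundary_op_in_Ext[OF Q b])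
  obtain B where B: "quotient_basis (Domain (boundary_op Q boundary)) (Domain (boundary_op Q {0})) B" "B \<approx> (UNIV :: 'p set)"
    by (rule quotient_basis_boundary_op[OF Q])
  obtain B' where B': "quotient_basis (Domain (boundary_op (\<lambda>x. ctranspose (Q x)) boundary))
      (Domain (boundary_op (\<lambda>x. ctranspose (Q x)) {0})) B'" "B' \<approx> (UNIV :: 'p set)"
    by (rule quotient_basis_boundary_op[OF L1_loc_ctranspose[OF Q]])
  show "quotient_dim_eq (Domain (boundary_op Q boundary)) (Domain (D_min Q))
     (Domain (adjoint_op (boundary_op Q boundary))) (Domain (D_min (\<lambda>x. ctranspose (Q x))))"
    unfolding quotient_dim_eq_def adjoint_boundary_op[OF Q b] D_min_eq_boundary_op[OF Q b]
      D_min_eq_boundary_op[OF L1_loc_ctranspose[OF Q] Im_bounds_ctranspose[OF b]]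
    using B B' eqpoll_trans eqpoll_sym by blast
qed

text \<open>The imaginary part of the form is the integral of the imaginary form of \<open>Q\<close>. Since \<open>Q y\<close> need not
be square-integrable, only this imaginary form is integrated: it is dominated by \<open>\<bar>y\<bar>\<^sup>2\<close>.\<close>

lemma numerical_range_boundary_op:
  assumes Q: "L1_loc Q" and b: "Im_bounds Q a b" and FG: "(F, G) \<in> boundary_op Q boundary"
  shows "a * (norm F)\<^sup>2 \<le> Im (cinner_L2 G F)" "Im (cinner_L2 G F) \<le> b * (norm F)\<^sup>2"
proof -
  obtain y g where y: "F = L2_class y" "G = L2_class g" "solves Q y g" "square_integrable y" "square_integrable g" "y 0 \<in> boundary"
    by (rule boundary_opE[OF FG])
  define q where "q x = Im (cdot (Q x *v y x) (y x))" for x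
  have yc: "continuous_on {0..} y" by (rule solves_continuous[OF y(3)])
  have ym: "y \<in> borel_measurable halfline" "integrable halfline (\<lambda>x. (norm (y x))\<^sup>2)"
    using y(4) by (auto simp: square_integrable_def)
  have "(\<lambda>x. Q x *v y x) \<in> borel_measurable halfline"
    by (intro L1_loc_measurable L1_loc_bilinear_flip[OF bounded_bilinear_matrix_vector_mult] Q yc)
  then have "(\<lambda>x. cdot (Q x *v y x) (y x)) \<in> borel_measurable halfline"
    by (intro borel_measurable_cdot ym)
  then have qm: "q \<in> borel_measurable halfline" unfolding q_def[abs_def] by measurable
  have qb: "AE x in halfline. a * (norm (y x))\<^sup>2 \<le> q x \<and> q x \<le> b * (norm (y x))\<^sup>2"
    using b unfolding Im_bounds_def q_def by eventually_elim blast
  have qi: "integrable halfline q"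
  proof (rule Bochner_Integration.integrable_bound[OF _ qm])
    show "integrable halfline (\<lambda>x. (\<bar>a\<bar> + \<bar>b\<bar>) * (norm (y x))\<^sup>2)" using ym by simp
    show "AE x in halfline. norm (q x) \<le> norm ((\<bar>a\<bar> + \<bar>b\<bar>) * (norm (y x))\<^sup>2)"
      using qb
    proof eventually_elim
      case (elim x)
      have "- (\<bar>a\<bar> * (norm (y x))\<^sup>2) \<le> a * (norm (y x))\<^sup>2" "b * (norm (y x))\<^sup>2 \<le> \<bar>b\<bar> * (norm (y x))\<^sup>2"
        using mult_right_mono[of "- \<bar>a\<bar>" a "(norm (y x))\<^sup>2"] mult_right_mono[of b "\<bar>b\<bar>" "(norm (y x))\<^sup>2"] by auto
      moreover have "0 \<le> \<bar>a\<bar> * (norm (y x))\<^sup>2" "0 \<le> \<bar>b\<bar> * (norm (y x))\<^sup>2" by auto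
      ultimately have "\<bar>q x\<bar> \<le> (\<bar>a\<bar> + \<bar>b\<bar>) * (norm (y x))\<^sup>2" 
        using elim unfolding distrib_right abs_le_iff by linarith
      then show ?case by simp
    qed
  qed
  have gi: "integrable halfline (\<lambda>x. cdot (g x) (y x))" by (intro integrable_cdot y)
  have eq: "2 * \<i> * of_real (Im (cdot (g x - Q x *v y x) (y x))) = 2 * \<i> * of_real (Im (cdot (g x) (y x)) - q x)" for x
    by (simp add: q_def cdot_diff_left)
  have ii: "integrable halfline (\<lambda>x. Im (cdot (g x) (y x)) - q x)"
    using gi qi by (intro Bochner_Integration.integrable_diff integrable_Im)
  have "integral\<^sup>L halfline (\<lambda>x. 2 * \<i> * of_real (Im (cdot (g x - Q x *v y x) (y x)))) = - cdot (J *v y 0) (y 0)"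
    unfolding eq
    by (rule primitive_integrable_integral_derivative[OF lagrange_identity_self[OF y(3), unfolded eq]])
       (use ii in \<open>intro integrable_cdot square_integrable_J y integrable_mult_right integrable_of_real\<close>)+
  moreover have "integral\<^sup>L halfline (\<lambda>x. 2 * \<i> * of_real (Im (cdot (g x) (y x)) - q x))
      = 2 * \<i> * of_real (integral\<^sup>L halfline (\<lambda>x. Im (cdot (g x) (y x)) - q x))"
    by (simp only: integral_mult_right_zero integral_complex_of_real)
  ultimately have "integral\<^sup>L halfline (\<lambda>x. Im (cdot (g x) (y x)) - q x) = 0"
    unfolding eq using boundary_isotropic[OF y(6,6)] by simp
  then have "Im (integral\<^sup>L halfline (\<lambda>x. cdot (g x) (y x))) = integral\<^sup>L halfline q"
    using gi qi by (simp add: integral_Im)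
  then have Im: "Im (cinner_L2 G F) = integral\<^sup>L halfline q" by (simp add: y cinner_L2_class)
  have n: "(norm F)\<^sup>2 = integral\<^sup>L halfline (\<lambda>x. (norm (y x))\<^sup>2)" by (simp add: y norm_L2_class)
  show "a * (norm F)\<^sup>2 \<le> Im (cinner_L2 G F)"
    unfolding Im n integral_mult_right_zero[symmetric]
    by (rule integral_mono_AE) (use ym qi qb in \<open>auto elim: eventually_mono\<close>)
  show "Im (cinner_L2 G F) \<le> b * (norm F)\<^sup>2"
    unfolding Im n integral_mult_right_zero[symmetric]
    by (rule integral_mono_AE) (use ym qi qb in \<open>auto elim: eventually_mono\<close>)
qed

text \<open>The bounds of the numerical range give the lower bound and coercivity the surjectivity.\<close>

lemma resolvent_set_boundary_op:
  assumes Q: "L1_loc Q" and b: "Im_bounds Q a b"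
  shows "{z. Im z < a} \<union> {z. Im z > b} \<subseteq> resolvent_set (boundary_op Q boundary)"
proof
  fix l assume l: "l \<in> {z. Im z < a} \<union> {z. Im z > b}"
  have Im: "Im (cinner_L2 (G - scaleC_L2 l F) F) = Im (cinner_L2 G F) - Im l * (norm F)\<^sup>2" for F G :: "('p + 'p) L2"
    by (simp add: cinner_L2_diff_left cinner_L2_scale_left cinner_L2_self del: of_real_power)
  have cancel: "d * norm F \<le> norm H" if "d * (norm F)\<^sup>2 \<le> \<bar>Im (cinner_L2 H F)\<bar>" for d and F H :: "('p + 'p) L2"
  proof (cases "norm F = 0")
    case False
    have "d * norm F * norm F \<le> norm H * norm F"
      using that Im_cinner_L2_le[of H F] by (simp add: power2_eq_square)
    then show ?thesis using False by (simp add: mult_le_cancel_right)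
  qed simp
  show "l \<in> resolvent_set (boundary_op Q boundary)"
  proof (cases "Im l < a")
    case True
    show ?thesis
    proof (rule mem_resolvent_set[OF linear_operator_boundary boundary_op_shift_surj[OF Q coercive_shift(2)[OF b True]]])
      show "a - Im l > 0" using True by simp
      fix F G assume "(F, G) \<in> boundary_op Q boundary"
      from numerical_range_boundary_op(1)[OF Q b this]
      show "(a - Im l) * norm F \<le> norm (G - scaleC_L2 l F)"
        by (intro cancel) (simp add: Im left_diff_distrib)
    qed
  next
    case False
    then have l': "Im l > b" using l by auto
    show ?thesis
    proof (rule mem_resolvent_set[OF linear_operator_boundary boundary_op_shift_surj[OF Q coercive_shift(1)[OF b l']]])
      show "Im l - b > 0" using l' by simp
      fix F G assume "(F, G) \<in> boundary_op Q boundary"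
      from numerical_range_boundary_op(2)[OF Q b this]
      show "(Im l - b) * norm F \<le> norm (G - scaleC_L2 l F)"
        by (intro cancel) (simp add: Im left_diff_distrib)
    qed
  qed
qed

end

section \<open>Solutions at points of the resolvent set\<close>

definition from_columns :: "('p::finite \<Rightarrow> complex ^ 'n) \<Rightarrow> complex ^ 'p ^ 'n" where
  "from_columns f = (\<chi> r j. f j $ r)"

lemma from_columns_mult: "from_columns f *v h = (\<Sum>j\<in>UNIV. h $ j *s f j)"
  by (simp add: from_columns_def matrix_vector_mult_def vec_eq_iff sum_component mult.commute)

lemma from_columns_axis: "from_columns (\<lambda>j. A *v axis j 1) = A"
  by (simp add: from_columns_def vec_eq_iff matrix_vector_mult_def axis_def if_distrib[where f = "\<lambda>x. _ * x"] cong: if_cong)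

lemma from_columns_eq_sum: "from_columns f = (\<Sum>j\<in>UNIV. from_columns (\<lambda>i. if i = j then f j else 0))"
  by (simp add: from_columns_def vec_eq_iff sum_component if_distrib[where f = "\<lambda>x. x $ _"] cong: if_cong)

lemma bounded_linear_single_column: "bounded_linear (\<lambda>u. from_columns (\<lambda>i. if i = j then u else 0))"
  unfolding linear_conv_bounded_linear[symmetric]
  by (rule linearI) (simp_all add: from_columns_def vec_eq_iff)

lemma primitive_sum:
  assumes "finite A" "\<And>j. j \<in> A \<Longrightarrow> primitive (y j) (g j)"
  shows "primitive (\<lambda>x. \<Sum>j\<in>A. y j x) (\<lambda>x. \<Sum>j\<in>A. g j x)"
  using assms
proof (induction A rule: finite_induct)
  case empty
  then show ?case by (simp add: primitive_def L1_loc_continuous)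
next
  case (insert i A)
  then show ?case using primitive_add[of "y i" "g i" "\<lambda>x. \<Sum>j\<in>A. y j x" "\<lambda>x. \<Sum>j\<in>A. g j x"] by simp
qed

lemma primitive_from_columns:
  assumes "\<And>j. primitive (y j) (g j)"
  shows "primitive (\<lambda>x. from_columns (\<lambda>j. y j x)) (\<lambda>x. from_columns (\<lambda>j. g j x))"
  unfolding from_columns_eq_sum[of "\<lambda>j. y j _"] from_columns_eq_sum[of "\<lambda>j. g j _"]
  by (intro primitive_sum primitive_linear[OF assms bounded_linear_single_column]) simp

lemma upper_lower_matrix_mult:
  "upper A *v h = upper (A *v h)" "lower A *v h = lower (A *v h)"
  for A :: "complex ^ 'p ^ ('q::finite + 'q)"
  by (simp_all add: upper_def lower_def matrix_vector_mult_def vec_eq_iff)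

lemma matrix_solution_mult:
  assumes Q: "L1_loc Q" and v: "matrix_solution Q l v"
  shows "solves Q (\<lambda>t. v t *v h) (\<lambda>t. l *s (v t *v h))"
proof (rule AC_loc_solves[OF Q])
  have "AC_loc (\<lambda>t. h)"
    using primitive_AC_loc[OF primitive_integral[of "\<lambda>_. 0" h]] by (simp add: L1_loc_continuous)
  then show ac: "AC_loc (\<lambda>t. v t *v h)"
    using v absolutely_continuous_bilinear[OF bounded_bilinear_matrix_vector_mult, of 0 _ v "\<lambda>_. h"]
    unfolding AC_loc_def matrix_solution_def by blast
  have "continuous_on {0..} (\<lambda>t. v t *v h)"
    by (rule continuous_on_halfline) (use ac in \<open>auto simp: AC_loc_def intro: absolutely_continuous_on_continuous\<close>)
  then show "L1_loc (\<lambda>t. l *s (v t *v h))"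
    by (intro L1_loc_continuous bounded_linear.continuous_on[OF bounded_linear_vector_scalar_mult])
  show "AE x in halfline. dirac_expr Q (\<lambda>t. v t *v h) x = l *s (v x *v h)"
    using v[unfolded matrix_solution_def, THEN conjunct2]
  proof eventually_elim
    case (elim x)
    then obtain v' where v': "(v has_vector_derivative v') (at x)" "J ** v' + Q x ** v x = mat l ** v x" by blast
    have "((\<lambda>t. v t *v h) has_vector_derivative v' *v h) (at x)"
      by (rule bounded_linear.has_vector_derivative[OF mv_bounded_linear_left v'(1)])
    then have "dirac_expr Q (\<lambda>t. v t *v h) x = J *v (v' *v h) + Q x *v (v x *v h)"
      by (simp add: dirac_expr_def vector_derivative_at)
    also have "\<dots> = (J ** v' + Q x ** v x) *v h"
      by (simp add: matrix_vector_mul_assoc mv_add_left)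
    also have "\<dots> = l *s (v x *v h)" by (simp add: v'(2) matrix_vector_mul_assoc[symmetric] mat_mult_vector)
    finally show ?case .
  qed
qed

context lagrangian
begin

text \<open>Take any element of the maximal domain with the prescribed boundary value and subtract the
resolvent of its defect, which satisfies the homogeneous boundary condition. The initial value
\<open>(C k, S k)\<close> has the boundary value \<open>k\<close> because \<open>C\<^sup>2 + S\<^sup>2 = 1\<close>.\<close>

lemma resolvent_solution_exists:
  assumes Q: "L1_loc Q" and l: "l \<in> resolvent_set (boundary_op Q boundary)"
  obtains v where "solves Q v (\<lambda>t. l *s v t)" "square_integrable v" "C *v upper (v 0) + S *v lower (v 0) = k"
proof -
  obtain R where R: "{(g - scaleC_L2 l f, f) |f g. (f, g) \<in> boundary_op Q boundary} = {(h, R h) |h. True}"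
    using l unfolding resolvent_set_def by blast
  obtain y g where y: "solves Q y g" "square_integrable y" "square_integrable g" "y 0 = join (C *v k) (S *v k)"
    by (rule initial_value_attained[OF Q])
  have sy: "square_integrable (\<lambda>x. l *s y x)" by (rule square_integrable_scale[OF y(2)])
  define h where "h = L2_class (\<lambda>x. g x - l *s y x)"
  have "(h, R h) \<in> {(g - scaleC_L2 l f, f) |f g. (f, g) \<in> boundary_op Q boundary}" unfolding R by blast
  then obtain F G where F: "(F, G) \<in> boundary_op Q boundary" "h = G - scaleC_L2 l F" by blast
  obtain u w where u: "F = L2_class u" "G = L2_class w" "solves Q u w" "square_integrable u" "square_integrable w" "u 0 \<in> boundary"
    by (rule boundary_opE[OF F(1)])
  have su: "square_integrable (\<lambda>x. l *s u x)" by (rule square_integrable_scale[OF u(4)])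
  have "L2_class (\<lambda>x. g x - l *s y x) = L2_class (\<lambda>x. w x - l *s u x)"
    using F(2) unfolding h_def u by (simp add: L2_class_scale[OF u(4)] L2_class_diff[OF u(5) su])
  then have "AE x in halfline. g x - l *s y x = w x - l *s u x"
    by (simp add: L2_class_eq_iff square_integrable_diff y sy u su)
  then have ae: "AE x in halfline. l *s (y x - u x) = g x - w x"
    by eventually_elim (simp add: algebra_simps vec_eq_iff)
  have "solves Q (\<lambda>x. y x - u x) (\<lambda>x. l *s (y x - u x))"
    by (rule solves_cong_AE[OF solves_diff[OF y(1) u(3)] ae])
  moreover have "square_integrable (\<lambda>x. y x - u x)" by (rule square_integrable_diff[OF y(2) u(4)])
  moreover have "C *v upper (y 0 - u 0) + S *v lower (y 0 - u 0) = k"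
  proof -
    have "C *v upper (y 0 - u 0) + S *v lower (y 0 - u 0)
        = (C *v upper (y 0) + S *v lower (y 0)) - (C *v upper (u 0) + S *v lower (u 0))"
      by (simp add: upper_lower_simps mv_diff)
    then show ?thesis using u(6) by (simp add: boundary_def y(4) upper_join lower_join pyth)
  qed
  ultimately show ?thesis by (rule that)
qed

text \<open>Such a \<open>y\<close> is an eigenfunction for a point of the resolvent set.\<close>

lemma resolvent_solution_unique:
  assumes Q: "L1_loc Q" and l: "l \<in> resolvent_set (boundary_op Q boundary)"
    and y: "solves Q y (\<lambda>t. l *s y t)" "square_integrable y" "y 0 \<in> boundary" and t: "t \<ge> 0"
  shows "y t = 0"
proof -
  obtain R where R: "bounded_linear R"
    "{(g - scaleC_L2 l f, f) |f g. (f, g) \<in> boundary_op Q boundary} = {(h, R h) |h. True}"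
    using l unfolding resolvent_set_def by blast
  have "(L2_class y, L2_class (\<lambda>t. l *s y t)) \<in> boundary_op Q boundary"
    by (intro boundary_opI y square_integrable_scale)
  then have "(L2_class (\<lambda>t. l *s y t) - scaleC_L2 l (L2_class y), L2_class y) \<in> {(h, R h) |h. True}"
    unfolding R(2)[symmetric] by blast
  then have "L2_class y = R 0" by (simp add: L2_class_scale y)
  then have "L2_class y = L2_class (\<lambda>x. 0)" using linear_0[OF bounded_linear.linear[OF R(1)]] by (simp add: L2_class_zero)
  then have "AE x in halfline. y x = 0" by (simp add: L2_class_eq_iff y square_integrable_zero)
  then show ?thesis
    by (intro continuous_eq_of_AE_eq[of y "\<lambda>_. 0"] solves_continuous[OF y(1)] t continuous_on_const)
qed

lemma resolvent_matrix_solution: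
  assumes Q: "L1_loc Q" and l: "l \<in> resolvent_set (boundary_op Q boundary)"
  defines "P \<equiv> \<lambda>v :: real \<Rightarrow> complex ^ 'p ^ ('p + 'p). matrix_solution Q l v
     \<and> (\<forall>h. square_integrable (\<lambda>t. v t *v h)) \<and> C ** upper (v 0) + S ** lower (v 0) = mat 1"
  shows "\<exists>v. P v \<and> (\<forall>w. P w \<longrightarrow> (\<forall>t\<ge>0. w t = v t))"
proof -
  have "\<forall>j::'p. \<exists>v. solves Q v (\<lambda>t. l *s v t) \<and> square_integrable v \<and> C *v upper (v 0) + S *v lower (v 0) = axis j 1"
    using resolvent_solution_exists[OF Q l] by metis
  then obtain u where u: "\<And>j::'p. solves Q (u j) (\<lambda>t. l *s u j t)" "\<And>j. square_integrable (u j)"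
    "\<And>j. C *v upper (u j 0) + S *v lower (u j 0) = axis j 1" by metis
  define v where "v t = from_columns (\<lambda>j. u j t)" for t
  have bc_mult: "(C ** upper A + S ** lower A) *v h = C *v upper (A *v h) + S *v lower (A *v h)"
    for A :: "complex ^ 'p ^ ('p + 'p)" and h
    by (simp add: mv_add_left matrix_vector_mul_assoc[symmetric]
        upper_lower_matrix_mult)
  have "P v"
    unfolding P_def
  proof (intro conjI allI)
    define v' where "v' t = from_columns (\<lambda>j. J *v (Q t *v u j t - l *s u j t))" for t
    have prim: "primitive v v'"
      unfolding v_def[abs_def] v'_def[abs_def]
      by (rule primitive_from_columns) (rule u(1)[unfolded solves_def])
    have alg: "J ** v' t + Q t ** v t = mat l ** v t" for t
      unfolding matrix_eq
    proof
      fix h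
      have "v' t *v h = J *v (Q t *v (v t *v h) - l *s (v t *v h))"
        unfolding v_def v'_def from_columns_mult
        by (simp add: mv_sum mv_diff mv_scale
            sum_subtractf vec.scale_sum_right vector_ssub_ldistrib mult.commute)
      then have "J *v (v' t *v h) + Q t *v (v t *v h) = l *s (v t *v h)" by (simp add: J_J)
      then show "(J ** v' t + Q t ** v t) *v h = (mat l ** v t) *v h"
        by (simp add: mv_add_left
            matrix_vector_mul_assoc[symmetric] mat_mult_vector)
    qed
    show "matrix_solution Q l v"
      unfolding matrix_solution_def
    proof
      show "AC_loc v" by (rule primitive_AC_loc[OF prim])
      show "AE x in halfline. \<exists>v'. (v has_vector_derivative v') (at x) \<and> J ** v' + Q x ** v x = mat l ** v x"
        using primitive_AE_derivative[OF prim] by (rule eventually_mono) (use alg in blast)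
    qed
    show "square_integrable (\<lambda>t. v t *v h)" for h
    proof -
      have "square_integrable (\<lambda>t. \<Sum>j\<in>A. h $ j *s u j t)" if "finite A" for A
        using that by (induction A rule: finite_induct)
          (simp_all add: square_integrable_zero square_integrable_add square_integrable_scale u)
      then show ?thesis by (simp add: v_def from_columns_mult)
    qed
    show "C ** upper (v 0) + S ** lower (v 0) = mat 1"
      unfolding matrix_eq bc_mult
    proof
      fix h
      have b: "C *v upper (\<Sum>j\<in>A. h $ j *s u j 0) + S *v lower (\<Sum>j\<in>A. h $ j *s u j 0) = (\<Sum>j\<in>A. h $ j *s axis j 1)"
        if "finite A" for A
        using that
      proof (induction A rule: finite_induct)
        case (insert i A)
        have "C *v upper (h $ i *s u i 0) + S *v lower (h $ i *s u i 0) = h $ i *s (C *v upper (u i 0) + S *v lower (u i 0))"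
          by (simp add: upper_lower_simps mv_scale vector_add_ldistrib)
        then have i: "C *v upper (h $ i *s u i 0) + S *v lower (h $ i *s u i 0) = h $ i *s axis i 1" by (simp only: u(3))
        have "C *v upper (\<Sum>j\<in>insert i A. h $ j *s u j 0) + S *v lower (\<Sum>j\<in>insert i A. h $ j *s u j 0)
          = (C *v upper (h $ i *s u i 0) + S *v lower (h $ i *s u i 0))
            + (C *v upper (\<Sum>j\<in>A. h $ j *s u j 0) + S *v lower (\<Sum>j\<in>A. h $ j *s u j 0))"
          using insert.hyps by (simp add: upper_lower_simps(1,2) mv_add)
        then show ?case unfolding i insert.IH using insert.hyps by simp
      qed (simp add: upper_lower_simps mv_zero)
      have "C *v upper (v 0 *v h) + S *v lower (v 0 *v h) = (\<Sum>j\<in>UNIV. h $ j *s axis j 1)"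
        unfolding v_def from_columns_mult by (rule b) simp
      then show "C *v upper (v 0 *v h) + S *v lower (v 0 *v h) = mat 1 *v h"
        by (simp add: basis_expansion)
    qed
  qed
  moreover have "w t = v t" if w: "P w" and t: "t \<ge> 0" for w t
    unfolding matrix_eq
  proof
    fix h
    have wv: "matrix_solution Q l w" "square_integrable (\<lambda>t. w t *v h)" "C ** upper (w 0) + S ** lower (w 0) = mat 1"
      "matrix_solution Q l v" "square_integrable (\<lambda>t. v t *v h)" "C ** upper (v 0) + S ** lower (v 0) = mat 1"
      using w \<open>P v\<close> by (auto simp: P_def)
    have "w t *v h - v t *v h = 0"
    proof (rule resolvent_solution_unique[OF Q l _ _ _ t, of "\<lambda>t. w t *v h - v t *v h"])
      have "l *s a - l *s b = l *s (a - b)" for a b :: "complex ^ ('p + 'p)" by (simp add: vector_ssub_ldistrib)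
      then show "solves Q (\<lambda>t. w t *v h - v t *v h) (\<lambda>t. l *s (w t *v h - v t *v h))"
        using solves_diff[OF matrix_solution_mult[OF Q wv(1)] matrix_solution_mult[OF Q wv(4)], of h h] by simp
      show "square_integrable (\<lambda>t. w t *v h - v t *v h)" by (rule square_integrable_diff[OF wv(2,5)])
      have "C *v upper (w 0 *v h) + S *v lower (w 0 *v h) = h" "C *v upper (v 0 *v h) + S *v lower (v 0 *v h) = h"
        unfolding bc_mult[symmetric] wv(3,6) by simp_all
      moreover have "C *v upper (w 0 *v h - v 0 *v h) + S *v lower (w 0 *v h - v 0 *v h)
          = (C *v upper (w 0 *v h) + S *v lower (w 0 *v h)) - (C *v upper (v 0 *v h) + S *v lower (v 0 *v h))"
        by (simp add: upper_lower_simps mv_diff)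
      ultimately show "w 0 *v h - v 0 *v h \<in> boundary" by (simp add: boundary_def)
    qed
    then show "w t *v h = v t *v h" by simp
  qed
  ultimately show ?thesis by blast
qed

end

section \<open>Hermitian matrices\<close>

text \<open>A minimiser of the quadratic form on the unit sphere of \<open>V\<close> is an eigenvector, as the first
variation vanishes there.\<close>

lemma symmetric_minimal_eigenvector:
  fixes f :: "'a::euclidean_space \<Rightarrow> 'a"
  assumes f: "linear f" and sym: "\<And>u v. f u \<bullet> v = u \<bullet> f v"
    and V: "subspace V" "\<And>v. v \<in> V \<Longrightarrow> f v \<in> V" "V \<noteq> {0}"
  obtains v m where "v \<in> V" "norm v = 1" "f v = m *\<^sub>R v" "\<And>u. u \<in> V \<Longrightarrow> m * (u \<bullet> u) \<le> f u \<bullet> u"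
proof -
  have cont: "continuous_on UNIV f" using f by (simp add: linear_continuous_on linear_conv_bounded_linear)
  obtain w where w: "w \<in> V" "w \<noteq> 0" using V(1,3) subspace_0 by blast
  then have "(1 / norm w) *\<^sub>R w \<in> sphere 0 1 \<inter> V" using V(1) by (simp add: subspace_scale)
  moreover have "compact (sphere 0 1 \<inter> V)" using closed_subspace[OF V(1)] by (intro compact_Int_closed) auto
  moreover have "continuous_on (sphere 0 1 \<inter> V) (\<lambda>u. f u \<bullet> u)"
    by (intro continuous_intros continuous_on_subset[OF cont]) auto
  ultimately obtain v where v: "v \<in> V" "norm v = 1" "\<And>u. u \<in> V \<Longrightarrow> norm u = 1 \<Longrightarrow> f v \<bullet> v \<le> f u \<bullet> u"
    using continuous_attains_inf[of "sphere 0 1 \<inter> V" "\<lambda>u. f u \<bullet> u"] by fastforce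
  define m where "m = f v \<bullet> v"
  have min: "m * (u \<bullet> u) \<le> f u \<bullet> u" if u: "u \<in> V" for u
  proof (cases "u = 0")
    case False
    then have "m \<le> f ((1 / norm u) *\<^sub>R u) \<bullet> ((1 / norm u) *\<^sub>R u)"
      unfolding m_def by (intro v(3)) (use u V(1) in \<open>auto simp: subspace_scale\<close>)
    also have "\<dots> = (f u \<bullet> u) / (u \<bullet> u)"
      using False by (simp add: linear_scale[OF f] dot_square_norm power2_eq_square)
    finally show ?thesis using False by (simp add: pos_le_divide_eq)
  qed (simp add: linear_0[OF f])
  define w' where "w' = f v - m *\<^sub>R v"
  have w'V: "w' \<in> V" unfolding w'_def using v V by (intro subspace_diff subspace_scale) auto
  have "w' = 0"
  proof (rule ccontr)
    assume "w' \<noteq> 0"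
    define c where "c = w' \<bullet> w'"
    have c: "c > 0" using \<open>w' \<noteq> 0\<close> by (simp add: c_def)
    define k where "k = f w' \<bullet> w' - m * c"
    \<comment> \<open>The form of \<open>f - m\<close> is nonnegative on \<open>V\<close> and vanishes at \<open>v\<close>. Expanded along the residual
      \<open>w'\<close>, its linear term is \<open>2 t c\<close>, which is negative and dominant for small negative \<open>t\<close>.\<close>
    have exp: "0 \<le> 2 * t * c + t\<^sup>2 * k" for t
    proof -
      have "v + t *\<^sub>R w' \<in> V" using v(1) w'V V(1) by (intro subspace_add subspace_scale)
      from min[OF this] have "m * ((v + t *\<^sub>R w') \<bullet> (v + t *\<^sub>R w')) \<le> f (v + t *\<^sub>R w') \<bullet> (v + t *\<^sub>R w')" .
      also have "f (v + t *\<^sub>R w') \<bullet> (v + t *\<^sub>R w') = m + 2 * t * (f v \<bullet> w') + t\<^sup>2 * (f w' \<bullet> w')"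
        using sym[of w' v] by (simp add: linear_add[OF f] linear_scale[OF f] inner_add_left inner_add_right
            m_def power2_eq_square inner_commute algebra_simps)
      also have "(v + t *\<^sub>R w') \<bullet> (v + t *\<^sub>R w') = 1 + 2 * t * (v \<bullet> w') + t\<^sup>2 * c"
        using v(2) by (simp add: inner_add_left inner_add_right c_def power2_eq_square inner_commute algebra_simps
            norm_eq_1)
      finally have "0 \<le> 2 * t * (f v \<bullet> w' - m * (v \<bullet> w')) + t\<^sup>2 * k"
        by (simp add: k_def algebra_simps)
      moreover have "f v \<bullet> w' - m * (v \<bullet> w') = c"
        by (simp add: c_def w'_def inner_diff_left inner_diff_right algebra_simps)
      ultimately show ?thesis by simp
    qed
    define k' where "k' = \<bar>k\<bar> + 1"
    have k': "k' > 0" "k \<le> k'" by (auto simp: k'_def)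
    define t where "t = - c / k'"
    have "2 * t * c + t\<^sup>2 * k \<le> 2 * t * c + t\<^sup>2 * k'" using k' by (intro add_left_mono mult_left_mono) auto
    also have "\<dots> = - (c\<^sup>2 / k')" using k' by (simp add: t_def power2_eq_square field_simps)
    also have "\<dots> < 0" using c k' by simp
    finally show False using exp[of t] by simp
  qed
  then have "f v = m *\<^sub>R v" by (simp add: w'_def)
  then show ?thesis using that v(1,2) min by blast
qed

text \<open>The orthogonal complement of all eigenvectors is invariant; if it were not zero, it would contain
an eigenvector.\<close>

lemma span_eigenvectors_symmetric:
  fixes f :: "'a::euclidean_space \<Rightarrow> 'a"
  assumes f: "linear f" and sym: "\<And>u v. f u \<bullet> v = u \<bullet> f v"
  shows "span {v. \<exists>m. f v = m *\<^sub>R v} = UNIV"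
proof -
  let ?E = "{v. \<exists>m. f v = m *\<^sub>R v}"
  define W where "W = {w. \<forall>e\<in>?E. w \<bullet> e = 0}"
  have "subspace W" by (auto simp: subspace_def W_def inner_add_left)
  moreover have "f w \<in> W" if "w \<in> W" for w
    using that by (auto simp: W_def sym)
  moreover have False if "v \<in> W" "norm v = 1" "f v = m *\<^sub>R v" for v m
    using that by (auto simp: W_def norm_eq_1)
  ultimately have W: "W = {0}"
    using symmetric_minimal_eigenvector[OF f sym, of W] by metis
  show ?thesis
  proof (intro equalityI subsetI UNIV_I)
    fix x
    obtain y z where yz: "y \<in> span ?E" "\<And>w. w \<in> span ?E \<Longrightarrow> orthogonal z w" "x = y + z"
      by (rule orthogonal_subspace_decomp_exists[of ?E x]) (rule that, assumption+)
    have "z \<in> W" unfolding W_def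
    proof (intro CollectI ballI)
      fix e assume "e \<in> ?E"
      then show "z \<bullet> e = 0" using yz(2)[OF span_base] by (simp only: orthogonal_def)
    qed
    then show "x \<in> span ?E" using W yz by simp
  qed
qed

lemma hermitian_symmetric: "ctranspose H = H \<Longrightarrow> (H *v u) \<bullet> v = u \<bullet> (H *v v)"
  using cdot_ctranspose[of H u v] by (simp flip: Re_cdot)

text \<open>Real eigenvalues and the real span suffice, because a Hermitian matrix is symmetric for the real
inner product.\<close>

definition eigenvectors :: "complex ^ 'n ^ 'n \<Rightarrow> (complex ^ 'n) set" where
  "eigenvectors H = {v. \<exists>m::real. H *v v = m *\<^sub>R v}"

lemma span_eigenvectors: "ctranspose H = H \<Longrightarrow> span (eigenvectors H) = UNIV"
  unfolding eigenvectors_def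
  by (intro span_eigenvectors_symmetric hermitian_symmetric) (simp add: linear_conv_bounded_linear mv_bounded_linear)

lemma hermitian_matrix_eqI:
  assumes "ctranspose H = H" "\<And>v. v \<in> eigenvectors H \<Longrightarrow> A *v v = B *v v"
  shows "A = B"
  unfolding matrix_eq
proof
  fix x
  have "x \<in> span (eigenvectors H)" using span_eigenvectors[OF assms(1)] by simp
  then show "A *v x = B *v x"
    by (rule linear_eq_on_span[rotated 3]) (use assms(2) in \<open>auto simp: linear_conv_bounded_linear mv_bounded_linear\<close>)
qed

lemma matrix_power_eigenvector:
  assumes "H *v v = m *\<^sub>R v"
  shows "matrix_power H k *v v = m ^ k *\<^sub>R v"
proof (induction k)
  case (Suc k)
  have "matrix_power H (Suc k) *v v = H *v (matrix_power H k *v v)"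
    by (simp add: matrix_power_def matrix_vector_mul_assoc)
  then show ?case
    by (simp add: Suc assms mv_scaleR mult.commute)
qed (simp add: matrix_power_def)

text \<open>Convergence of the matrix series can be tested on the spanning set of eigenvectors, where it is a
scalar power series.\<close>

lemma matrix_power_series_eigenvector:
  assumes H: "ctranspose H = H" and a: "\<And>m::real. summable (\<lambda>k. a k * m ^ k)" and v: "H *v v = m *\<^sub>R v"
  shows "(\<Sum>k. a k *\<^sub>R matrix_power H k) *v v = (\<Sum>k. a k * m ^ k) *\<^sub>R v"
proof -
  let ?X = "\<lambda>k. a k *\<^sub>R matrix_power H k"
  have X: "?X k *v w = (a k * c ^ k) *\<^sub>R w" if "H *v w = c *\<^sub>R w" for k c w
    by (simp add: mv_scaleR_left matrix_power_eigenvector[OF that])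
  have "span (eigenvectors H) \<subseteq> {w. summable (\<lambda>k. ?X k *v w)}"
  proof (rule span_minimal)
    show "eigenvectors H \<subseteq> {w. summable (\<lambda>k. ?X k *v w)}"
      unfolding eigenvectors_def
    proof clarify
      fix w c assume w: "H *v w = c *\<^sub>R w"
      show "summable (\<lambda>k. ?X k *v w)"
        unfolding X[OF w] by (intro bounded_linear.summable[OF bounded_linear_scaleR_left] a)
    qed
    show "subspace {w. summable (\<lambda>k. ?X k *v w)}"
      by (auto simp: subspace_def mv_zero mv_add mv_scaleR
          intro: summable_add summable_scaleR_right)
  qed
  then have s: "summable (\<lambda>k. ?X k *v w)" for w unfolding span_eigenvectors[OF H] by blast
  have e: "?X k = (\<Sum>j\<in>UNIV. from_columns (\<lambda>i. if i = j then ?X k *v axis j 1 else 0))" for k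
  proof -
    have "?X k = from_columns (\<lambda>j. ?X k *v axis j 1)"
      by (rule from_columns_axis[symmetric])
    also have "\<dots> = (\<Sum>j\<in>UNIV. from_columns (\<lambda>i. if i = j then ?X k *v axis j 1 else 0))" by (rule from_columns_eq_sum)
    finally show ?thesis .
  qed
  have "summable (\<lambda>k. \<Sum>j\<in>UNIV. from_columns (\<lambda>i. if i = j then ?X k *v axis j 1 else 0))"
    by (intro summable_sum bounded_linear.summable[OF bounded_linear_single_column s])
  then have "summable ?X" by (simp only: e[symmetric])
  then have "(\<Sum>k. ?X k) *v v = (\<Sum>k. ?X k *v v)"
    by (rule bounded_linear.suminf[OF mv_bounded_linear_left])
  also have "\<dots> = (\<Sum>k. a k * m ^ k) *\<^sub>R v"
    unfolding X[OF v] by (rule bounded_linear.suminf[OF bounded_linear_scaleR_left a, symmetric])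
  finally show ?thesis .
qed

lemma cos_sin_matrix_eigenvector:
  assumes "ctranspose H = H" "H *v v = m *\<^sub>R v"
  shows "cos_matrix H *v v = cos m *\<^sub>R v" "sin_matrix H *v v = sin m *\<^sub>R v"
proof -
  have "summable (\<lambda>k. cos_coeff k * c ^ k)" "summable (\<lambda>k. sin_coeff k * c ^ k)" for c :: real
    using summable_norm_cancel[OF summable_norm_cos[of c]] summable_norm_cancel[OF summable_norm_sin[of c]] by simp_all
  note s = this
  show "cos_matrix H *v v = cos m *\<^sub>R v"
    unfolding cos_matrix_def matrix_power_series_eigenvector[OF assms(1) s(1) assms(2)] by (simp add: cos_def)
  show "sin_matrix H *v v = sin m *\<^sub>R v"
    unfolding sin_matrix_def matrix_power_series_eigenvector[OF assms(1) s(2) assms(2)] by (simp add: sin_def)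
qed

text \<open>Symmetry need only be checked on eigenvectors of \<open>H\<close>; those of different eigenvalues are
orthogonal.\<close>

lemma hermitian_function_of_hermitian:
  assumes H: "ctranspose H = H" and F: "\<And>v m. H *v v = m *\<^sub>R v \<Longrightarrow> F *v v = \<phi> m *\<^sub>R v"
  shows "ctranspose F = F"
proof -
  have e: "(F *v u) \<bullet> w = u \<bullet> (F *v w)" if u: "u \<in> eigenvectors H" and w: "w \<in> eigenvectors H" for u w
  proof -
    obtain m n where mn: "H *v u = m *\<^sub>R u" "H *v w = n *\<^sub>R w" using u w by (auto simp: eigenvectors_def)
    have "m * (u \<bullet> w) = n * (u \<bullet> w)" using hermitian_symmetric[OF H, of u w] by (simp add: mn)
    then show ?thesis using F[OF mn(1)] F[OF mn(2)] by auto
  qed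
  note lin = mv_add mv_scaleR mv_zero inner_add_left inner_add_right
  have "span (eigenvectors H) \<subseteq> {u. (F *v u) \<bullet> w = u \<bullet> (F *v w)}" if "w \<in> eigenvectors H" for w
    by (rule span_minimal) (use e that in \<open>auto simp: subspace_def lin\<close>)
  then have e2: "(F *v u) \<bullet> w = u \<bullet> (F *v w)" if "w \<in> eigenvectors H" for u w
    unfolding span_eigenvectors[OF H] using that by blast
  have "span (eigenvectors H) \<subseteq> {w. (F *v u) \<bullet> w = u \<bullet> (F *v w)}" for u
    by (rule span_minimal) (use e2 in \<open>auto simp: subspace_def lin\<close>)
  then have e3: "(F *v u) \<bullet> w = u \<bullet> (F *v w)" for u w
    unfolding span_eigenvectors[OF H] by blast
  have "u \<bullet> (ctranspose F *v w) = u \<bullet> (F *v w)" for u w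
    using e3[of u w] cdot_ctranspose[of F u w] by (simp flip: Re_cdot)
  then have "ctranspose F *v w = F *v w" for w by (metis vector_eq_ldot)
  then show ?thesis unfolding matrix_eq by blast
qed

lemma lagrangian_cos_sin:
  assumes H: "ctranspose H = H"
  shows "lagrangian (cos_matrix H) (sin_matrix H)"
proof
  note ev = cos_sin_matrix_eigenvector[OF H]
  show "ctranspose (cos_matrix H) = cos_matrix H" "ctranspose (sin_matrix H) = sin_matrix H"
    by (rule hermitian_function_of_hermitian[OF H ev(1)], assumption, rule hermitian_function_of_hermitian[OF H ev(2)], assumption)
  show "cos_matrix H ** sin_matrix H = sin_matrix H ** cos_matrix H"
  proof (rule hermitian_matrix_eqI[OF H])
    fix v assume "v \<in> eigenvectors H"
    then obtain m where m: "H *v v = m *\<^sub>R v" by (auto simp: eigenvectors_def)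
    show "(cos_matrix H ** sin_matrix H) *v v = (sin_matrix H ** cos_matrix H) *v v"
      by (simp add: matrix_vector_mul_assoc[symmetric] ev[OF m] mv_scaleR mult.commute)
  qed
  show "cos_matrix H ** cos_matrix H + sin_matrix H ** sin_matrix H = mat 1"
  proof (rule hermitian_matrix_eqI[OF H])
    fix v assume "v \<in> eigenvectors H"
    then obtain m where m: "H *v v = m *\<^sub>R v" by (auto simp: eigenvectors_def)
    have "(cos m * cos m) *\<^sub>R v + (sin m * sin m) *\<^sub>R v = v"
      using sin_cos_squared_add2[of m] by (simp add: scaleR_add_left[symmetric] power2_eq_square)
    then show "(cos_matrix H ** cos_matrix H + sin_matrix H ** sin_matrix H) *v v = mat 1 *v v"
      by (simp add: mv_add_left
          matrix_vector_mul_assoc[symmetric] ev[OF m] mv_scaleR)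
  qed
qed

lemma ctranspose_Im_matrix: "ctranspose (Im_matrix A) = Im_matrix A"
proof -
  have eq: "Im_matrix A $ i $ j = (A $ i $ j - cnj (A $ j $ i)) / (2 * \<i>)" for i j and A :: "complex ^ 'n ^ 'n"
    by (simp add: Im_matrix_def matrix_matrix_mult_def mat_def ctranspose_def if_distrib[where f = "\<lambda>x. x * _"] cong: if_cong)
  have "cnj ((a - cnj b) / (2 * \<i>)) = (b - cnj a) / (2 * \<i>)" for a b
    by (simp add: field_simps)
  then show ?thesis by (simp add: ctranspose_def vec_eq_iff eq)
qed

lemma inner_Im_matrix: "(Im_matrix A *v u) \<bullet> u = Im (cdot (A *v u) u)"
proof -
  have eq: "Im_matrix A *v u = (1 / (2 * \<i>)) *s (A *v u - ctranspose A *v u)"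
    by (simp add: Im_matrix_def matrix_vector_mul_assoc[symmetric] mat_mult_vector
        mv_diff_left)
  have c: "cdot (ctranspose A *v u) u = cnj (cdot (A *v u) u)"
    using cdot_commute[of "ctranspose A *v u" u] by (simp add: cdot_ctranspose[of A])
  have "cdot (Im_matrix A *v u) u = (1 / (2 * \<i>)) * (cdot (A *v u) u - cnj (cdot (A *v u) u))"
    unfolding eq cdot_scale_left cdot_diff_left c ..
  also have "\<dots> = of_real (Im (cdot (A *v u) u))" by (simp add: complex_eq_iff)
  finally show ?thesis by (simp flip: Re_cdot)
qed

lemma Re_eigenvalues_hermitian:
  assumes H: "ctranspose H = H"
  shows "Re ` eigenvalues H = {m. \<exists>v. v \<noteq> 0 \<and> H *v v = m *\<^sub>R v}"
proof -
  have real: "Re l *\<^sub>R v = l *s v" if v: "v \<noteq> 0" "H *v v = l *s v" for l v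
  proof -
    have "cdot (H *v v) v = cnj (cdot (H *v v) v)"
      using cdot_commute[of "H *v v" v] by (simp add: cdot_ctranspose[of H] H)
    then have "l * of_real ((norm v)\<^sup>2) = cnj l * of_real ((norm v)\<^sup>2)"
      unfolding v(2) cdot_scale_left cdot_self by simp
    then have "l = cnj l" using v(1) by simp
    then have "l = of_real (Re l)" by (metis Reals_cnj_iff of_real_Re)
    then show ?thesis using scale_of_real[of "Re l" v] by simp
  qed
  show ?thesis
  proof (intro equalityI subsetI)
    fix m assume "m \<in> Re ` eigenvalues H"
    then obtain l v where v: "m = Re l" "v \<noteq> 0" "H *v v = l *s v" unfolding eigenvalues_def by blast
    then show "m \<in> {m. \<exists>v. v \<noteq> 0 \<and> H *v v = m *\<^sub>R v}"
      using real[OF v(2,3)] by (intro CollectI exI[of _ v]) simp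
  next
    fix m assume "m \<in> {m. \<exists>v. v \<noteq> 0 \<and> H *v v = m *\<^sub>R v}"
    then obtain v where "v \<noteq> 0" "H *v v = m *\<^sub>R v" by blast
    then have "of_real m \<in> eigenvalues H" unfolding eigenvalues_def scale_of_real[symmetric] by blast
    then show "m \<in> Re ` eigenvalues H" by (rule rev_image_eqI) simp
  qed
qed

text \<open>Eigenvectors of different eigenvalues form a pairwise orthogonal family of nonzero vectors.\<close>

lemma finite_Re_eigenvalues_hermitian:
  assumes H: "ctranspose H = H"
  shows "finite (Re ` eigenvalues H)"
proof -
  let ?R = "Re ` eigenvalues H"
  have "\<forall>m\<in>?R. \<exists>v. v \<noteq> 0 \<and> H *v v = m *\<^sub>R v" unfolding Re_eigenvalues_hermitian[OF H] by blast
  then obtain e where e: "\<And>m. m \<in> ?R \<Longrightarrow> e m \<noteq> 0 \<and> H *v e m = m *\<^sub>R e m" by metis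
  have ort: "e m \<bullet> e n = 0" if "m \<in> ?R" "n \<in> ?R" "m \<noteq> n" for m n
    using hermitian_symmetric[OF H, of "e m" "e n"] e[OF that(1)] e[OF that(2)] that(3) by simp
  have inj: "inj_on e ?R"
    using ort e by (intro inj_onI) (metis inner_eq_zero_iff)
  have "pairwise orthogonal (e ` ?R)"
    by (auto simp: pairwise_def orthogonal_def intro!: ort)
  then have "finite (e ` ?R)" by (rule pairwise_orthogonal_imp_finite)
  then show ?thesis using inj by (simp add: finite_image_iff)
qed

lemma smallest_eigenvalue_hermitian:
  assumes H: "ctranspose H = H"
  obtains v where "norm v = 1" "H *v v = smallest_eigenvalue H *\<^sub>R v"
    "\<And>u. smallest_eigenvalue H * (norm u)\<^sup>2 \<le> (H *v u) \<bullet> u"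
proof -
  have lin: "linear ((*v) H)" by (simp add: linear_conv_bounded_linear mv_bounded_linear)
  have "(UNIV :: (complex ^ 'n) set) \<noteq> {0}"
    using UNIV_I[of "axis undefined 1 :: complex ^ 'n"] by (metis axis_eq_0_iff singletonD zero_neq_one)
  then obtain v m where v: "norm v = 1" "H *v v = m *\<^sub>R v" "\<And>u. m * (u \<bullet> u) \<le> (H *v u) \<bullet> u"
    using symmetric_minimal_eigenvector[OF lin hermitian_symmetric[OF H] subspace_UNIV] by (metis UNIV_I)
  have "smallest_eigenvalue H = m"
    unfolding smallest_eigenvalue_def
  proof (rule Min_eqI[OF finite_Re_eigenvalues_hermitian[OF H]])
    show "m \<in> Re ` eigenvalues H"
      unfolding Re_eigenvalues_hermitian[OF H] using v(1,2) by (intro CollectI exI[of _ v]) auto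
    fix k assume "k \<in> Re ` eigenvalues H"
    then obtain w where w: "w \<noteq> 0" "H *v w = k *\<^sub>R w" unfolding Re_eigenvalues_hermitian[OF H] by blast
    then show "m \<le> k" using v(3)[of w] by simp
  qed
  then show ?thesis using that[of v] v by (simp add: dot_square_norm)
qed

lemma largest_eigenvalue_eq_smallest_uminus:
  assumes H: "ctranspose H = H"
  shows "largest_eigenvalue H = - smallest_eigenvalue (- H)"
proof -
  have H': "ctranspose (- H) = - H" using H by (simp add: ctranspose_def vec_eq_iff)
  have "(- H) *v v = m *\<^sub>R v \<longleftrightarrow> H *v v = (- m) *\<^sub>R v" for v m
    by (simp add: mv_minus_left) (metis add.inverse_inverse)
  then have eq: "Re ` eigenvalues (- H) = uminus ` (Re ` eigenvalues H)"
    unfolding Re_eigenvalues_hermitian[OF H] Re_eigenvalues_hermitian[OF H'] by (force simp: image_iff intro: exI[of _ "- _"])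
  obtain v where "norm v = 1" "H *v v = smallest_eigenvalue H *\<^sub>R v"
    by (rule smallest_eigenvalue_hermitian[OF H])
  then have "smallest_eigenvalue H \<in> Re ` eigenvalues H"
    unfolding Re_eigenvalues_hermitian[OF H] by (intro CollectI exI[of _ v]) auto
  then have "Re ` eigenvalues H \<noteq> {}" by blast
  from minus_Max_eq_Min[OF finite_Re_eigenvalues_hermitian[OF H] this] show ?thesis
    unfolding largest_eigenvalue_def smallest_eigenvalue_def eq by simp
qed

section \<open>The essential bounds of the imaginary part\<close>

text \<open>The minimum over the unit sphere of the imaginary part of the form of \<open>A\<close>, by the first lemma
below. Working with minima only, the upper bound is reached through \<open>-A\<close>.\<close>

definition Im_min :: "complex ^ 'n ^ 'n \<Rightarrow> real" where
  "Im_min A = smallest_eigenvalue (Im_matrix A)"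

lemma Im_min:
  obtains v where "norm v = 1" "Im (cdot (A *v v) v) = Im_min A"
    "\<And>u. Im_min A * (norm u)\<^sup>2 \<le> Im (cdot (A *v u) u)"
proof -
  obtain v where v: "norm v = 1" "Im_matrix A *v v = smallest_eigenvalue (Im_matrix A) *\<^sub>R v"
    "\<And>u. smallest_eigenvalue (Im_matrix A) * (norm u)\<^sup>2 \<le> (Im_matrix A *v u) \<bullet> u"
    by (rule smallest_eigenvalue_hermitian[OF ctranspose_Im_matrix[of A]]) (rule that, assumption+)
  show ?thesis
  proof (rule that[of v])
    show "norm v = 1" by (rule v(1))
    show "Im (cdot (A *v v) v) = Im_min A"
      unfolding inner_Im_matrix[symmetric] Im_min_def v(2) using v(1) by (simp add: dot_square_norm)
    show "Im_min A * (norm u)\<^sup>2 \<le> Im (cdot (A *v u) u)" for u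
      unfolding inner_Im_matrix[symmetric] Im_min_def by (rule v(3))
  qed
qed

lemma Im_min_le: "Im_min A * (norm u)\<^sup>2 \<le> Im (cdot (A *v u) u)"
  by (rule Im_min[of A]) simp

lemma Im_matrix_uminus: "Im_matrix (- A) = - Im_matrix A"
  by (simp add: Im_matrix_def ctranspose_def matrix_matrix_mult_def vec_eq_iff mat_def sum_negf[symmetric] algebra_simps)

lemma largest_eigenvalue_Im_matrix: "largest_eigenvalue (Im_matrix A) = - Im_min (- A)"
  unfolding largest_eigenvalue_eq_smallest_uminus[OF ctranspose_Im_matrix] Im_min_def Im_matrix_uminus ..

text \<open>A minimum of functions of \<open>A\<close> with a common Lipschitz constant. Continuity is needed for the
measurability of \<open>x \<mapsto> Im_min (Q x)\<close>, without which the essential supremum would have the default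
value \<open>\<infinity>\<close>.\<close>

lemma continuous_Im_min: "continuous_on UNIV (Im_min :: complex ^ 'n ^ 'n \<Rightarrow> real)"
proof -
  obtain K where K: "K > 0" "\<And>(A :: complex ^ 'n ^ 'n) u. norm (A *v u) \<le> norm A * norm u * K"
    using bounded_bilinear.pos_bounded[OF bounded_bilinear_matrix_vector_mult] by blast
  have le: "Im_min A \<le> Im_min B + K * norm (A - B)" for A B :: "complex ^ 'n ^ 'n"
  proof -
    obtain v where v: "norm v = 1" "Im (cdot (B *v v) v) = Im_min B"
      by (rule Im_min[of B])
    have "Im_min A \<le> Im (cdot (A *v v) v)" using Im_min_le[of A v] v(1) by simp
    also have "\<dots> = Im_min B + Im (cdot ((A - B) *v v) v)"
      by (simp add: mv_diff_left cdot_diff_left v(2)[symmetric])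
    also have "Im (cdot ((A - B) *v v) v) \<le> norm ((A - B) *v v) * norm v"
      by (rule order_trans[OF abs_ge_self order_trans[OF abs_Im_le_cmod norm_cdot_le]])
    also have "\<dots> \<le> K * norm (A - B)" using K(2)[of "A - B" v] v(1) by (simp add: mult.commute)
    finally show ?thesis by simp
  qed
  have "K-lipschitz_on UNIV (Im_min :: complex ^ 'n ^ 'n \<Rightarrow> real)"
    unfolding lipschitz_on_def dist_real_def dist_norm
  proof (intro conjI ballI)
    fix A B :: "complex ^ 'n ^ 'n"
    show "\<bar>Im_min A - Im_min B\<bar> \<le> K * norm (A - B)"
      using le[of A B] le[of B A] by (simp add: norm_minus_commute abs_le_iff)
  qed (use K in simp)
  then show ?thesis by (rule lipschitz_on_continuous_on)
qed

text \<open>The bound \<open>C\<close> keeps the essential supremum finite from both sides; from below because the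
half-line is not a null set.\<close>

lemma esssup_Im_min:
  fixes Q :: "real \<Rightarrow> complex ^ 'n ^ 'n"
  assumes Q: "L1_loc Q" and bd: "AE x in halfline. onorm ((*v) (Im_matrix (Q x))) \<le> C"
  obtains e where "esssup halfline (\<lambda>x. ereal (- Im_min (Q x))) = ereal e" "AE x in halfline. - e \<le> Im_min (Q x)"
proof -
  define f where "f x = - Im_min (Q x)" for x
  have f: "f \<in> borel_measurable halfline"
    unfolding f_def[abs_def]
    by (intro borel_measurable_uminus borel_measurable_continuous_on[OF continuous_Im_min] L1_loc_measurable Q)
  have b: "AE x in halfline. \<bar>f x\<bar> \<le> C"
    using bd
  proof eventually_elim
    case (elim x)
    obtain v where v: "norm v = 1" "Im (cdot (Q x *v v) v) = Im_min (Q x)" by (rule Im_min[of "Q x"])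
    have "\<bar>f x\<bar> = \<bar>(Im_matrix (Q x) *v v) \<bullet> v\<bar>" by (simp add: f_def inner_Im_matrix v(2))
    also have "\<dots> \<le> onorm ((*v) (Im_matrix (Q x)))"
      using Cauchy_Schwarz_ineq2[of "Im_matrix (Q x) *v v" v] onorm[OF mv_bounded_linear, of "Im_matrix (Q x)" v] v(1) by simp
    finally show ?case using elim by simp
  qed
  have m: "(\<lambda>x. ereal (f x)) \<in> borel_measurable halfline" using f by measurable
  have up: "esssup halfline (\<lambda>x. ereal (f x)) \<le> ereal C"
    by (rule esssup_I[OF m]) (use b in \<open>auto elim: eventually_mono\<close>)
  have "emeasure halfline (space halfline) \<noteq> 0"
  proof
    assume "emeasure halfline (space halfline) = 0"
    then have "emeasure lebesgue {0::real..} = 0" by (simp add: emeasure_restrict_space)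
    then have "negligible {0::real..}" by (simp add: negligible_iff_null_sets null_sets_def)
    then have "negligible {0<..<1::real}" by (rule negligible_subset) auto
    then show False using open_not_negligible[of "{0<..<1::real}"] by auto
  qed
  then have "esssup halfline (\<lambda>x. ereal (- C)) = ereal (- C)" by (rule esssup_const)
  moreover have "esssup halfline (\<lambda>x. ereal (- C)) \<le> esssup halfline (\<lambda>x. ereal (f x))"
    by (rule esssup_AE_mono) (use b in \<open>auto elim!: eventually_mono\<close>)
  ultimately have lo: "ereal (- C) \<le> esssup halfline (\<lambda>x. ereal (f x))" by simp
  obtain e where e: "esssup halfline (\<lambda>x. ereal (f x)) = ereal e"
    using up lo by (cases "esssup halfline (\<lambda>x. ereal (f x))") auto
  have "AE x in halfline. ereal (f x) \<le> ereal e" using esssup_AE[of "\<lambda>x. ereal (f x)" halfline] by (simp only: e)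
  then have "AE x in halfline. - e \<le> Im_min (Q x)" by eventually_elim (simp add: f_def)
  then show ?thesis using that e unfolding f_def by blast
qed

lemma Im_bounds_alpha_beta:
  fixes Q :: "real \<Rightarrow> complex ^ 'n ^ 'n"
  assumes Q: "L1_loc Q" and bd: "AE x in halfline. onorm ((*v) (Im_matrix (Q x))) \<le> C"
  shows "Im_bounds Q (alpha Q) (beta Q)"
proof -
  obtain e where e: "esssup halfline (\<lambda>x. ereal (- Im_min (Q x))) = ereal e" "AE x in halfline. - e \<le> Im_min (Q x)"
    by (rule esssup_Im_min[OF Q bd])
  have Q': "L1_loc (\<lambda>x. - Q x)" by (rule L1_loc_linear[OF Q bounded_linear_minus[OF bounded_linear_ident]])
  have "AE x in halfline. onorm ((*v) (Im_matrix (- Q x))) \<le> C"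
    using bd unfolding Im_matrix_uminus mv_minus_left[abs_def] onorm_neg .
  then obtain e' where e': "esssup halfline (\<lambda>x. ereal (- Im_min (- Q x))) = ereal e'" "AE x in halfline. - e' \<le> Im_min (- Q x)"
    by (rule esssup_Im_min[OF Q'])
  have a: "alpha Q = - e" using e(1) by (simp add: alpha_def Im_min_def)
  have b: "beta Q = e'" using e'(1) by (simp add: beta_def largest_eigenvalue_Im_matrix)
  show ?thesis
    unfolding Im_bounds_def a b using e(2) e'(2)
  proof eventually_elim
    case (elim x)
    show ?case
    proof (intro allI conjI)
      fix u
      show "- e * (norm u)\<^sup>2 \<le> Im (cdot (Q x *v u) u)"
        using mult_right_mono[OF elim(1), of "(norm u)\<^sup>2"] Im_min_le[of "Q x" u] by simp
      have "- e' * (norm u)\<^sup>2 \<le> Im (cdot ((- Q x) *v u) u)"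
        using mult_right_mono[OF elim(2), of "(norm u)\<^sup>2"] Im_min_le[of "- Q x" u] by simp
      then show "Im (cdot (Q x *v u) u) \<le> e' * (norm u)\<^sup>2"
        by (simp add: mv_minus_left cdot_minus_left)
    qed
  qed
qed

section \<open>Dirac operators with separated boundary conditions\<close>

theorem theorem4p12:
  fixes Q :: "real \<Rightarrow> complex ^ ('p :: finite + 'p) ^ ('p + 'p)"
    and \<Phi> :: "complex ^ 'p ^ 'p"
  assumes "L1_loc Q"
    and "\<exists>C. AE x in halfline. onorm ((*v) (Im_matrix (Q x))) \<le> C"
    and "ctranspose \<Phi> = \<Phi>"
  shows "(quasi_selfadjoint (D_min Q) (D_min (\<lambda>x. ctranspose (Q x))) (D_bc Q \<Phi>)
      \<and> (\<forall>(f, g)\<in>D_bc Q \<Phi>. alpha Q * (norm f)\<^sup>2 \<le> Im (cinner_L2 g f)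
           \<and> Im (cinner_L2 g f) \<le> beta Q * (norm f)\<^sup>2)
      \<and> {z. Im z < alpha Q} \<union> {z. Im z > beta Q} \<subseteq> resolvent_set (D_bc Q \<Phi>))
    \<and> (\<forall>l\<in>resolvent_set (D_bc Q \<Phi>).
      let P = (\<lambda>v :: real \<Rightarrow> complex ^ 'p ^ ('p + 'p).
                matrix_solution Q l v
                \<and> (\<forall>h. square_integrable (\<lambda>t. v t *v h))
                \<and> cos_matrix \<Phi> ** upper (v 0) + sin_matrix \<Phi> ** lower (v 0) = mat 1)
      in \<exists>v. P v \<and> (\<forall>w. P w \<longrightarrow> (\<forall>t\<ge>0. w t = v t)))"
proof -
  interpret lagrangian "cos_matrix \<Phi>" "sin_matrix \<Phi>" by (rule lagrangian_cos_sin[OF assms(3)])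
  have D: "D_bc Q \<Phi> = boundary_op Q boundary"
    unfolding boundary_def by (rule D_bc_eq_boundary_op[OF assms(1)])
  obtain C where "AE x in halfline. onorm ((*v) (Im_matrix (Q x))) \<le> C" using assms(2) by blast
  then have b: "Im_bounds Q (alpha Q) (beta Q)" by (rule Im_bounds_alpha_beta[OF assms(1)])
  show ?thesis
    unfolding D Let_def
    using quasi_selfadjoint_boundary_op[OF assms(1) b] numerical_range_boundary_op[OF assms(1) b]
      resolvent_set_boundary_op[OF assms(1) b] resolvent_matrix_solution[OF assms(1)]
    by blast
qed

end
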